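(* Let $k>0$ and let $M\ge 1$ source points ${\bf x}_1,\dots,{\bf x}_M\in\mathbb{R}^2$ be given, together with radii $a_m>0$ satisfying $|{\bf x}_m|>a_m$ for all $m$. Let $C\subset\mathbb{R}^2$ be a bounded connected open region containing a neighbourhood of the origin and containing none of the points ${\bf x}_m$. Consider an incident field and an active source field of the forms $$u_i({\bf x})=\sum_{n=-\infty}^{\infty}A_n\,U_n^{+}({\bf x}),\qquad u_d({\bf x})=\sum_{m=1}^{M}\sum_{n=-\infty}^{\infty}b_{m,n}\,V_n^{+}({\bf x}-{\bf x}_m),$$ with complex coefficients $A_n$, $b_{m,n}$ (all series assumed convergent). Then the two requirements (i) the total field vanishes in $C$, i.e. $u_i+u_d=0$ in $C$, and (ii) $u_d$ radiates nothing, i.e. its far-field amplitude $f(\theta)$, defined by $u_d({\bf x})=f(\theta)\,e^{ik|{\bf x}|}(k|{\bf x}|)^{-1/2}+O((k|{\bf x}|)^{-3/2})$ as $|{\bf x}|\to\infty$ with $\theta=\arg{\bf x}$, vanishes identically, hold if and only if, for every $n\in\mathbb{Z}$, $$\sum_{m=1}^{M}\sum_{l=-\infty}^{\infty}b_{m,l}\,U_{n-l}^{-}({\bf x}_m)=0\qquad\text{and}\qquad \sum_{m=1}^{M}\sum_{l=-\infty}^{\infty}b_{m,l}\,V_{n-l}^{-}({\bf x}_m)=-A_n .$$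
   Context: For ${\bf x}\in\mathbb{R}^2$, $\arg{\bf x}\in[0,2\pi)$ denotes the polar angle, and the wave functions are $U_n^{\pm}({\bf x})=J_n(k|{\bf x}|)\,e^{\pm i n\arg{\bf x}}$ and $V_n^{\pm}({\bf x})=H_n^{(1)}(k|{\bf x}|)\,e^{\pm i n\arg{\bf x}}$, where $J_n$ is the Bessel function and $H_n^{(1)}$ the Hankel function of the first kind of order $n$. All fields are time-harmonic solutions of the 2D Helmholtz equation $\nabla^2u+k^2u=0$ away from sources. *)

theory Defs
  imports "HOL-Analysis.Analysis" "HOL-Library.Landau_Symbols"
begin

text \<open>Points of the plane are represented as complex numbers.
  Polar angle in [0, 2 pi).\<close>
definition polar_angle :: "complex \<Rightarrow> real" where
  "polar_angle z = (if Arg z < 0 then Arg z + 2 * pi else Arg z)"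

definition besselJ_nat :: "nat \<Rightarrow> real \<Rightarrow> real" where
  "besselJ_nat n x = (\<Sum>j. (-1) ^ j / (fact j * fact (j + n)) * (x / 2) ^ (2 * j + n))"

definition besselJ :: "int \<Rightarrow> real \<Rightarrow> real" where
  "besselJ n x = (if n \<ge> 0 then besselJ_nat (nat n) x
                  else (-1) ^ nat (- n) * besselJ_nat (nat (- n)) x)"

text \<open>Bessel function of the second kind, integer order, x > 0 (DLMF 10.8.1;
  Y_{-n} = (-1)^n Y_n).\<close>
definition besselY_nat :: "nat \<Rightarrow> real \<Rightarrow> real" where
  "besselY_nat n x =
     - ((x / 2) powr (- real n) / pi) *
         (\<Sum>j<n. fact (n - j - 1) / fact j * (x\<^sup>2 / 4) ^ j)
     + (2 / pi) * ln (x / 2) * besselJ_nat n x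
     - ((x / 2) ^ n / pi) *
         (\<Sum>j. (Digamma (real (j + 1)) + Digamma (real (n + j + 1))) *
                (- (x\<^sup>2 / 4)) ^ j / (fact j * fact (n + j)))"

definition besselY :: "int \<Rightarrow> real \<Rightarrow> real" where
  "besselY n x = (if n \<ge> 0 then besselY_nat (nat n) x
                  else (-1) ^ nat (- n) * besselY_nat (nat (- n)) x)"

definition hankel1 :: "int \<Rightarrow> real \<Rightarrow> complex" where
  "hankel1 n x = Complex (besselJ n x) (besselY n x)"

definition Uplus :: "real \<Rightarrow> int \<Rightarrow> complex \<Rightarrow> complex" where
  "Uplus k n x = complex_of_real (besselJ n (k * cmod x)) * exp (\<i> * of_int n * of_real (polar_angle x))"

definition Uminus :: "real \<Rightarrow> int \<Rightarrow> complex \<Rightarrow> complex" where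
  "Uminus k n x = complex_of_real (besselJ n (k * cmod x)) * exp (- \<i> * of_int n * of_real (polar_angle x))"

definition Vplus :: "real \<Rightarrow> int \<Rightarrow> complex \<Rightarrow> complex" where
  "Vplus k n x = hankel1 n (k * cmod x) * exp (\<i> * of_int n * of_real (polar_angle x))"

definition Vminus :: "real \<Rightarrow> int \<Rightarrow> complex \<Rightarrow> complex" where
  "Vminus k n x = hankel1 n (k * cmod x) * exp (- \<i> * of_int n * of_real (polar_angle x))"

definition far_field_amplitude :: "real \<Rightarrow> (complex \<Rightarrow> complex) \<Rightarrow> (real \<Rightarrow> complex) \<Rightarrow> bool" where
  "far_field_amplitude k u f \<longleftrightarrow>
     (\<lambda>x. u x - f (polar_angle x) * exp (\<i> * of_real (k * cmod x)) * of_real ((k * cmod x) powr (-1/2)))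
       \<in> O[at_infinity](\<lambda>x. of_real ((k * cmod x) powr (-3/2)))"

end

theory Submission
  imports Defs "HOL-Complex_Analysis.Complex_Analysis" "HOL-Real_Asymp.Real_Asymp"
begin

text \<open>In the variables \<open>z = k x / 2\<close> and \<open>w = cnj z\<close>, regarded as independent, the wave functions
  satisfy \<open>\<partial>\<^sub>z W\<^sub>l = W\<^sub>l\<^sub>-\<^sub>1\<close> and \<open>\<partial>\<^sub>w W\<^sub>l = - W\<^sub>l\<^sub>+\<^sub>1\<close>. Hence Graf's addition theorem is the Taylor expansion
  of the holomorphic function \<open>t \<mapsto> V\<^sub>l (y + t x)\<close>, regrouped by the angular index. Inserted into \<open>u\<^sub>d\<close>
  it yields an expansion in the \<open>U\<^sub>n\<close> near the origin, with the coefficients of the second condition,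
  and one in the \<open>V\<^sub>n\<close> near infinity, with those of the first. Near the origin, uniqueness
  of Fourier coefficients and unique continuation along \<open>C\<close> give the equivalence with (i). At infinity
  it remains to know that no \<open>H\<^sub>n (r)\<close> is \<open>O(r powr (-3/2))\<close>, which the Wronskian of \<open>J\<^sub>n\<close> and \<open>H\<^sub>n\<close> shows.\<close>

text \<open>The obstacle is the interchange of sums. Convergence is assumed only at points, while an
  expansion about another centre rearranges a triple series over the order \<open>l\<close> and two
  Taylor exponents \<open>p\<close>, \<open>q\<close>. Sums over \<open>UNIV\<close> converge
  unconditionally, hence absolutely, so convergence at one nonzero point \<open>z\<close> can be
  traded for a weight on the coefficients: with \<open>n = nat \<bar>l\<bar>\<close>, large orders
  of \<open>wave_U l z\<close> have size \<open>cmod z ^ n / fact n\<close>, those of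
  \<open>wave_V l z\<close> size \<open>fact n / cmod z ^ n\<close> up to a factor
  \<open>1 / n\<close>. A slightly larger radius \<sigma> pays for that factor, and the gap between
  \<open>cmod x + \<sigma>\<close> and \<open>cmod y\<close> makes the triple series converge
  absolutely. A wave is moreover not holomorphic in its point. Once \<open>w\<close> is free of
  \<open>cnj z\<close>, it is holomorphic in the parameter \<open>t\<close> of a complexified line,
  which serves the Taylor expansion and the unique continuation alike. Only the logarithm in
  \<open>Y\<close> needs a branch; it exists on the disc where \<open>1 + t * (x / y)\<close> and
  \<open>1 + t * cnj (x / y)\<close> stay in the right half-plane.\<close>

section \<open>Bessel--Clifford functions\<close>

text \<open>\<open>J\<^sub>n (2 r) = r ^ n * clifford n (r\<^sup>2)\<close>; the other two functions are the digamma series and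
  the finite sum in \<open>Y\<^sub>n (2 r)\<close>.\<close>
definition clifford :: "nat \<Rightarrow> complex \<Rightarrow> complex" where
  "clifford n s = (\<Sum>j. (-1) ^ j / (fact j * fact (n + j)) * s ^ j)"

definition clifford_psi :: "nat \<Rightarrow> complex \<Rightarrow> complex" where
  "clifford_psi n s = (\<Sum>j. of_real (Digamma (real (j + 1)) + Digamma (real (n + j + 1)))
     * ((-1) ^ j / (fact j * fact (n + j))) * s ^ j)"

definition clifford_pol :: "nat \<Rightarrow> complex \<Rightarrow> complex" where
  "clifford_pol n s = (\<Sum>j<n. fact (n - j - 1) / fact j * s ^ j)"

text \<open>The recurrence adds at most 1 per step, starting from minus Euler's constant. Linear
  growth is crude, but the coefficients of \<open>clifford_psi\<close> have a factorial to
  spare.\<close>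

lemma abs_Digamma_le: "\<bar>Digamma (real (j + 1))\<bar> \<le> real (j + 1)"
proof (induction j)
  case 0
  show ?case
    using euler_mascheroni_pos euler_mascheroni_less_13_over_22 by simp
next
  case (Suc j)
  have "Digamma (real (Suc j + 1)) = Digamma (real (j + 1)) + 1 / real (j + 1)"
    using Digamma_plus1[of "real (j + 1)"] by (simp add: add_ac)
  moreover have "\<bar>1 / real (j + 1)\<bar> \<le> 1" by (simp add: divide_simps)
  ultimately show ?case using Suc by linarith
qed

lemma norm_clifford_coeff_le:
  "norm ((-1) ^ j / (fact j * fact (n + j)) * s ^ j :: complex) \<le> norm s ^ j / fact j / fact n"
proof -
  have "(fact n :: real) \<le> fact (n + j)" by (simp add: fact_mono)
  then have "norm s ^ j / (fact j * fact (n + j)) \<le> norm s ^ j / (fact j * fact n)"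
    by (intro divide_left_mono mult_left_mono mult_pos_pos) auto
  then show ?thesis
    by (simp add: norm_mult norm_divide norm_power)
qed

lemma Suc_le_two_fact: "real (m + 1) \<le> 2 * fact m"
proof (induction m)
  case (Suc m)
  have "real m \<le> real m * fact m"
    using fact_ge_1[of m] by (simp add: mult_le_cancel_left1)
  moreover have "(1 :: real) \<le> fact m" by (rule fact_ge_1)
  ultimately have "real m \<le> real m * fact m \<and> (1 :: real) \<le> fact m" by simp
  moreover have "2 * fact (Suc m) = 2 * fact m + 2 * (real m * fact m)" by (simp add: algebra_simps)
  ultimately show ?case by linarith
qed simp

text \<open>The factor \<open>fact (n + j)\<close> is spent on the digamma values, leaving an
  exponential series with a bound uniform in \<open>n\<close>.\<close>

lemma norm_clifford_psi_coeff_le: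
  "norm (of_real (Digamma (real (j + 1)) + Digamma (real (n + j + 1)))
     * ((-1) ^ j / (fact j * fact (n + j))) * s ^ j :: complex) \<le> 4 * (norm s ^ j / fact j)"
proof -
  have "\<bar>Digamma (real (j + 1)) + Digamma (real (n + j + 1))\<bar> \<le> real (j + 1) + real (n + j + 1)"
    using abs_Digamma_le[of j] abs_Digamma_le[of "n + j"] by linarith
  also have "\<dots> \<le> 2 * real (n + j + 1)" by simp
  also have "\<dots> \<le> 4 * fact (n + j)" using Suc_le_two_fact[of "n + j"] by simp
  finally have D: "\<bar>Digamma (real (j + 1)) + Digamma (real (n + j + 1))\<bar> / fact (n + j) \<le> 4"
    by (simp add: divide_simps)
  have "norm (of_real (Digamma (real (j + 1)) + Digamma (real (n + j + 1)))
     * ((-1) ^ j / (fact j * fact (n + j))) * s ^ j :: complex)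
    = \<bar>Digamma (real (j + 1)) + Digamma (real (n + j + 1))\<bar> / fact (n + j) * (norm s ^ j / fact j)"
    by (simp only: norm_mult norm_divide norm_power norm_of_real norm_fact) simp
  also have "\<dots> \<le> 4 * (norm s ^ j / fact j)"
    by (intro mult_right_mono D) auto
  finally show ?thesis .
qed

lemma sums_exp_real: "(\<lambda>j. x ^ j / fact j) sums exp (x :: real)"
  using exp_converges[of x] by (simp add: divide_inverse mult_ac)

lemma summable_clifford: "summable (\<lambda>j. (-1) ^ j / (fact j * fact (n + j)) * s ^ j :: complex)"
  by (rule summable_comparison_test'[OF summable_divide[OF sums_summable[OF sums_exp_real]]])
     (rule norm_clifford_coeff_le)

lemma summable_clifford_psi:
  "summable (\<lambda>j. of_real (Digamma (real (j + 1)) + Digamma (real (n + j + 1)))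
     * ((-1) ^ j / (fact j * fact (n + j))) * s ^ j :: complex)"
  by (rule summable_comparison_test'[OF summable_mult[OF sums_summable[OF sums_exp_real]]])
     (rule norm_clifford_psi_coeff_le)

lemma norm_clifford_le: "norm (clifford n s) \<le> exp (norm s) / fact n"
  unfolding clifford_def
  by (rule order_trans[OF norm_suminf_le[OF norm_clifford_coeff_le]])
     (use sums_divide[OF sums_exp_real] in \<open>auto simp: sums_iff\<close>)

lemma norm_clifford_psi_le: "norm (clifford_psi n s) \<le> 4 * exp (norm s)"
  unfolding clifford_psi_def
  by (rule order_trans[OF norm_suminf_le[OF norm_clifford_psi_coeff_le]])
     (use sums_mult[OF sums_exp_real] in \<open>auto simp: sums_iff\<close>)

lemma norm_clifford_pol_le: "norm (clifford_pol n s) \<le> fact (n - 1) * exp (norm s)"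
proof -
  have "norm (clifford_pol n s) \<le> (\<Sum>j<n. fact (n - 1) * (norm s ^ j / fact j))"
    unfolding clifford_pol_def
  proof (rule order_trans[OF norm_sum sum_mono])
    fix j
    have "(fact (n - j - 1) :: real) \<le> fact (n - 1)" by (intro fact_mono) auto
    then show "norm (fact (n - j - 1) / fact j * s ^ j) \<le> fact (n - 1) * (norm s ^ j / fact j)"
      by (auto simp: norm_mult norm_divide norm_power divide_simps mult_ac intro!: mult_left_mono)
  qed
  also have "\<dots> = fact (n - 1) * (\<Sum>j<n. norm s ^ j / fact j)"
    by (simp add: sum_distrib_left)
  also have "\<dots> \<le> fact (n - 1) * exp (norm s)"
    by (intro mult_left_mono sum_le_suminf[THEN order_trans])
       (use sums_exp_real[of "norm s"] in \<open>auto simp: sums_iff\<close>)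
  finally show ?thesis .
qed

lemma clifford_0 [simp]: "clifford n 0 = 1 / fact n"
  unfolding clifford_def by (subst powser_zero) simp

lemma DERIV_clifford: "(clifford n has_field_derivative - clifford (Suc n) s) (at s)"
proof -
  have "((\<lambda>s. clifford n s) has_field_derivative
      (\<Sum>j. diffs (\<lambda>j. (-1) ^ j / (fact j * fact (n + j))) j * s ^ j)) (at s)"
    unfolding clifford_def
    by (rule termdiffs_strong_converges_everywhere) (rule summable_clifford)
  also have "(\<Sum>j. diffs (\<lambda>j. (-1) ^ j / (fact j * fact (n + j))) j * s ^ j)
    = (\<Sum>j. - ((-1) ^ j / (fact j * fact (Suc n + j)) * s ^ j))"
    by (intro suminf_cong) (auto simp: diffs_def divide_simps simp del: of_nat_Suc)
  also have "\<dots> = - clifford (Suc n) s"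
    unfolding clifford_def by (rule suminf_minus[OF summable_clifford])
  finally show ?thesis .
qed

text \<open>The Euler operator \<open>s * d/ds\<close> keeps the exponent of each monomial, so
  recurrences can be proved coefficient by coefficient.\<close>

lemma powser_times_index_sums:
  fixes c :: "nat \<Rightarrow> complex"
  assumes "\<And>s. summable (\<lambda>j. c j * s ^ j)"
    and "((\<lambda>s. \<Sum>j. c j * s ^ j) has_field_derivative D) (at s)"
  shows "(\<lambda>j. of_nat j * c j * s ^ j) sums (s * D)"
proof -
  have sm: "summable (\<lambda>n. diffs c n * s ^ n)"
    using assms(1) by (rule termdiff_converges_all)
  have "(\<lambda>j. s * (of_nat j * c j * s ^ (j - Suc 0))) sums (s * (\<Sum>n. diffs c n * s ^ n))"
    by (intro sums_mult diffs_equiv sm)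
  moreover have "(\<Sum>n. diffs c n * s ^ n) = D"
    using DERIV_unique termdiffs_strong_converges_everywhere[OF assms(1)] assms(2) by blast
  moreover have "s * (of_nat j * c j * s ^ (j - Suc 0)) = of_nat j * c j * s ^ j" for j
    by (cases j) auto
  ultimately show ?thesis by simp
qed

text \<open>The factor \<open>n + 1 + j\<close> produced by \<open>n + 1\<close> and the Euler
  operator cancels the last factor of \<open>fact (Suc n + j)\<close>.\<close>

lemma clifford_rec: "clifford n s = of_nat (Suc n) * clifford (Suc n) s - s * clifford (Suc (Suc n)) s"
proof -
  have "(\<lambda>j. of_nat j * ((-1) ^ j / (fact j * fact (Suc n + j))) * s ^ j) sums (s * - clifford (Suc (Suc n)) s)"
    by (rule powser_times_index_sums[OF summable_clifford])
       (use DERIV_clifford[of "Suc n" s] in \<open>simp add: clifford_def[abs_def]\<close>)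
  moreover have "(\<lambda>j. of_nat (Suc n) * ((-1) ^ j / (fact j * fact (Suc n + j)) * s ^ j))
     sums (of_nat (Suc n) * clifford (Suc n) s)"
    unfolding clifford_def by (intro sums_mult summable_sums summable_clifford)
  ultimately have "(\<lambda>j. of_nat (Suc n) * ((-1) ^ j / (fact j * fact (Suc n + j)) * s ^ j)
      + of_nat j * ((-1) ^ j / (fact j * fact (Suc n + j))) * s ^ j)
     sums (of_nat (Suc n) * clifford (Suc n) s + s * - clifford (Suc (Suc n)) s)"
    by (intro sums_add)
  also have "(\<lambda>j. of_nat (Suc n) * ((-1) ^ j / (fact j * fact (Suc n + j)) * s ^ j)
      + of_nat j * ((-1) ^ j / (fact j * fact (Suc n + j))) * s ^ j)
     = (\<lambda>j. (-1) ^ j / (fact j * fact (n + j)) * s ^ j)"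
  proof
    fix j
    have "(fact (Suc n + j) :: complex) = (of_nat (Suc n) + of_nat j) * fact (n + j)"
      by (simp add: algebra_simps)
    moreover have "of_nat (Suc n) + of_nat j \<noteq> (0 :: complex)"
      by (metis add_Suc of_nat_add of_nat_neq_0)
    ultimately show "of_nat (Suc n) * ((-1) ^ j / (fact j * fact (Suc n + j)) * s ^ j)
      + of_nat j * ((-1) ^ j / (fact j * fact (Suc n + j))) * s ^ j
      = (-1) ^ j / (fact j * fact (n + j)) * s ^ j"
      by (simp add: divide_simps del: of_nat_Suc) (simp add: algebra_simps)
  qed
  finally have "clifford n s = of_nat (Suc n) * clifford (Suc n) s + s * - clifford (Suc (Suc n)) s"
    unfolding clifford_def[of n] by (rule sums_unique[symmetric])
  then show ?thesis by simp
qed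

text \<open>Only \<open>s\<close> times this derivative has an expression free of division, see
  \<open>times_clifford_psi'\<close>; hence a name of its own.\<close>

definition clifford_psi' :: "nat \<Rightarrow> complex \<Rightarrow> complex" where
  "clifford_psi' n s = deriv (clifford_psi n) s"

lemma DERIV_clifford_psi: "(clifford_psi n has_field_derivative clifford_psi' n s) (at s)"
proof -
  have "\<exists>D. ((\<lambda>s. clifford_psi n s) has_field_derivative D) (at s)"
    unfolding clifford_psi_def
    by (rule exI, rule termdiffs_strong_converges_everywhere, rule summable_clifford_psi)
  then show ?thesis unfolding clifford_psi'_def using DERIV_imp_deriv by blast
qed

text \<open>Shifting the series by one index turns \<open>Digamma (j + 2)\<close> into
  \<open>Digamma (j + 1) + 1 / (j + 1)\<close>. The reciprocals add up to
  \<open>clifford n s\<close> less its constant term \<open>1 / fact n\<close>, which the shift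
  loses.\<close>

lemma times_clifford_psi':
  "s * clifford_psi' n s = - s * clifford_psi (Suc n) s + clifford n s - 1 / fact n"
proof -
  let ?d = "\<lambda>n j. of_real (Digamma (real (j + 1)) + Digamma (real (n + j + 1))) :: complex"
  let ?c = "\<lambda>n j. (-1) ^ j / (fact j * fact (n + j)) :: complex"
  have "(\<lambda>j. of_nat j * (?d n j * ?c n j) * s ^ j) sums (s * clifford_psi' n s)"
    by (rule powser_times_index_sums[OF summable_clifford_psi])
       (use DERIV_clifford_psi[of n s] in \<open>simp only: clifford_psi_def[abs_def]\<close>)
  then have "(\<lambda>j. of_nat (Suc j) * (?d n (Suc j) * ?c n (Suc j)) * s ^ Suc j) sums (s * clifford_psi' n s)"
    by (subst sums_Suc_iff) simp
  moreover have "(\<lambda>j. s * (?d (Suc n) j * ?c (Suc n) j * s ^ j)) sums (s * clifford_psi (Suc n) s)"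
    unfolding clifford_psi_def by (intro sums_mult summable_sums summable_clifford_psi)
  moreover have "(\<lambda>j. ?c n (Suc j) * s ^ Suc j) sums (clifford n s - 1 / fact n)"
    using summable_sums[OF summable_clifford[of n s]]
    by (subst sums_Suc_iff) (simp add: clifford_def)
  ultimately have "(\<lambda>j. of_nat (Suc j) * (?d n (Suc j) * ?c n (Suc j)) * s ^ Suc j
      + s * (?d (Suc n) j * ?c (Suc n) j * s ^ j) - ?c n (Suc j) * s ^ Suc j)
    sums (s * clifford_psi' n s + s * clifford_psi (Suc n) s - (clifford n s - 1 / fact n))"
    by (intro sums_add sums_diff)
  moreover have "of_nat (Suc j) * (?d n (Suc j) * ?c n (Suc j)) * s ^ Suc j
      + s * (?d (Suc n) j * ?c (Suc n) j * s ^ j) - ?c n (Suc j) * s ^ Suc j = 0" for j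
  proof -
    have "Digamma (real (Suc j + 1)) = Digamma (real (j + 1)) + 1 / real (j + 1)"
      using Digamma_plus1[of "real (j + 1)"] by (simp add: add_ac)
    then have d: "?d n (Suc j) = ?d (Suc n) j + 1 / of_nat (Suc j)"
      by (simp add: add_ac)
    have c: "of_nat (Suc j) * ?c n (Suc j) = - ?c (Suc n) j"
      by (simp add: divide_simps del: of_nat_Suc)
    have gen: "a * ((d + 1 / a) * c) = d * (a * c) + c" if "a \<noteq> 0" for a c d :: complex
      using that by (simp add: field_simps)
    have A: "of_nat (Suc j) * (?d n (Suc j) * ?c n (Suc j)) = ?d (Suc n) j * (of_nat (Suc j) * ?c n (Suc j)) + ?c n (Suc j)"
      unfolding d by (rule gen) (rule of_nat_neq_0)
    have "x * (s * t) + s * (d * e * t) - f * (s * t) = 0" if "x = d * - e + f" for x d e f t :: complex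
      unfolding that by (simp add: algebra_simps)
    from this[of "of_nat (Suc j) * (?d n (Suc j) * ?c n (Suc j))" "?d (Suc n) j" "?c (Suc n) j" "?c n (Suc j)" "s ^ j", OF A[unfolded c]]
    show ?thesis
      by (simp only: power_Suc)
  qed
  ultimately have "(\<lambda>j. 0) sums (s * clifford_psi' n s + s * clifford_psi (Suc n) s - (clifford n s - 1 / fact n))"
    by (simp only:)
  then have "s * clifford_psi' n s + s * clifford_psi (Suc n) s - (clifford n s - 1 / fact n) = 0"
    by (rule sums_unique2[OF _ sums_zero])
  then show ?thesis by (simp add: algebra_simps)
qed

text \<open>Here the increment comes from the second digamma value: its
  \<open>1 / (n + 1 + j)\<close> cancels the factor \<open>n + 1 + j\<close> and leaves the series
  of \<open>clifford (Suc n)\<close>.\<close>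

lemma clifford_psi_rec':
  "of_nat (Suc n) * clifford_psi (Suc n) s + s * clifford_psi' (Suc n) s
    = clifford_psi n s + clifford (Suc n) s"
proof -
  let ?d = "\<lambda>n j. of_real (Digamma (real (j + 1)) + Digamma (real (n + j + 1))) :: complex"
  let ?c = "\<lambda>n j. (-1) ^ j / (fact j * fact (n + j)) :: complex"
  have "(\<lambda>j. of_nat j * (?d (Suc n) j * ?c (Suc n) j) * s ^ j) sums (s * clifford_psi' (Suc n) s)"
    by (rule powser_times_index_sums[OF summable_clifford_psi])
       (use DERIV_clifford_psi[of "Suc n" s] in \<open>simp only: clifford_psi_def[abs_def]\<close>)
  moreover have "(\<lambda>j. of_nat (Suc n) * (?d (Suc n) j * ?c (Suc n) j * s ^ j))
      sums (of_nat (Suc n) * clifford_psi (Suc n) s)"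
    unfolding clifford_psi_def by (intro sums_mult summable_sums summable_clifford_psi)
  ultimately have "(\<lambda>j. of_nat (Suc n) * (?d (Suc n) j * ?c (Suc n) j * s ^ j)
       + of_nat j * (?d (Suc n) j * ?c (Suc n) j) * s ^ j)
      sums (of_nat (Suc n) * clifford_psi (Suc n) s + s * clifford_psi' (Suc n) s)"
    by (intro sums_add)
  moreover have "of_nat (Suc n) * (?d (Suc n) j * ?c (Suc n) j * s ^ j)
       + of_nat j * (?d (Suc n) j * ?c (Suc n) j) * s ^ j
    = ?d n j * ?c n j * s ^ j + ?c (Suc n) j * s ^ j" for j
  proof -
    have "Digamma (real (Suc n + j + 1)) = Digamma (real (n + j + 1)) + 1 / real (n + j + 1)"
      using Digamma_plus1[of "real (n + j + 1)"] by (simp add: add_ac)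
    then have d: "?d (Suc n) j = ?d n j + 1 / of_nat (Suc (n + j))"
      by (simp add: add_ac)
    have c: "of_nat (Suc (n + j)) * ?c (Suc n) j = ?c n j"
      by (simp add: divide_simps del: of_nat_Suc)
    have gen: "x * (d * c * t) + y * (d * c) * t = d * ((x + y) * c) * t" for x y c d t :: complex
      by (simp add: algebra_simps)
    have gen2: "(d + 1 / a) * (a * c) * t = d * (a * c) * t + c * t" if "a \<noteq> 0" for a c d t :: complex
      using that by (simp add: field_simps)
    have "of_nat (Suc n) * (?d (Suc n) j * ?c (Suc n) j * s ^ j)
       + of_nat j * (?d (Suc n) j * ?c (Suc n) j) * s ^ j
      = ?d (Suc n) j * ((of_nat (Suc n) + of_nat j) * ?c (Suc n) j) * s ^ j"
      by (rule gen)
    also have "of_nat (Suc n) + of_nat j = (of_nat (Suc (n + j)) :: complex)"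
      by simp
    also have "?d (Suc n) j * (of_nat (Suc (n + j)) * ?c (Suc n) j) * s ^ j
      = ?d n j * (of_nat (Suc (n + j)) * ?c (Suc n) j) * s ^ j + ?c (Suc n) j * s ^ j"
      unfolding d by (rule gen2) (rule of_nat_neq_0)
    finally show ?thesis unfolding c .
  qed
  ultimately have "(\<lambda>j. ?d n j * ?c n j * s ^ j + ?c (Suc n) j * s ^ j)
      sums (of_nat (Suc n) * clifford_psi (Suc n) s + s * clifford_psi' (Suc n) s)"
    by simp
  moreover have "(\<lambda>j. ?d n j * ?c n j * s ^ j + ?c (Suc n) j * s ^ j)
      sums (clifford_psi n s + clifford (Suc n) s)"
    unfolding clifford_psi_def clifford_def
    by (intro sums_add summable_sums summable_clifford_psi summable_clifford)
  ultimately show ?thesis by (rule sums_unique2)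
qed

lemma clifford_pol_0 [simp]: "clifford_pol 0 s = 0"
  and clifford_pol_1 [simp]: "clifford_pol (Suc 0) s = 1"
  by (simp_all add: clifford_pol_def)

lemma DERIV_clifford_pol: "(clifford_pol (Suc n) has_field_derivative clifford_pol n s) (at s)"
proof -
  have "(clifford_pol (Suc n) has_field_derivative
      (\<Sum>j<Suc n. fact (n - j) / fact j * (of_nat j * s ^ (j - 1)))) (at s)"
    unfolding clifford_pol_def[abs_def]
    by (auto intro!: derivative_eq_intros sum.cong)
  also have "(\<Sum>j<Suc n. fact (n - j) / fact j * (of_nat j * s ^ (j - 1))) = clifford_pol n s"
    unfolding clifford_pol_def by (subst sum.lessThan_Suc_shift) (auto intro!: sum.cong simp: divide_simps of_nat_neq_0[simplified])
  finally show ?thesis .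
qed

text \<open>The last term is the top coefficient of \<open>clifford_pol (Suc (Suc n))\<close>, which
  the shorter sums do not reach. It later cancels the \<open>1 / fact\<close> left over in the
  recurrences of \<open>clifford_psi\<close>.\<close>

lemma clifford_pol_rec:
  "clifford_pol (Suc (Suc n)) s = of_nat (Suc n) * clifford_pol (Suc n) s - s * clifford_pol n s
     + s ^ Suc n / fact (Suc n)"
proof -
  have "s * clifford_pol n s = (\<Sum>j<n. of_nat (Suc j) * (fact (n - j - 1) / fact (Suc j) * s ^ Suc j))"
    unfolding clifford_pol_def sum_distrib_left by (intro sum.cong) (auto simp: divide_simps of_nat_neq_0[simplified])
  also have "\<dots> = (\<Sum>j<Suc n. of_nat j * (fact (n - j) / fact j * s ^ j))"
    by (subst sum.lessThan_Suc_shift) (auto intro!: sum.cong)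
  finally have 1: "s * clifford_pol n s = (\<Sum>j<Suc n. of_nat j * (fact (n - j) / fact j * s ^ j))" .
  have "of_nat (Suc n) * clifford_pol (Suc n) s - s * clifford_pol n s
      = (\<Sum>j<Suc n. of_nat (Suc n - j) * (fact (n - j) / fact j * s ^ j))"
    unfolding 1 unfolding clifford_pol_def sum_distrib_left sum_subtractf[symmetric]
    by (intro sum.cong) (auto simp: of_nat_diff left_diff_distrib diff_divide_distrib)
  also have "\<dots> = (\<Sum>j<Suc n. fact (Suc n - j) / fact j * s ^ j)"
    by (intro sum.cong) (auto simp: Suc_diff_le fact_reduce)
  also have "\<dots> = clifford_pol (Suc (Suc n)) s - s ^ Suc n / fact (Suc n)"
    unfolding clifford_pol_def by simp
  finally show ?thesis by simp
qed

section \<open>Wave functions of two independent complex variables\<close>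

text \<open>Entire in both variables. Negative orders carry powers of \<open>- w\<close> instead of
  \<open>z\<close>, which encodes both the sign in \<open>J_(-n) = (-1)^n J_n\<close> and the
  conjugate angular factor.\<close>

definition bessel_wave :: "int \<Rightarrow> complex \<Rightarrow> complex \<Rightarrow> complex" where
  "bessel_wave l z w = (if l \<ge> 0 then z ^ nat l * clifford (nat l) (z * w)
     else (- w) ^ nat (- l) * clifford (nat (- l)) (z * w))"

text \<open>\<open>L\<close> stands for \<open>ln (z * w)\<close>, kept as a separate argument so that its branch can be chosen later.\<close>
definition hankel_wave_nat :: "nat \<Rightarrow> complex \<Rightarrow> complex \<Rightarrow> complex \<Rightarrow> complex" where
  "hankel_wave_nat n z w L = z ^ n * clifford n (z * w) * (1 + \<i> / pi * L)
     - \<i> / pi * (clifford_pol n (z * w) / w ^ n + z ^ n * clifford_psi n (z * w))"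

definition hankel_wave :: "int \<Rightarrow> complex \<Rightarrow> complex \<Rightarrow> complex \<Rightarrow> complex" where
  "hankel_wave l z w L = (if l \<ge> 0 then hankel_wave_nat (nat l) z w L
     else (-1) ^ nat (- l) * hankel_wave_nat (nat (- l)) w z L)"

text \<open>The Bessel part obeys the ladder relation exactly, while the polynomial part, the
  digamma part and the derivative of \<open>L\<close> leave defects that cancel one another.\<close>

lemma DERIV_hankel_wave_nat_Suc:
  assumes z: "(z has_field_derivative z') (at t)" and w: "(w has_field_derivative w') (at t)"
    and L: "(L has_field_derivative (z' / z t + w' / w t)) (at t)"
    and nz: "z t \<noteq> 0" "w t \<noteq> 0"
  shows "((\<lambda>t. hankel_wave_nat (Suc m) (z t) (w t) (L t)) has_field_derivative
    z' * hankel_wave_nat m (z t) (w t) (L t) - w' * hankel_wave_nat (Suc (Suc m)) (z t) (w t) (L t)) (at t)"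
proof -
  define s where "s = z t * w t"
  define f :: complex where "f = fact (Suc m)"
  define p0 p1 p2 where "p0 = clifford_pol m s" and "p1 = clifford_pol (Suc m) s" and "p2 = clifford_pol (Suc (Suc m)) s"
  define c0 c1 c2 where "c0 = clifford m s" and "c1 = clifford (Suc m) s" and "c2 = clifford (Suc (Suc m)) s"
  define g0 g1 g2 g1' where "g0 = clifford_psi m s" and "g1 = clifford_psi (Suc m) s"
    and "g2 = clifford_psi (Suc (Suc m)) s" and "g1' = clifford_psi' (Suc m) s"
  define N :: complex where "N = of_nat (Suc m)"
  have f0: "f \<noteq> 0" unfolding f_def by (rule fact_nonzero)
  have c_rec: "c0 = N * c1 - s * c2"
    unfolding c0_def c1_def c2_def N_def by (rule clifford_rec)
  have g_rec1: "s * g1' = - s * g2 + c1 - 1 / f"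
    unfolding g1'_def g2_def c1_def f_def by (rule times_clifford_psi')
  have g_rec2: "N * g1 + s * g1' = g0 + c1"
    unfolding g1'_def g1_def g0_def c1_def N_def by (rule clifford_psi_rec')
  have p_rec: "p2 = N * p1 - s * p0 + s ^ Suc m / f"
    unfolding p0_def p1_def p2_def N_def f_def by (rule clifford_pol_rec)
  have s: "((\<lambda>t. z t * w t) has_field_derivative (z' * w t + w' * z t)) (at t)"
    by (rule DERIV_mult[OF z w])
  have zp: "((\<lambda>t. z t ^ Suc m) has_field_derivative (N * (z' * z t ^ m))) (at t)"
    using DERIV_power[OF z, of "Suc m"] by (simp add: N_def)
  have c: "((\<lambda>t. clifford (Suc m) (z t * w t)) has_field_derivative (- c2 * (z' * w t + w' * z t))) (at t)"
    using DERIV_chain2[OF DERIV_clifford s] by (simp add: c2_def s_def)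
  have g: "((\<lambda>t. clifford_psi (Suc m) (z t * w t)) has_field_derivative (g1' * (z' * w t + w' * z t))) (at t)"
    using DERIV_chain2[OF DERIV_clifford_psi s] by (simp add: g1'_def s_def)
  have p: "((\<lambda>t. clifford_pol (Suc m) (z t * w t)) has_field_derivative (p0 * (z' * w t + w' * z t))) (at t)"
    using DERIV_chain2[OF DERIV_clifford_pol s] by (simp add: p0_def s_def)
  have wp: "((\<lambda>t. w t ^ Suc m) has_field_derivative (N * (w' * w t ^ m))) (at t)"
    using DERIV_power[OF w, of "Suc m"] by (simp add: N_def)
  have zc: "((\<lambda>t. z t ^ Suc m * clifford (Suc m) (z t * w t)) has_field_derivative
      z' * (z t ^ m * c0) - w' * (z t ^ Suc (Suc m) * c2)) (at t)"
    by (rule DERIV_cong[OF DERIV_mult[OF zp c]])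
       (simp add: c_rec s_def c1_def[unfolded s_def mult.commute[of "z t"], symmetric] algebra_simps)
  have zg: "((\<lambda>t. z t ^ Suc m * clifford_psi (Suc m) (z t * w t)) has_field_derivative
      z' * (z t ^ m * (g0 + c1)) - w' * (z t ^ Suc (Suc m) * g2) + w' * (z t ^ Suc m * c1 - z t ^ Suc m / f) / w t) (at t)"
  proof (rule DERIV_cong[OF DERIV_mult[OF zp g]])
    have "w' * (z t ^ Suc (Suc m) * g1') = w' * z t ^ Suc m * (s * g1') / w t"
      using nz by (simp add: s_def)
    also have "\<dots> = w' * z t ^ Suc m * (- s * g2 + c1 - 1 / f) / w t"
      unfolding g_rec1 ..
    also have "\<dots> = - w' * (z t ^ Suc (Suc m) * g2) + w' * (z t ^ Suc m * c1 - z t ^ Suc m / f) / w t"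
      using nz f0 by (simp add: s_def field_simps)
    finally have 1: "w' * (z t ^ Suc (Suc m) * g1') = \<dots>" .
    have "N * (z' * z t ^ m) * g1 + g1' * (z' * w t + w' * z t) * z t ^ Suc m
       = z' * (z t ^ m * (N * g1 + s * g1')) + w' * (z t ^ Suc (Suc m) * g1')"
      by (simp add: s_def algebra_simps)
    also have "\<dots> = z' * (z t ^ m * (g0 + c1)) - w' * (z t ^ Suc (Suc m) * g2) + w' * (z t ^ Suc m * c1 - z t ^ Suc m / f) / w t"
      unfolding g_rec2 1 by simp
    finally show "N * (z' * z t ^ m) * clifford_psi (Suc m) (z t * w t) + g1' * (z' * w t + w' * z t) * z t ^ Suc m = \<dots>"
      by (simp add: g1_def s_def)
  qed
  have pw: "((\<lambda>t. clifford_pol (Suc m) (z t * w t) / w t ^ Suc m) has_field_derivative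
      z' * (p0 / w t ^ m) - w' * (p2 / w t ^ Suc (Suc m)) + w' * (z t ^ Suc m / (f * w t))) (at t)"
  proof (rule DERIV_cong[OF DERIV_divide[OF p wp]])
    have "(p0 * (z' * w t + w' * z t) * w t ^ Suc m - p1 * (N * (w' * w t ^ m))) / (w t ^ Suc m * w t ^ Suc m)
      = z' * (p0 / w t ^ m) - w' * ((N * p1 - s * p0) / w t ^ Suc (Suc m))"
      using nz by (simp add: s_def field_simps)
    also have "w' * (z t ^ Suc m / (f * w t)) = w' * (s ^ Suc m / f / w t ^ Suc (Suc m))"
      using nz f0 by (simp add: s_def power_mult_distrib)
    then have "z' * (p0 / w t ^ m) - w' * ((N * p1 - s * p0) / w t ^ Suc (Suc m)) =
      z' * (p0 / w t ^ m) - w' * (p2 / w t ^ Suc (Suc m)) + w' * (z t ^ Suc m / (f * w t))"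
      unfolding p_rec add_divide_distrib distrib_left by simp
    finally show "(p0 * (z' * w t + w' * z t) * w t ^ Suc m - clifford_pol (Suc m) (z t * w t) * (N * (w' * w t ^ m))) / (w t ^ Suc m * w t ^ Suc m)
       = z' * (p0 / w t ^ m) - w' * (p2 / w t ^ Suc (Suc m)) + w' * (z t ^ Suc m / (f * w t))"
      by (simp only: p1_def s_def)
  qed (use nz in simp)
  have L': "((\<lambda>t. 1 + \<i> / pi * L t) has_field_derivative \<i> / pi * (z' / z t + w' / w t)) (at t)"
    by (auto intro!: derivative_eq_intros L)
  \<comment> \<open>\<open>x\<close>, \<open>y\<close>, \<open>Z\<close> stand for
    \<open>z t\<close>, \<open>w t\<close>, \<open>z t ^ m\<close>; as free variables they keep the
    powers from being expanded. In the \<open>z'\<close> part the logarithm removes the extra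
    \<open>c1\<close> (fact 1), and in the \<open>w'\<close> part all defects sum to zero (fact
    2).\<close>
  have key: "(z' * (Z * c0) - w' * (x * (x * Z) * c2)) * A + i * (z' / x + w' / y) * (x * Z * c1)
     - i * ((z' * P0 - w' * P2 + w' * (x * Z / (f * y))) +
       (z' * (Z * (g0 + c1)) - w' * (x * (x * Z) * g2) + w' * (x * Z * c1 - x * Z / f) / y))
     = z' * (Z * c0 * A - i * (P0 + Z * g0)) - w' * (x * (x * Z) * c2 * A - i * (P2 + x * (x * Z) * g2))"
    if "x \<noteq> 0" "y \<noteq> 0" "f \<noteq> 0" for x y Z A i P0 P2
  proof -
    have 1: "z' / x * (x * Z * c1) = z' * Z * c1" using that by simp
    have 2: "w' / y * (x * Z * c1) + - w' * (x * Z / (f * y)) - w' * (x * Z * c1 - x * Z / f) / y = 0"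
      using that by (simp add: field_simps)
    have "(z' * (Z * c0) - w' * (x * (x * Z) * c2)) * A + i * (z' / x + w' / y) * (x * Z * c1)
     - i * ((z' * P0 - w' * P2 + w' * (x * Z / (f * y))) +
       (z' * (Z * (g0 + c1)) - w' * (x * (x * Z) * g2) + w' * (x * Z * c1 - x * Z / f) / y))
      = (z' * (Z * c0) - w' * (x * (x * Z) * c2)) * A + i * (z' / x * (x * Z * c1))
     - i * ((z' * P0 - w' * P2) + (z' * (Z * (g0 + c1)) - w' * (x * (x * Z) * g2)))
     + i * (w' / y * (x * Z * c1) + - w' * (x * Z / (f * y)) - w' * (x * Z * c1 - x * Z / f) / y)"
      by (simp only: distrib_left distrib_right left_diff_distrib right_diff_distrib mult_minus_left mult_minus_right) simp
    also have "\<dots> = z' * (Z * c0 * A - i * (P0 + Z * g0)) - w' * (x * (x * Z) * c2 * A - i * (P2 + x * (x * Z) * g2))"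
      unfolding 1 2 by (simp add: algebra_simps)
    finally show ?thesis .
  qed
  show ?thesis
    unfolding hankel_wave_nat_def
    by (rule DERIV_cong[OF DERIV_diff[OF DERIV_mult[OF zc L'] DERIV_cmult[OF DERIV_add[OF pw zg]]]])
      (use key[OF nz f0, of "z t ^ m" "1 + \<i> / pi * L t" "\<i> / pi" "p0 / w t ^ m" "p2 / w t ^ Suc (Suc m)"] in
       \<open>simp only: power_Suc s_def c0_def c1_def c2_def g0_def g2_def p0_def p2_def\<close>)
qed

text \<open>Lowering from order 0 reaches order -1, that is, minus order 1 with the arguments
  exchanged, so order 0 falls outside the general step.\<close>

lemma DERIV_hankel_wave_nat_0:
  assumes z: "(z has_field_derivative z') (at t)" and w: "(w has_field_derivative w') (at t)"
    and L: "(L has_field_derivative (z' / z t + w' / w t)) (at t)"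
    and nz: "z t \<noteq> 0" "w t \<noteq> 0"
  shows "((\<lambda>t. hankel_wave_nat 0 (z t) (w t) (L t)) has_field_derivative
    - z' * hankel_wave_nat 1 (w t) (z t) (L t) - w' * hankel_wave_nat 1 (z t) (w t) (L t)) (at t)"
proof -
  define s where "s = z t * w t"
  define c0 c1 where "c0 = clifford 0 s" and "c1 = clifford 1 s"
  define g0 g1 g0' where "g0 = clifford_psi 0 s" and "g1 = clifford_psi 1 s" and "g0' = clifford_psi' 0 s"
  have s: "((\<lambda>t. z t * w t) has_field_derivative (z' * w t + w' * z t)) (at t)"
    by (rule DERIV_mult[OF z w])
  have c: "((\<lambda>t. clifford 0 (z t * w t)) has_field_derivative (- c1 * (z' * w t + w' * z t))) (at t)"
    using DERIV_chain2[OF DERIV_clifford s] by (simp add: c1_def s_def)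
  have "((\<lambda>t. clifford_psi 0 (z t * w t)) has_field_derivative (g0' * (z' * w t + w' * z t))) (at t)"
    using DERIV_chain2[OF DERIV_clifford_psi s] by (simp add: g0'_def s_def)
  also have "g0' * (z' * w t + w' * z t) = (s * g0') * (z' / z t + w' / w t)"
    using nz by (simp add: s_def field_simps)
  also have "s * g0' = - s * g1 + c0 - 1"
    using times_clifford_psi'[of s 0] by (simp add: g0'_def g1_def c0_def)
  finally have g: "((\<lambda>t. clifford_psi 0 (z t * w t)) has_field_derivative
      (- s * g1 + c0 - 1) * (z' / z t + w' / w t)) (at t)" .
  have L': "((\<lambda>t. 1 + \<i> / pi * L t) has_field_derivative \<i> / pi * (z' / z t + w' / w t)) (at t)"
    by (auto intro!: derivative_eq_intros L)
  have key: "(- c1 * (z' * w t + w' * z t)) * A + i * (z' / z t + w' / w t) * c0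
     - i * ((- s * g1 + c0 - 1) * (z' / z t + w' / w t))
     = - z' * (w t * c1 * A - i * (1 / z t + w t * g1)) - w' * (z t * c1 * A - i * (1 / w t + z t * g1))" for A i
    using nz by (simp add: s_def field_simps)
  show ?thesis
    unfolding hankel_wave_nat_def power_0 clifford_pol_0 div_0 add_0 mult_1_left
    by (rule DERIV_cong[OF DERIV_diff[OF DERIV_mult[OF c L'] DERIV_cmult[OF g]]])
      (use key[of "1 + \<i> / pi * L t" "\<i> / pi"] in
       \<open>simp add: s_def c0_def c1_def g1_def mult.commute\<close>)
qed

text \<open>Order 0 is symmetric in \<open>z\<close> and \<open>w\<close>, so both branches of the
  definition agree there; raising order -1 ends on this value.\<close>

lemma hankel_wave_neg: "l \<le> 0 \<Longrightarrow> hankel_wave l z w L = (-1) ^ nat (- l) * hankel_wave_nat (nat (- l)) w z L"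
  by (cases "l = 0") (auto simp: hankel_wave_def hankel_wave_nat_def mult.commute)

lemma DERIV_hankel_wave:
  assumes z: "(z has_field_derivative z') (at t)" and w: "(w has_field_derivative w') (at t)"
    and L: "(L has_field_derivative (z' / z t + w' / w t)) (at t)"
    and nz: "z t \<noteq> 0" "w t \<noteq> 0"
  shows "((\<lambda>t. hankel_wave l (z t) (w t) (L t)) has_field_derivative
    z' * hankel_wave (l - 1) (z t) (w t) (L t) - w' * hankel_wave (l + 1) (z t) (w t) (L t)) (at t)"
proof -
  consider "l = 0" | m where "l = int (Suc m)" | m where "l = - int (Suc m)"
    by (metis int_cases3 Suc_pred)
  then show ?thesis
  proof cases
    case 1
    then show ?thesis
      using DERIV_hankel_wave_nat_0[OF assms] by (simp add: hankel_wave_def)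
  next
    case (2 m)
    have e: "hankel_wave l = hankel_wave_nat (Suc m)" "hankel_wave (l - 1) = hankel_wave_nat m"
      "hankel_wave (l + 1) = hankel_wave_nat (Suc (Suc m))"
      using 2 by (auto simp: hankel_wave_def fun_eq_iff nat_add_distrib)
    show ?thesis
      unfolding e by (rule DERIV_hankel_wave_nat_Suc[OF assms])
  next
    \<comment> \<open>Exchanging \<open>z\<close> and \<open>w\<close> exchanges raising and
      lowering, and the alternating sign \<open>(-1) ^ n\<close> turns the difference round
      accordingly.\<close>
    case (3 m)
    have L2: "(L has_field_derivative (w' / w t + z' / z t)) (at t)" using L by (simp add: add.commute)
    have e: "hankel_wave l = (\<lambda>z w L. (-1) ^ Suc m * hankel_wave_nat (Suc m) w z L)"
      "hankel_wave (l - 1) = (\<lambda>z w L. (-1) ^ Suc (Suc m) * hankel_wave_nat (Suc (Suc m)) w z L)"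
      "hankel_wave (l + 1) = (\<lambda>z w L. (-1) ^ m * hankel_wave_nat m w z L)"
      using 3 by (auto simp: hankel_wave_neg fun_eq_iff nat_add_distrib)
    show ?thesis
      unfolding e
      by (rule DERIV_cong[OF DERIV_cmult[OF DERIV_hankel_wave_nat_Suc[OF w z L2 nz(2,1), of m]]])
         (simp add: algebra_simps)
  qed
qed

text \<open>The defects \<open>1 / f\<close> of the digamma part and \<open>s ^ Suc m / f\<close> of
  the polynomial part cancel once the powers of \<open>z\<close> and \<open>w\<close> are
  attached.\<close>

lemma hankel_wave_nat_rec:
  assumes nz: "z \<noteq> 0" "w \<noteq> 0"
  shows "z * hankel_wave_nat m z w L + w * hankel_wave_nat (Suc (Suc m)) z w L
    = of_nat (Suc m) * hankel_wave_nat (Suc m) z w L"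
proof -
  define s where "s = z * w"
  define f :: complex where "f = fact (Suc m)"
  define p0 p1 p2 where "p0 = clifford_pol m s" and "p1 = clifford_pol (Suc m) s" and "p2 = clifford_pol (Suc (Suc m)) s"
  define c0 c1 c2 where "c0 = clifford m s" and "c1 = clifford (Suc m) s" and "c2 = clifford (Suc (Suc m)) s"
  define g0 g1 g2 where "g0 = clifford_psi m s" and "g1 = clifford_psi (Suc m) s"
    and "g2 = clifford_psi (Suc (Suc m)) s"
  define N :: complex where "N = of_nat (Suc m)"
  have f0: "f \<noteq> 0" unfolding f_def by (rule fact_nonzero)
  have c_rec: "c0 = N * c1 - s * c2"
    unfolding c0_def c1_def c2_def N_def by (rule clifford_rec)
  have g_rec: "g0 = N * g1 - s * g2 - 1 / f"
    using clifford_psi_rec'[of m s, folded g0_def g1_def N_def]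
    unfolding times_clifford_psi'[of s "Suc m", folded g2_def f_def] by (simp add: algebra_simps)
  have p_rec: "p2 = N * p1 - s * p0 + s ^ Suc m / f"
    unfolding p0_def p1_def p2_def N_def f_def by (rule clifford_pol_rec)
  have key: "z * (z ^ m * c0 * A - i * (p0 / w ^ m + z ^ m * g0))
     + w * (z ^ Suc (Suc m) * c2 * A - i * (p2 / w ^ Suc (Suc m) + z ^ Suc (Suc m) * g2))
     = N * (z ^ Suc m * c1 * A - i * (p1 / w ^ Suc m + z ^ Suc m * g1))" for A i
    unfolding c_rec g_rec p_rec using nz f0 by (simp add: s_def field_simps power_mult_distrib)
  show ?thesis
    using key[of "1 + \<i> / pi * L" "\<i> / pi"]
    unfolding hankel_wave_nat_def s_def[symmetric] p0_def p1_def p2_def c0_def c1_def c2_def g0_def g1_def g2_def N_def .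
qed

text \<open>This is the Wronskian of orders 0 and 1 with the logarithms already cancelled. What
  remains is entire with derivative 0, so its value can be read off at \<open>s = 0\<close>, where
  the Hankel functions themselves are singular.\<close>

lemma clifford_wronskian: "clifford 0 s + s * (clifford 0 s * clifford_psi 1 s - clifford_psi 0 s * clifford 1 s) = 1"
proof -
  let ?W = "\<lambda>s. clifford 0 s + (clifford 0 s * (s * clifford_psi 1 s) - clifford_psi 0 s * (s * clifford 1 s))"
  have "(?W has_field_derivative 0) (at s)" for s
  proof -
    have 1: "((\<lambda>s. s * clifford 1 s) has_field_derivative clifford 0 s) (at s)"
      by (rule DERIV_cong[OF DERIV_mult[OF DERIV_ident DERIV_clifford]])
         (simp add: clifford_rec[of 0 s] algebra_simps)
    have 2: "((\<lambda>s. s * clifford_psi 1 s) has_field_derivative (clifford_psi 0 s + clifford 1 s)) (at s)"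
      by (rule DERIV_cong[OF DERIV_mult[OF DERIV_ident DERIV_clifford_psi]])
         (use clifford_psi_rec'[of 0 s] in \<open>simp add: algebra_simps\<close>)
    have 3: "s * clifford_psi' 0 s = - s * clifford_psi 1 s + clifford 0 s - 1"
      using times_clifford_psi'[of s 0] by simp
    show ?thesis
    proof (rule DERIV_cong[OF DERIV_add[OF DERIV_clifford DERIV_diff[OF
            DERIV_mult[OF DERIV_clifford 2] DERIV_mult[OF DERIV_clifford_psi 1]]]])
      have "clifford_psi' 0 s * (s * clifford 1 s) = (- s * clifford_psi 1 s + clifford 0 s - 1) * clifford 1 s"
        unfolding 3[symmetric] by (simp add: mult_ac)
      then show "- clifford (Suc 0) s + (- clifford (Suc 0) s * (s * clifford_psi 1 s) + (clifford_psi 0 s + clifford 1 s) * clifford 0 s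
          - (clifford_psi' 0 s * (s * clifford 1 s) + clifford 0 s * clifford_psi 0 s)) = 0"
        by (simp add: algebra_simps)
    qed
  qed
  then have "\<exists>c. \<forall>s\<in>UNIV. ?W s = c"
    by (intro has_field_derivative_zero_constant) auto
  then obtain c where c: "\<forall>s\<in>UNIV. ?W s = c" ..
  show ?thesis
    using bspec[OF c, of s] bspec[OF c, of 0] by (simp add: algebra_simps)
qed

section \<open>Bessel and Hankel functions\<close>

definition wave_U :: "int \<Rightarrow> complex \<Rightarrow> complex" where
  "wave_U l z = bessel_wave l z (cnj z)"

text \<open>On \<open>w = cnj z\<close> the product \<open>z * w\<close> is positive for nonzero
  \<open>z\<close>, so the real logarithm is the branch to take.\<close>

definition wave_V :: "int \<Rightarrow> complex \<Rightarrow> complex" where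
  "wave_V l z = hankel_wave l z (cnj z) (of_real (2 * ln (cmod z)))"

lemma besselJ_nat_eq: "of_real (besselJ_nat n (2 * r)) = of_real r ^ n * clifford n (of_real r ^ 2)"
proof -
  have pw: "complex_of_real r ^ (2 * j + n) = (of_real r ^ 2) ^ j * of_real r ^ n" for j
    by (simp only: power_add power_mult)
  have eq: "complex_of_real ((-1) ^ j / (fact j * fact (j + n)) * (2 * r / 2) ^ (2 * j + n))
      = of_real r ^ n * ((-1) ^ j / (fact j * fact (n + j)) * (of_real r ^ 2) ^ j)" for j
    by (simp add: pw[symmetric] add.commute[of n]) (simp add: pw)
  have "summable (\<lambda>j. complex_of_real ((-1) ^ j / (fact j * fact (j + n)) * (2 * r / 2) ^ (2 * j + n)))"
    unfolding eq by (intro summable_mult summable_clifford)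
  then have "summable (\<lambda>j. (-1) ^ j / (fact j * fact (j + n)) * (2 * r / 2) ^ (2 * j + n))"
    by (simp only: summable_of_real_iff)
  then have "of_real (besselJ_nat n (2 * r))
      = (\<Sum>j. complex_of_real ((-1) ^ j / (fact j * fact (j + n)) * (2 * r / 2) ^ (2 * j + n)))"
    unfolding besselJ_nat_def by (rule suminf_of_real)
  also have "\<dots> = of_real r ^ n * clifford n (of_real r ^ 2)"
    unfolding clifford_def eq by (rule suminf_mult[OF summable_clifford])
  finally show ?thesis .
qed

lemma besselY_nat_eq:
  assumes "r > 0"
  shows "of_real (besselY_nat n (2 * r)) = of_real r ^ n * clifford n (of_real r ^ 2) * (2 * of_real (ln r) / of_real pi)
     - (clifford_pol n (of_real r ^ 2) / of_real r ^ n + of_real r ^ n * clifford_psi n (of_real r ^ 2)) / of_real pi"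
proof -
  have "clifford_psi n (of_real r ^ 2) = (\<Sum>j. complex_of_real ((Digamma (real (j + 1)) + Digamma (real (n + j + 1))) *
                (- (r\<^sup>2)) ^ j / (fact j * fact (n + j))))"
    unfolding clifford_psi_def by (intro suminf_cong) (simp add: power_minus[of "r\<^sup>2"])
  also have "\<dots> = of_real (\<Sum>j. (Digamma (real (j + 1)) + Digamma (real (n + j + 1))) *
                (- (r\<^sup>2)) ^ j / (fact j * fact (n + j)))"
  proof (rule suminf_of_real[symmetric])
    have "summable (\<lambda>j. complex_of_real ((Digamma (real (j + 1)) + Digamma (real (n + j + 1))) *
                (- (r\<^sup>2)) ^ j / (fact j * fact (n + j))))"
      using summable_clifford_psi[of n "of_real r ^ 2"] by (simp add: power_minus[of "r\<^sup>2"] mult.assoc)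
    then show "summable (\<lambda>j. (Digamma (real (j + 1)) + Digamma (real (n + j + 1))) *
                (- (r\<^sup>2)) ^ j / (fact j * fact (n + j)))"
      by (simp only: summable_of_real_iff)
  qed
  finally have psi: "complex_of_real (\<Sum>j. (Digamma (real (j + 1)) + Digamma (real (n + j + 1))) *
      (- ((2 * r)\<^sup>2 / 4)) ^ j / (fact j * fact (n + j))) = clifford_psi n (of_real r ^ 2)"
    by (simp add: power_mult_distrib)
  have pol: "complex_of_real (\<Sum>j<n. fact (n - j - 1) / fact j * ((2 * r)\<^sup>2 / 4) ^ j) = clifford_pol n (of_real r ^ 2)"
    unfolding clifford_pol_def by (simp add: power_mult_distrib)
  have "(2 * r / 2) powr (- real n) = inverse (r ^ n)"
    using assms by (simp add: powr_minus powr_realpow)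
  show ?thesis
    unfolding besselY_nat_def \<open>(2 * r / 2) powr (- real n) = inverse (r ^ n)\<close> of_real_add of_real_diff of_real_minus of_real_mult pol psi besselJ_nat_eq
    using assms by (simp add: field_simps)
qed

lemma hankel1_nat_eq:
  assumes "r > 0"
  shows "hankel1 (int n) (2 * r) = hankel_wave_nat n (of_real r) (of_real r) (of_real (2 * ln r))"
proof -
  have "hankel1 (int n) (2 * r) = of_real (besselJ_nat n (2 * r)) + \<i> * of_real (besselY_nat n (2 * r))"
    by (simp add: hankel1_def besselJ_def besselY_def complex_eq_iff)
  also have "\<dots> = hankel_wave_nat n (of_real r) (of_real r) (of_real (2 * ln r))"
    unfolding besselJ_nat_eq besselY_nat_eq[OF assms] hankel_wave_nat_def
    by (simp add: power2_eq_square algebra_simps add_divide_distrib)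
  finally show ?thesis .
qed

lemma besselJ_minus: "besselJ (- l) x = (-1) ^ nat \<bar>l\<bar> * besselJ l x"
  by (cases "l = 0") (auto simp: besselJ_def mult.assoc[symmetric] simp flip: power_mult_distrib)

lemma besselY_minus: "besselY (- l) x = (-1) ^ nat \<bar>l\<bar> * besselY l x"
  by (cases "l = 0") (auto simp: besselY_def mult.assoc[symmetric] simp flip: power_mult_distrib)

lemma hankel1_minus: "hankel1 (- l) x = (-1) ^ nat \<bar>l\<bar> * hankel1 l x"
  unfolding hankel1_def besselJ_minus besselY_minus
  by (cases "even (nat \<bar>l\<bar>)") (auto simp: complex_eq_iff)

lemma wave_U_polar:
  assumes "cmod u = 1"
  shows "wave_U l (of_real r * u) = of_real (besselJ l (2 * r)) * u powi l"
proof -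
  have u: "cnj u = inverse u" "u \<noteq> 0"
    using assms complex_div_cnj[of 1 u] by (auto simp: inverse_eq_divide)
  then have s: "of_real r * u * cnj (of_real r * u) = of_real r ^ 2"
    by (simp add: power2_eq_square)
  show ?thesis
  proof (cases "l \<ge> 0")
    case True
    then have "wave_U l (of_real r * u) = of_real (besselJ_nat (nat l) (2 * r)) * u ^ nat l"
      unfolding wave_U_def bessel_wave_def s besselJ_nat_eq by (simp add: power_mult_distrib)
    with True show ?thesis by (simp add: besselJ_def power_int_def)
  next
    case False
    then have "wave_U l (of_real r * u) = (-1) ^ nat (- l) * of_real (besselJ_nat (nat (- l)) (2 * r)) * inverse u ^ nat (- l)"
      unfolding wave_U_def bessel_wave_def s besselJ_nat_eq
      by (simp add: power_mult_distrib u power_minus[of "_ * _"])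
    with False show ?thesis by (simp add: besselJ_def power_int_def)
  qed
qed

lemma wave_V_polar:
  assumes "cmod u = 1" "r > 0"
  shows "wave_V l (of_real r * u) = hankel1 l (2 * r) * u powi l"
proof -
  have u: "cnj u = inverse u" "u \<noteq> 0"
    using assms complex_div_cnj[of 1 u] by (auto simp: inverse_eq_divide)
  have m: "cmod (of_real r * u) = r" using assms by (simp add: norm_mult)
  have main: "hankel_wave_nat n (of_real r * u) (of_real r * inverse u) L = hankel_wave_nat n (of_real r) (of_real r) L * u ^ n"
    if "u \<noteq> 0" for n u L
  proof -
    have "of_real r * u * (of_real r * inverse u) = of_real r * of_real r"
      using that by simp
    then show ?thesis
      using that assms(2) unfolding hankel_wave_nat_def by (simp add: power_mult_distrib field_simps)
  qed
  show ?thesis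
  proof (cases "l \<ge> 0")
    case True
    then show ?thesis
      using hankel1_nat_eq[OF assms(2), of "nat l"] main[OF u(2)]
      by (simp add: wave_V_def hankel_wave_def m u power_int_def)
  next
    case False
    then have "hankel1 l (2 * r) = (-1) ^ nat (- l) * hankel1 (int (nat (- l))) (2 * r)"
      using hankel1_minus[of "- l"] by simp
    with False show ?thesis
      using hankel1_nat_eq[OF assms(2), of "nat (- l)"] main[of "inverse u"] u
      by (simp add: wave_V_def hankel_wave_def m u power_int_def)
  qed
qed

lemma cis_polar_angle: "exp (\<i> * of_int n * of_real (polar_angle x)) = cis (Arg x) powi n"
  and cis_polar_angle': "exp (- \<i> * of_int n * of_real (polar_angle x)) = cis (Arg x) powi (- n)"
proof -
  have "cis (polar_angle x) = cis (Arg x)"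
    by (auto simp: polar_angle_def complex_eq_iff)
  then have *: "cis (of_int n * polar_angle x) = cis (Arg x) powi n" for n
    by (metis cis_power_int)
  show "exp (\<i> * of_int n * of_real (polar_angle x)) = cis (Arg x) powi n"
    unfolding *[symmetric] by (simp add: cis_conv_exp mult_ac)
  show "exp (- \<i> * of_int n * of_real (polar_angle x)) = cis (Arg x) powi (- n)"
    unfolding *[symmetric] by (simp add: cis_conv_exp mult_ac)
qed

lemma complex_polar: "of_real (k / 2) * x = of_real (k * cmod x / 2) * cis (Arg x)"
  using rcis_cmod_Arg[of x] by (simp add: rcis_def)

lemma Uplus_eq: "Uplus k l x = wave_U l (of_real (k / 2) * x)"
  unfolding Uplus_def cis_polar_angle complex_polar[of k x] by (subst wave_U_polar) auto

lemma Vplus_eq: "k > 0 \<Longrightarrow> x \<noteq> 0 \<Longrightarrow> Vplus k l x = wave_V l (of_real (k / 2) * x)"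
  unfolding Vplus_def cis_polar_angle complex_polar[of k x] by (subst wave_V_polar) auto

lemma minus_powi: "(- u) powi (- l) = (-1) ^ nat \<bar>l\<bar> * u powi (- l)" for u :: complex
  by (simp add: power_int_minus_left minus_one_power_iff even_nat_iff)

text \<open>Reversing the point multiplies the angular factor by \<open>(-1) ^ l\<close>, reversing
  the order multiplies the Bessel function by the same sign. This brings the coefficients of the
  conditions to the order \<open>l - n\<close> in which the addition theorem delivers them.\<close>

lemma Uminus_eq: "Uminus k l x = wave_U (- l) (- (of_real (k / 2) * x))"
proof -
  have "wave_U (- l) (- (of_real (k / 2) * x)) = wave_U (- l) (of_real (k * cmod x / 2) * - cis (Arg x))"
    unfolding complex_polar[of k x] by simp
  also have "\<dots> = of_real (besselJ (- l) (k * cmod x)) * (- cis (Arg x)) powi (- l)"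
    by (subst wave_U_polar) auto
  also have "\<dots> = Uminus k l x"
    unfolding Uminus_def cis_polar_angle' besselJ_minus minus_powi by (simp flip: power_mult_distrib)
  finally show ?thesis ..
qed

lemma Vminus_eq:
  assumes "k > 0" "x \<noteq> 0"
  shows "Vminus k l x = wave_V (- l) (- (of_real (k / 2) * x))"
proof -
  have "wave_V (- l) (- (of_real (k / 2) * x)) = wave_V (- l) (of_real (k * cmod x / 2) * - cis (Arg x))"
    unfolding complex_polar[of k x] by simp
  also have "\<dots> = hankel1 (- l) (k * cmod x) * (- cis (Arg x)) powi (- l)"
    using assms by (subst wave_V_polar) auto
  also have "\<dots> = Vminus k l x"
    unfolding Vminus_def cis_polar_angle' hankel1_minus minus_powi by (simp flip: power_mult_distrib)
  finally show ?thesis ..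
qed

section \<open>Growth of the waves in the order at a fixed point\<close>

lemma norm_bessel_wave_le:
  assumes "cmod z \<le> r" "cmod w \<le> r"
  shows "norm (bessel_wave l z w) \<le> exp (r\<^sup>2) * (r ^ nat \<bar>l\<bar> / fact (nat \<bar>l\<bar>))"
proof -
  have r: "r \<ge> 0" using assms norm_ge_zero[of z] by linarith
  have main: "norm (v ^ n * clifford n (z * w)) \<le> exp (r\<^sup>2) * (r ^ n / fact n)" if "cmod v \<le> r" for v n
  proof -
    have "norm (z * w) \<le> r\<^sup>2"
      using assms r by (simp add: norm_mult power2_eq_square mult_mono)
    then have "norm (clifford n (z * w)) \<le> exp (r\<^sup>2) / fact n"
      by (intro order_trans[OF norm_clifford_le] divide_right_mono) auto
    then have "norm (v ^ n * clifford n (z * w)) \<le> r ^ n * (exp (r\<^sup>2) / fact n)"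
      unfolding norm_mult norm_power using that r by (intro mult_mono power_mono) auto
    then show ?thesis by (simp add: mult_ac)
  qed
  show ?thesis
    unfolding bessel_wave_def using main[of z] main[of "- w"] assms by auto
qed

lemma norm_wave_U: "norm (wave_U l z) = cmod z ^ nat \<bar>l\<bar> * norm (clifford (nat \<bar>l\<bar>) (of_real (cmod z) ^ 2))"
  unfolding wave_U_def bessel_wave_def
  by (auto simp: norm_mult norm_power simp flip: complex_norm_square)

text \<open>The constant coefficient of \<open>fact n * clifford n s\<close> is 1, and every other
  one carries a quotient \<open>fact n / fact (n + j)\<close> of at most
  \<open>1 / (n + 1)\<close>.\<close>

lemma norm_fact_clifford_diff_le: "norm (fact n * clifford n s - 1) \<le> exp (norm s) / real (n + 1)"
proof -
  have "(\<lambda>j. fact n * ((-1) ^ j / (fact j * fact (n + j)) * s ^ j)) sums (fact n * clifford n s)"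
    unfolding clifford_def by (intro sums_mult summable_sums summable_clifford)
  then have s: "(\<lambda>j. fact n * ((-1) ^ Suc j / (fact (Suc j) * fact (n + Suc j)) * s ^ Suc j)) sums (fact n * clifford n s - 1)"
    by (subst sums_Suc_iff) simp
  have t: "(\<lambda>j. norm s ^ Suc j / fact (Suc j) / real (n + 1)) sums ((exp (norm s) - 1) / real (n + 1))"
    using sums_exp_real[of "norm s"] by (intro sums_divide) (subst sums_Suc_iff, simp)
  have "norm (fact n * clifford n s - 1) \<le> (exp (norm s) - 1) / real (n + 1)"
    unfolding sums_unique[OF s] sums_unique[OF t]
  proof (rule norm_suminf_le[OF _ sums_summable[OF t]])
    fix j
    have "(fact n * real (n + 1) :: real) = fact (n + 1)" by simp
    also have "\<dots> \<le> fact (n + Suc j)" by (intro fact_mono) auto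
    finally have "fact n / fact (n + Suc j) \<le> 1 / real (n + 1)" by (simp add: divide_simps del: of_nat_Suc fact_Suc)
    then have "norm s ^ Suc j / fact (Suc j) * (fact n / fact (n + Suc j)) \<le> norm s ^ Suc j / fact (Suc j) * (1 / real (n + 1))"
      by (intro mult_left_mono) auto
    then show "norm (fact n * ((-1) ^ Suc j / (fact (Suc j) * fact (n + Suc j)) * s ^ Suc j)) \<le> norm s ^ Suc j / fact (Suc j) / real (n + 1)"
      by (simp add: norm_mult norm_divide norm_power del: fact_Suc of_nat_Suc power_Suc) (simp add: mult_ac)
  qed
  also have "\<dots> \<le> exp (norm s) / real (n + 1)" by (intro divide_right_mono) auto
  finally show ?thesis .
qed

text \<open>Only large orders can be bounded below: for finitely many \<open>l\<close> the Bessel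
  function may vanish at the given radius.\<close>

lemma wave_U_lower: "\<forall>\<^sub>F n in sequentially. \<forall>l. nat \<bar>l\<bar> = n \<longrightarrow> cmod z ^ n / fact n \<le> 2 * norm (wave_U l z)"
proof -
  define s :: complex where "s = of_real (cmod z) ^ 2"
  have "(\<lambda>n. exp (norm s) / real (n + 1)) \<longlonglongrightarrow> 0" by real_asymp
  then have "\<forall>\<^sub>F n in sequentially. exp (norm s) / real (n + 1) < 1 / 2"
    by (rule order_tendstoD) auto
  then show ?thesis
  proof eventually_elim
    case (elim n)
    have "norm (1 - fact n * clifford n s) < 1 / 2"
      using norm_fact_clifford_diff_le[of n s] elim unfolding norm_minus_commute[of 1] by linarith
    moreover have "1 \<le> norm (1 - fact n * clifford n s) + norm (fact n * clifford n s)"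
      using norm_triangle_ineq[of "1 - fact n * clifford n s" "fact n * clifford n s"] by simp
    ultimately have "1 \<le> 2 * norm (fact n * clifford n s)" by linarith
    then have "1 / fact n \<le> 2 * norm (clifford n s)" by (simp add: norm_mult field_simps)
    then have "cmod z ^ n * (1 / fact n) \<le> cmod z ^ n * (2 * norm (clifford n s))"
      by (intro mult_left_mono) auto
    then show ?case by (auto simp: norm_wave_U s_def mult_ac)
  qed
qed

text \<open>Adding back the polynomial part removes the singular term, and the rest scales like
  \<open>r ^ n\<close>. The 3 is 1 from the Bessel part plus 2, a bound for \<open>4 / pi\<close>,
  from the digamma part.\<close>

lemma norm_hankel_wave_nat_diff_le:
  assumes "cmod z = r" "cmod w = r" "r > 0"
  shows "norm (hankel_wave_nat n z w (of_real (2 * ln r)) + \<i> / pi * (clifford_pol n (z * w) / w ^ n))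
     \<le> exp (r\<^sup>2) * (3 + 2 * \<bar>ln r\<bar>) * r ^ n"
proof -
  have s: "norm (z * w) = r\<^sup>2" using assms by (simp add: norm_mult power2_eq_square)
  have "norm (1 + \<i> / pi * of_real (2 * ln r)) \<le> 1 + 2 * \<bar>ln r\<bar> / pi"
    using norm_triangle_ineq[of 1 "\<i> / pi * of_real (2 * ln r)"] by (simp add: norm_mult norm_divide)
  also have "2 * \<bar>ln r\<bar> / pi \<le> 2 * \<bar>ln r\<bar>"
    using pi_ge_two by (simp add: divide_simps mult_le_cancel_left1)
  finally have 1: "norm (1 + \<i> / pi * of_real (2 * ln r)) \<le> 1 + 2 * \<bar>ln r\<bar>" by simp
  have "norm (clifford n (z * w)) \<le> exp (r\<^sup>2) / fact n"
    using norm_clifford_le[of n "z * w"] s by simp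
  also have "\<dots> \<le> exp (r\<^sup>2)" by (simp add: divide_simps mult_le_cancel_left1)
  finally have 2: "norm (z ^ n * clifford n (z * w) * (1 + \<i> / pi * of_real (2 * ln r))) \<le> r ^ n * exp (r\<^sup>2) * (1 + 2 * \<bar>ln r\<bar>)"
    unfolding norm_mult norm_power assms(1) using 1 assms by (intro mult_mono) auto
  have "norm (\<i> / pi * (z ^ n * clifford_psi n (z * w))) = r ^ n * norm (clifford_psi n (z * w)) / pi"
    using assms by (simp add: norm_mult norm_divide norm_power)
  also have "\<dots> \<le> r ^ n * (4 * exp (r\<^sup>2)) / 2"
    using norm_clifford_psi_le[of n "z * w"] s assms pi_ge_two by (intro frac_le mult_left_mono) auto
  finally have 3: "norm (\<i> / pi * (z ^ n * clifford_psi n (z * w))) \<le> r ^ n * (2 * exp (r\<^sup>2))" by simp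
  have "hankel_wave_nat n z w (of_real (2 * ln r)) + \<i> / pi * (clifford_pol n (z * w) / w ^ n)
    = z ^ n * clifford n (z * w) * (1 + \<i> / pi * of_real (2 * ln r)) - \<i> / pi * (z ^ n * clifford_psi n (z * w))"
    unfolding hankel_wave_nat_def by (simp add: algebra_simps)
  also have "norm \<dots> \<le> r ^ n * exp (r\<^sup>2) * (1 + 2 * \<bar>ln r\<bar>) + r ^ n * (2 * exp (r\<^sup>2))"
    by (rule order_trans[OF norm_triangle_ineq4 add_mono[OF 2 3]])
  also have "\<dots> = exp (r\<^sup>2) * (3 + 2 * \<bar>ln r\<bar>) * r ^ n" by (simp add: algebra_simps)
  finally show ?thesis .
qed

lemma power_div_fact_le_exp: "x \<ge> 0 \<Longrightarrow> x ^ n / fact n \<le> exp (x :: real)"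
  using sum_le_suminf[of "\<lambda>j. x ^ j / fact j" "{n}"] sums_exp_real[of x] by (simp add: sums_iff)

lemma norm_hankel_wave_nat_le:
  assumes "cmod z = r" "cmod w = r" "r > 0"
  shows "norm (hankel_wave_nat n z w (of_real (2 * ln r)))
     \<le> (exp (r\<^sup>2) * (3 + 2 * \<bar>ln r\<bar>) * exp (r\<^sup>2) + exp (r\<^sup>2)) * (fact n / r ^ n)"
proof -
  have s: "norm (z * w) = r\<^sup>2" using assms by (simp add: norm_mult power2_eq_square)
  \<comment> \<open>This inequality absorbs the regular part of size \<open>r ^ n\<close> in the
    singular scale \<open>fact n / r ^ n\<close>.\<close>
  have "(r\<^sup>2) ^ n / fact n \<le> exp (r\<^sup>2)" by (intro power_div_fact_le_exp) auto
  then have "r ^ n \<le> exp (r\<^sup>2) * (fact n / r ^ n)"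
    using assms by (simp add: power2_eq_square power_mult_distrib field_simps)
  then have 1: "exp (r\<^sup>2) * (3 + 2 * \<bar>ln r\<bar>) * r ^ n \<le> exp (r\<^sup>2) * (3 + 2 * \<bar>ln r\<bar>) * (exp (r\<^sup>2) * (fact n / r ^ n))"
    by (intro mult_left_mono) auto
  have "norm (\<i> / pi * (clifford_pol n (z * w) / w ^ n)) = norm (clifford_pol n (z * w)) / pi / r ^ n"
    using assms by (simp add: norm_mult norm_divide norm_power)
  also have "\<dots> \<le> norm (clifford_pol n (z * w)) / 1 / r ^ n"
    using assms pi_ge_two by (intro divide_right_mono divide_left_mono) auto
  also have "norm (clifford_pol n (z * w)) / 1 / r ^ n \<le> (fact n * exp (r\<^sup>2)) / 1 / r ^ n"
    using norm_clifford_pol_le[of n "z * w"] s assms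
    by (intro divide_right_mono order_trans[OF norm_clifford_pol_le] mult_mono fact_mono) auto
  finally have 2: "norm (\<i> / pi * (clifford_pol n (z * w) / w ^ n)) \<le> exp (r\<^sup>2) * (fact n / r ^ n)"
    by (simp add: mult_ac)
  have "norm (hankel_wave_nat n z w (of_real (2 * ln r))) \<le>
     norm (hankel_wave_nat n z w (of_real (2 * ln r)) + \<i> / pi * (clifford_pol n (z * w) / w ^ n))
      + norm (\<i> / pi * (clifford_pol n (z * w) / w ^ n))"
    by (metis add_diff_cancel norm_triangle_ineq4)
  also have "\<dots> \<le> exp (r\<^sup>2) * (3 + 2 * \<bar>ln r\<bar>) * (exp (r\<^sup>2) * (fact n / r ^ n)) + exp (r\<^sup>2) * (fact n / r ^ n)"
    by (intro add_mono order_trans[OF norm_hankel_wave_nat_diff_le[OF assms] 1] 2)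
  finally show ?thesis
    by (simp only: distrib_right mult.assoc)
qed

lemma norm_wave_V: "norm (wave_V l z) = norm (hankel_wave_nat (nat \<bar>l\<bar>) (if l \<ge> 0 then z else cnj z)
    (if l \<ge> 0 then cnj z else z) (of_real (2 * ln (cmod z))))"
  by (auto simp: wave_V_def hankel_wave_def norm_mult norm_power)

lemma norm_wave_V_le:
  assumes "z \<noteq> 0"
  obtains K where "K > 0" "\<And>l. norm (wave_V l z) \<le> K * (fact (nat \<bar>l\<bar>) / cmod z ^ nat \<bar>l\<bar>)"
proof
  let ?r = "cmod z"
  let ?K = "exp (?r\<^sup>2) * (3 + 2 * \<bar>ln ?r\<bar>) * exp (?r\<^sup>2) + exp (?r\<^sup>2)"
  show "?K > 0" by (intro add_nonneg_pos mult_nonneg_nonneg) auto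
  show "norm (wave_V l z) \<le> ?K * (fact (nat \<bar>l\<bar>) / cmod z ^ nat \<bar>l\<bar>)" for l
    unfolding norm_wave_V using assms by (intro norm_hankel_wave_nat_le) auto
qed

text \<open>On the nonnegative axis all terms are nonnegative, so the term \<open>j = 0\<close>
  alone is a lower bound.\<close>

lemma fact_le_norm_clifford_pol:
  assumes "n > 0" "r \<ge> 0"
  shows "fact (n - 1) \<le> norm (clifford_pol n (of_real r))"
proof -
  have "clifford_pol n (of_real r) = of_real (\<Sum>j<n. fact (n - j - 1) / fact j * r ^ j)"
    by (simp add: clifford_pol_def)
  moreover have "(\<Sum>j\<in>{0}. fact (n - j - 1) / fact j * r ^ j) \<le> (\<Sum>j<n. fact (n - j - 1) / fact j * r ^ j)"
    using assms by (intro sum_mono2) auto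
  then have "fact (n - 1) \<le> (\<Sum>j<n. fact (n - j - 1) / fact j * r ^ j)" by simp
  ultimately show ?thesis by (simp only: norm_of_real)
qed

text \<open>The singular part has size at least \<open>fact (n - 1) / (pi * r ^ n)\<close>. The
  missing factor \<open>n\<close> and the constants are paid by the exponential gain
  \<open>(\<sigma> / r) ^ n\<close>.\<close>

lemma wave_V_lower:
  assumes z: "z \<noteq> 0" and \<sigma>: "cmod z < \<sigma>"
  shows "\<forall>\<^sub>F n in sequentially. \<forall>l. nat \<bar>l\<bar> = n \<longrightarrow> fact n / \<sigma> ^ n \<le> norm (wave_V l z)"
proof -
  define r where "r = cmod z"
  have r: "r > 0" "r < \<sigma>" using assms by (auto simp: r_def)
  define K where "K = exp (r\<^sup>2) * (3 + 2 * \<bar>ln r\<bar>)"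
  have lower: "fact (n - 1) / r ^ n / pi - K * r ^ n \<le> norm (wave_V l z)" if "nat \<bar>l\<bar> = n" "n > 0" for n l
  proof -
    define z' w' where "z' = (if l \<ge> 0 then z else cnj z)" and "w' = (if l \<ge> 0 then cnj z else z)"
    have zw: "cmod z' = r" "cmod w' = r" "z' * w' = of_real (r\<^sup>2)"
      using complex_norm_square[of z] by (auto simp: z'_def w'_def r_def mult.commute)
    have V: "norm (wave_V l z) = norm (hankel_wave_nat n z' w' (of_real (2 * ln r)))"
      unfolding norm_wave_V z'_def w'_def r_def using that by simp
    have "fact (n - 1) / r ^ n / pi \<le> norm (clifford_pol n (z' * w')) / r ^ n / pi"
      unfolding zw(3) using fact_le_norm_clifford_pol[OF that(2), of "r\<^sup>2"] r
      by (intro divide_right_mono) auto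
    also have "\<dots> = norm (\<i> / pi * (clifford_pol n (z' * w') / w' ^ n))"
      by (simp add: zw norm_mult norm_divide norm_power)
    also have "\<dots> \<le> norm (hankel_wave_nat n z' w' (of_real (2 * ln r)) + \<i> / pi * (clifford_pol n (z' * w') / w' ^ n))
        + norm (hankel_wave_nat n z' w' (of_real (2 * ln r)))"
      by (metis add_diff_cancel_left' norm_triangle_ineq4)
    also have "norm (hankel_wave_nat n z' w' (of_real (2 * ln r)) + \<i> / pi * (clifford_pol n (z' * w') / w' ^ n)) \<le> K * r ^ n"
      unfolding K_def by (rule norm_hankel_wave_nat_diff_le[OF zw(1,2) r(1)])
    finally show ?thesis unfolding V by simp
  qed
  have "filterlim (\<lambda>n. c ^ n / (real n * pi)) at_top sequentially" if "c > 1" for c :: real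
    using that by real_asymp
  from this[of "\<sigma> / r"] have 1: "\<forall>\<^sub>F n in sequentially. (\<sigma> / r) ^ n / (real n * pi) \<ge> 2"
    using r by (simp add: filterlim_at_top)
  have "(\<lambda>n. K * ((r * \<sigma>) ^ n / fact n)) \<longlonglongrightarrow> K * 0"
    by (intro tendsto_mult tendsto_const summable_LIMSEQ_zero sums_summable[OF sums_exp_real])
  then have 2: "\<forall>\<^sub>F n in sequentially. K * ((r * \<sigma>) ^ n / fact n) < 1"
    by (rule order_tendstoD) auto
  show ?thesis
    using 1 2 eventually_gt_at_top[of 0]
  proof eventually_elim
    case (elim n)
    have "fact n / \<sigma> ^ n * 1 \<le> fact n / \<sigma> ^ n * ((\<sigma> / r) ^ n / (real n * pi) - K * ((r * \<sigma>) ^ n / fact n))"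
    proof (rule mult_left_mono)
      show "1 \<le> (\<sigma> / r) ^ n / (real n * pi) - K * ((r * \<sigma>) ^ n / fact n)"
        using elim by linarith
    qed (use r in auto)
    also have "\<dots> = fact (n - 1) / r ^ n / pi - K * r ^ n"
      using elim r by (simp add: fact_reduce[of n] field_simps power_mult_distrib)
    finally have *: "fact n / \<sigma> ^ n \<le> fact (n - 1) / r ^ n / pi - K * r ^ n" by simp
    show ?case
    proof (intro allI impI)
      fix l assume "nat \<bar>l\<bar> = n"
      then show "fact n / \<sigma> ^ n \<le> norm (wave_V l z)"
        by (intro order_trans[OF * lower] elim(3))
    qed
  qed
qed

section \<open>Wronskian and slow decay of the Hankel functions\<close>

lemma bessel_wave_nat_rec:
  "z * (z ^ m * clifford m (z * w)) + w * (z ^ Suc (Suc m) * clifford (Suc (Suc m)) (z * w))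
    = of_nat (Suc m) * (z ^ Suc m * clifford (Suc m) (z * w))"
  by (subst clifford_rec) (simp add: algebra_simps)

text \<open>Both families satisfy the same three-term recurrence, so the expression does not depend
  on \<open>n\<close>, and order 0 is \<open>clifford_wronskian\<close>. The logarithm drops out
  because it multiplies a copy of the Bessel part.\<close>

lemma hankel_wave_nat_wronskian:
  assumes "t \<noteq> 0"
  shows "t * (t ^ Suc n * clifford (Suc n) (t * t) * hankel_wave_nat n t t L
      - t ^ n * clifford n (t * t) * hankel_wave_nat (Suc n) t t L) = \<i> / pi"
proof (induction n)
  case 0
  have "t * (t ^ Suc 0 * clifford (Suc 0) (t * t) * hankel_wave_nat 0 t t L
      - t ^ 0 * clifford 0 (t * t) * hankel_wave_nat (Suc 0) t t L)
    = \<i> / pi * (clifford 0 (t * t) + t * t * (clifford 0 (t * t) * clifford_psi 1 (t * t) - clifford_psi 0 (t * t) * clifford 1 (t * t)))"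
    using assms by (simp add: hankel_wave_nat_def field_simps)
  then show ?case unfolding clifford_wronskian by simp
next
  case (Suc n)
  define j where "j = (\<lambda>n. t ^ n * clifford n (t * t))"
  define h where "h = (\<lambda>n. hankel_wave_nat n t t L)"
  have j: "t * j (Suc (Suc n)) = of_nat (Suc n) * j (Suc n) - t * j n"
    using bessel_wave_nat_rec[of t n t] unfolding j_def by (simp add: algebra_simps)
  have h: "t * h (Suc (Suc n)) = of_nat (Suc n) * h (Suc n) - t * h n"
    using hankel_wave_nat_rec[OF assms assms, of n L] unfolding h_def by (simp add: algebra_simps)
  have "t * (j (Suc (Suc n)) * h (Suc n) - j (Suc n) * h (Suc (Suc n)))
    = t * j (Suc (Suc n)) * h (Suc n) - j (Suc n) * (t * h (Suc (Suc n)))"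
    by (simp add: algebra_simps)
  also have "\<dots> = t * (j (Suc n) * h n - j n * h (Suc n))"
    unfolding j h by (simp add: algebra_simps)
  also have "\<dots> = \<i> / pi"
    using Suc unfolding j_def h_def by simp
  finally show ?case unfolding j_def h_def .
qed

text \<open>Otherwise \<open>(r ^ (n + 1) * h (n + 1))' = 2 * r ^ (n + 1) * h n\<close> with \<open>h n = H\<^sub>n (2 r)\<close> would
  bound \<open>H\<^sub>n\<^sub>+\<^sub>1\<close>, and the Wronskian would decay faster than \<open>1 / r\<close>.\<close>
lemma hankel1_nat_no_fast_decay:
  assumes "\<And>r. r \<ge> r0 \<Longrightarrow> norm (hankel1 (int n) (2 * r)) \<le> K / (r * sqrt r)"
  shows False
proof -
  define r1 where "r1 = max r0 1"
  \<comment> \<open>Along \<open>z = w = t\<close> the logarithm of \<open>z * w\<close> becomes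
    \<open>2 * Ln t\<close>, so the ladder of the wave functions applies off the nonpositive real
    axis.\<close>
  define h where "h = (\<lambda>n t. hankel_wave_nat n t t (2 * Ln t))"
  have h_real: "h n (of_real r) = hankel1 (int n) (2 * r)" if "r > 0" for n r
    using that by (simp add: h_def hankel1_nat_eq Ln_of_real)
  have K: "K \<ge> 0"
  proof -
    have "0 \<le> K / (r1 * sqrt r1)"
      using assms[of r1] norm_ge_zero[of "hankel1 (int n) (2 * r1)"] by (simp add: r1_def del: norm_ge_zero)
    moreover have "r1 * sqrt r1 > 0" by (simp add: r1_def)
    ultimately show ?thesis by (simp add: zero_le_divide_iff)
  qed
  have deriv: "((\<lambda>t. t ^ Suc n * h (Suc n) t) has_field_derivative 2 * t ^ Suc n * h n t) (at t)"
    if "t \<notin> \<real>\<^sub>\<le>\<^sub>0" for t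
  proof -
    have t: "t \<noteq> 0" using that by auto
    have L: "((\<lambda>t. 2 * Ln t) has_field_derivative (1 / t + 1 / t)) (at t)"
      using that t by (auto intro!: derivative_eq_intros simp: field_simps)
    have hD: "(h (Suc n) has_field_derivative (1 * h n t - 1 * h (Suc (Suc n)) t)) (at t)"
      unfolding h_def by (rule DERIV_hankel_wave_nat_Suc[OF DERIV_ident DERIV_ident L t t])
    have tD: "((\<lambda>t. t ^ Suc n) has_field_derivative of_nat (Suc n) * (1 * t ^ (Suc n - Suc 0))) (at t)"
      by (rule DERIV_power[OF DERIV_ident])
    have rec: "of_nat (Suc n) * h (Suc n) t = t * h n t + t * h (Suc (Suc n)) t"
      unfolding h_def by (rule hankel_wave_nat_rec[OF t t, symmetric])
    have "of_nat (Suc n) * (1 * t ^ (Suc n - Suc 0)) * h (Suc n) t = t ^ n * (of_nat (Suc n) * h (Suc n) t)"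
      by simp
    then have "of_nat (Suc n) * (1 * t ^ (Suc n - Suc 0)) * h (Suc n) t + (1 * h n t - 1 * h (Suc (Suc n)) t) * t ^ Suc n
       = 2 * t ^ Suc n * h n t"
      unfolding rec by (simp add: algebra_simps)
    then show ?thesis
      by (rule DERIV_cong[OF DERIV_mult[OF tD hD]])
  qed
  \<comment> \<open>The derivative is at most \<open>2 * K * r ^ n\<close> on an interval of length
    at most \<open>r\<close>; after division by \<open>r ^ Suc n\<close> this contributes
    \<open>2 * K\<close>.\<close>
  define B where "B = norm (of_real r1 ^ Suc n * h (Suc n) (of_real r1)) + 2 * K"
  have bound: "norm (h (Suc n) (of_real r)) \<le> B" if r: "r \<ge> r1" for r
  proof -
    have r1: "r1 \<ge> 1" "r \<ge> 1" "r1 \<ge> r0" using r by (auto simp: r1_def)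
    let ?S = "closed_segment (of_real r1 :: complex) (of_real r)"
    have S: "\<exists>\<rho>. t = of_real \<rho> \<and> r1 \<le> \<rho> \<and> \<rho> \<le> r" if "t \<in> ?S" for t
      using that r by (auto simp: closed_segment_of_real closed_segment_eq_real_ivl)
    have "norm (of_real r ^ Suc n * h (Suc n) (of_real r) - of_real r1 ^ Suc n * h (Suc n) (of_real r1))
       \<le> (2 * K * r ^ n) * norm (of_real r - of_real r1 :: complex)"
    proof (rule field_differentiable_bound[of ?S])
      fix t assume "t \<in> ?S"
      then obtain \<rho> where \<rho>: "t = of_real \<rho>" "r1 \<le> \<rho>" "\<rho> \<le> r" using S by blast
      have "t \<notin> \<real>\<^sub>\<le>\<^sub>0" using \<rho> r1 by (auto simp: complex_nonpos_Reals_iff)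
      then show "((\<lambda>t. t ^ Suc n * h (Suc n) t) has_field_derivative 2 * t ^ Suc n * h n t) (at t within ?S)"
        by (rule has_field_derivative_at_within[OF deriv])
      have \<rho>1: "\<rho> \<ge> 1" using \<rho> r1 by simp
      have "norm (h n t) \<le> K / (\<rho> * sqrt \<rho>)"
        using \<rho> r1 assms[of \<rho>] by (simp add: h_real)
      \<comment> \<open>The decay \<open>1 / sqrt \<rho>\<close> is given away here: mere
        boundedness of \<open>h (Suc n)\<close> is the aim.\<close>
      also have "\<dots> \<le> K / (\<rho> * 1)"
        using \<rho>1 K by (intro divide_left_mono mult_left_mono) auto
      finally have "norm (2 * t ^ Suc n * h n t) \<le> 2 * \<rho> ^ Suc n * (K / \<rho>)"
        unfolding norm_mult norm_power using \<rho>1 \<rho>(1) by (intro mult_mono) auto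
      also have "\<dots> = 2 * K * \<rho> ^ n" using \<rho>1 by simp
      also have "\<dots> \<le> 2 * K * r ^ n" using \<rho> \<rho>1 K by (intro mult_left_mono power_mono) auto
      finally show "norm (2 * t ^ Suc n * h n t) \<le> 2 * K * r ^ n" .
    qed auto
    also have "norm (of_real r - of_real r1 :: complex) = r - r1"
      using r by (metis abs_of_nonneg diff_ge_0_iff_ge norm_of_real of_real_diff)
    also have "2 * K * r ^ n * (r - r1) \<le> 2 * K * r ^ n * r"
      using K r r1 by (intro mult_left_mono) auto
    finally have "norm (of_real r ^ Suc n * h (Suc n) (of_real r))
        \<le> norm (of_real r1 ^ Suc n * h (Suc n) (of_real r1)) * 1 + 2 * K * r ^ Suc n"
      using norm_triangle_ineq2[of "of_real r ^ Suc n * h (Suc n) (of_real r)" "of_real r1 ^ Suc n * h (Suc n) (of_real r1)"]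
      by (simp add: mult_ac)
    also have "\<dots> \<le> norm (of_real r1 ^ Suc n * h (Suc n) (of_real r1)) * r ^ Suc n + 2 * K * r ^ Suc n"
      using r1 K by (intro add_mono mult_left_mono one_le_power) auto
    also have "\<dots> = r ^ Suc n * B" by (simp add: B_def algebra_simps)
    finally have "r ^ Suc n * norm (h (Suc n) (of_real r)) \<le> r ^ Suc n * B"
      using r1 by (simp add: norm_mult norm_power)
    then show ?thesis using r1 by (simp add: mult_le_cancel_left)
  qed
  have wr: "sqrt r \<le> 2 * pi * K * B" if r: "r \<ge> r1" for r
  proof -
    have r1: "r \<ge> 1" "r \<ge> r0" using r by (auto simp: r1_def)
    let ?j = "\<lambda>n. of_real r ^ n * clifford n (of_real r * of_real r)"
    \<comment> \<open>The Bessel function is the real part of the Hankel function, so the Wronskian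
      is controlled by Hankel functions alone.\<close>
    have j: "norm (?j n) \<le> norm (h n (of_real r))" for n
    proof -
      have "?j n = of_real (besselJ (int n) (2 * r))"
        using besselJ_nat_eq[of n r] by (simp add: besselJ_def power2_eq_square)
      moreover have "h n (of_real r) = hankel1 (int n) (2 * r)" using r1 by (intro h_real) auto
      ultimately show ?thesis
        using abs_Re_le_cmod[of "hankel1 (int n) (2 * r)"] by (simp add: hankel1_def)
    qed
    have r0': "complex_of_real r \<noteq> 0" using r1 by auto
    have "1 / pi = norm (\<i> / pi :: complex)" by (simp add: norm_divide)
    also have "\<dots> = r * norm (?j (Suc n) * h n (of_real r) - ?j n * h (Suc n) (of_real r))"
      unfolding hankel_wave_nat_wronskian[of "of_real r" n "2 * Ln (of_real r)", symmetric, OF r0']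
      using r1 by (simp add: h_def norm_mult)
    also have "norm (?j (Suc n) * h n (of_real r) - ?j n * h (Suc n) (of_real r))
      \<le> norm (h (Suc n) (of_real r)) * norm (h n (of_real r)) + norm (h n (of_real r)) * norm (h (Suc n) (of_real r))"
      by (rule order_trans[OF norm_triangle_ineq4]) (unfold norm_mult[of "?j _"], intro add_mono mult_right_mono j, auto)
    also have "\<dots> = 2 * (norm (h n (of_real r)) * norm (h (Suc n) (of_real r)))" by simp
    also have "\<dots> \<le> 2 * (K / (r * sqrt r) * B)"
      using r1 K assms[of r] bound[OF r] by (intro mult_left_mono mult_mono) (auto simp: h_real)
    finally have "1 / pi \<le> r * (2 * (K / (r * sqrt r) * B))"
      using r1 by (simp add: mult_left_mono)
    also have "\<dots> = 2 * K * B / sqrt r" using r1 by simp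
    finally show ?thesis using r1 by (simp add: field_simps)
  qed
  define R where "R = max r1 ((2 * pi * K * B + 1) ^ 2)"
  have "2 * pi * K * B + 1 \<le> \<bar>2 * pi * K * B + 1\<bar>" by simp
  also have "\<dots> \<le> sqrt R" by (intro real_le_rsqrt) (simp add: R_def)
  finally show False using wr[of R] by (simp add: R_def)
qed

section \<open>Addition theorem\<close>

lemma summable_on_times_product:
  fixes f :: "'a \<Rightarrow> real" and g :: "'b \<Rightarrow> real"
  assumes "f summable_on A" "g summable_on B" "\<And>x. f x \<ge> 0" "\<And>y. g y \<ge> 0"
  shows "(\<lambda>(x, y). f x * g y) summable_on A \<times> B"
proof (rule summable_on_SigmaI)
  show "((\<lambda>y. (case (x, y) of (x, y) \<Rightarrow> f x * g y)) has_sum f x * infsum g B) B" for x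
    using assms(2) by (simp add: has_sum_cmult_right)
  show "(\<lambda>x. f x * infsum g B) summable_on A"
    by (intro summable_on_cmult_left assms)
qed (use assms in auto)

text \<open>The binomial coefficient hidden in \<open>fact (n + q)\<close> is absorbed by bounding a single term of the
  expansion of \<open>((\<sigma> + \<xi>) / \<eta>) ^ (n + q)\<close>; the slack \<open>\<xi> + \<sigma> < \<eta>\<close> leaves a geometric series in \<open>q\<close>.\<close>
lemma translation_majorant_nat:
  fixes \<xi> \<eta> \<sigma> :: real
  assumes "\<xi> \<ge> 0" "\<sigma> > 0" "\<xi> + \<sigma> < \<eta>"
  shows "\<xi> ^ p * \<xi> ^ q / (fact p * fact q) * (fact (nat \<bar>int n - int p + int q\<bar>) / \<eta> ^ nat \<bar>int n - int p + int q\<bar>)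
    \<le> fact n / \<sigma> ^ n * ((\<xi> * \<eta>) ^ p / fact p * ((\<sigma> + \<xi>) / \<eta>) ^ q
       + exp (\<eta> * \<sigma>) * ((\<xi> / \<eta>) ^ p * ((\<xi> * \<eta>) ^ q / fact q)))"
    (is "?T \<le> ?F * (?N1 + ?N2)")
proof -
  have \<eta>: "\<eta> > 0" using assms by simp
  have N: "?F * ?N1 \<ge> 0" "?F * ?N2 \<ge> 0" using assms \<eta> by auto
  show ?thesis
  \<comment> \<open>The shifted order \<open>n - p + q\<close> is nonnegative in the first case and
    negative in the second; the summands \<open>?N1\<close> and \<open>?N2\<close> serve one case
    each.\<close>
  proof (cases "p \<le> n + q")
    case True
    then have m: "nat \<bar>int n - int p + int q\<bar> = n + q - p" by linarith
    have \<eta>m: "1 / \<eta> ^ (n + q - p) = \<eta> ^ p / (\<eta> ^ n * \<eta> ^ q)"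
      using True \<eta> by (simp add: power_diff flip: power_add)
    have "((n + q) choose q) * (\<xi> / \<eta>) ^ q * (\<sigma> / \<eta>) ^ n
        \<le> (\<Sum>k\<le>n + q. ((n + q) choose k) * (\<xi> / \<eta>) ^ k * (\<sigma> / \<eta>) ^ (n + q - k))"
      using member_le_sum[of q "{..n + q}" "\<lambda>k. ((n + q) choose k) * (\<xi> / \<eta>) ^ k * (\<sigma> / \<eta>) ^ (n + q - k)"] assms \<eta>
      by simp
    also have "\<dots> = ((\<sigma> + \<xi>) / \<eta>) ^ (n + q)"
      by (subst binomial_ring[symmetric]) (simp add: add_divide_distrib add.commute)
    also have "\<dots> \<le> ((\<sigma> + \<xi>) / \<eta>) ^ q"
      using assms \<eta> by (intro power_decreasing) (auto simp: divide_simps)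
    finally have b: "((n + q) choose q) * (\<xi> / \<eta>) ^ q * (\<sigma> / \<eta>) ^ n \<le> ((\<sigma> + \<xi>) / \<eta>) ^ q" .
    have "?T \<le> \<xi> ^ p * \<xi> ^ q / (fact p * fact q) * (fact (n + q) / \<eta> ^ (n + q - p))"
      unfolding m using assms \<eta> by (intro mult_left_mono divide_right_mono fact_mono) auto
    also have "\<dots> = \<xi> ^ p * \<xi> ^ q / (fact p * fact q) * (fact (n + q) * (\<eta> ^ p / (\<eta> ^ n * \<eta> ^ q)))"
      using \<eta>m by (simp add: divide_inverse)
    also have "fact (n + q) = fact q * fact n * real ((n + q) choose q)"
    proof -
      have "real (fact (n + q)) = real (fact q * fact n * ((n + q) choose q))"
        using binomial_fact_lemma[of q "n + q"] by simp
      then show ?thesis by (simp only: of_nat_mult of_nat_fact)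
    qed
    also have "\<xi> ^ p * \<xi> ^ q / (fact p * fact q) * (fact q * fact n * real ((n + q) choose q) * (\<eta> ^ p / (\<eta> ^ n * \<eta> ^ q)))
      = ?F * ((\<xi> * \<eta>) ^ p / fact p * (((n + q) choose q) * (\<xi> / \<eta>) ^ q * (\<sigma> / \<eta>) ^ n))"
    proof -
      have "P * Q / (fp * fq) * (fq * fn * c * (E / (A * B))) = fn / S * (P * E / fp * (c * (Q / B) * (S / A)))"
        if "fq \<noteq> 0" "S \<noteq> 0" for P Q fp fq fn c E A B S :: real
        using that by (simp add: mult_ac)
      from this[of "fact q" "\<sigma> ^ n" "\<xi> ^ p" "\<xi> ^ q" "fact p" "fact n" "real ((n + q) choose q)"] show ?thesis
        unfolding power_divide power_mult_distrib using assms by (simp only: mult.assoc) simp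
    qed
    also have "\<dots> \<le> ?F * ?N1"
      using assms \<eta> by (intro mult_left_mono b) auto
    finally show ?thesis using N by (simp add: distrib_left)
  next
    case False
    define m where "m = p - n - q"
    have p: "p = n + q + m" and m: "nat \<bar>int n - int p + int q\<bar> = m" using False by (auto simp: m_def)
    have "fact m * fact n \<le> (fact p :: real)"
    proof -
      have "fact m * fact n \<le> (fact (m + n) :: real)"
      proof -
        have "fact m * fact n \<le> (fact (m + n) :: nat)"
          by (intro dvd_imp_le fact_fact_dvd_fact) simp
        then have "real (fact m * fact n) \<le> real (fact (m + n))" by (rule of_nat_mono)
        then show ?thesis by (simp only: of_nat_mult of_nat_fact)
      qed
      also have "\<dots> \<le> fact p" by (intro fact_mono) (simp add: p)
      finally show ?thesis .
    qed
    then have f: "fact m / fact p \<le> (1 / fact n :: real)" by (simp add: field_simps)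
    have "?T = \<xi> ^ p * \<xi> ^ q / fact q / \<eta> ^ m * (fact m / fact p)" unfolding m by simp
    also have "\<dots> \<le> \<xi> ^ p * \<xi> ^ q / fact q / \<eta> ^ m * (1 / fact n)"
      using assms \<eta> by (intro mult_left_mono f) auto
    \<comment> \<open>The factor \<open>\<sigma> ^ n\<close> is inserted to produce the weight; its
      counterpart \<open>(\<eta> * \<sigma>) ^ n / fact n\<close> is then a single term of the
      series of \<open>exp (\<eta> * \<sigma>)\<close>.\<close>
    also have "\<dots> = (\<xi> / \<eta>) ^ p * ((\<xi> * \<eta>) ^ q / fact q) * ((\<eta> * \<sigma>) ^ n / fact n * (1 / \<sigma> ^ n))"
      using assms \<eta> by (simp add: p power_add power_divide power_mult_distrib field_simps)
    also have "\<dots> \<le> (\<xi> / \<eta>) ^ p * ((\<xi> * \<eta>) ^ q / fact q) * (exp (\<eta> * \<sigma>) * (fact n / \<sigma> ^ n))"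
      using assms \<eta> by (intro mult_left_mono mult_mono power_div_fact_le_exp divide_right_mono) auto
    also have "\<dots> = ?F * ?N2" by (simp only: mult_ac)
    finally show ?thesis using N by (simp add: distrib_left)
  qed
qed

text \<open>The point is that \<open>M\<close> does not depend on \<open>l\<close>: the whole
  dependence on the order sits in the weight, so a series over \<open>l\<close> can later be summed
  on top. Negating \<open>l\<close> exchanges \<open>p\<close> and \<open>q\<close>, hence a
  symmetrised \<open>M\<close>.\<close>

lemma translation_majorant:
  fixes \<xi> \<eta> \<sigma> :: real
  assumes "\<xi> \<ge> 0" "\<sigma> > 0" "\<xi> + \<sigma> < \<eta>"
  obtains M :: "nat \<times> nat \<Rightarrow> real" where "M summable_on UNIV" "\<And>pq. M pq \<ge> 0"
    "\<And>l p q. \<xi> ^ p * \<xi> ^ q / (fact p * fact q) * (fact (nat \<bar>l - int p + int q\<bar>) / \<eta> ^ nat \<bar>l - int p + int q\<bar>)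
      \<le> fact (nat \<bar>l\<bar>) / \<sigma> ^ nat \<bar>l\<bar> * M (p, q)"
proof -
  have \<eta>: "\<eta> > 0" using assms by simp
  define N where "N = (\<lambda>p q. (\<xi> * \<eta>) ^ p / fact p * ((\<sigma> + \<xi>) / \<eta>) ^ q
       + exp (\<eta> * \<sigma>) * ((\<xi> / \<eta>) ^ p * ((\<xi> * \<eta>) ^ q / fact q)))"
  define M where "M = (\<lambda>(p, q). N p q + N q p)"
  have N0: "N p q \<ge> 0" for p q
    unfolding N_def using assms \<eta> by (intro add_nonneg_nonneg mult_nonneg_nonneg) auto
  have e: "(\<lambda>p. (\<xi> * \<eta>) ^ p / fact p) summable_on UNIV"
    using assms \<eta> sums_summable[OF sums_exp_real] by (intro summable_nonneg_imp_summable_on) auto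
  have g: "(\<lambda>p. c ^ p) summable_on UNIV" if "0 \<le> c" "c < 1" for c :: real
    using that by (intro summable_nonneg_imp_summable_on summable_geometric) auto
  have "(\<lambda>(p, q). (\<xi> * \<eta>) ^ p / fact p * ((\<sigma> + \<xi>) / \<eta>) ^ q) summable_on UNIV \<times> UNIV"
    using assms \<eta> by (intro summable_on_times_product e g) (auto simp: divide_simps)
  moreover have "(\<lambda>(p, q). (\<xi> / \<eta>) ^ p * ((\<xi> * \<eta>) ^ q / fact q)) summable_on UNIV \<times> UNIV"
    using assms \<eta> by (intro summable_on_times_product e g) (auto simp: divide_simps)
  ultimately have "(\<lambda>pq. (case pq of (p, q) \<Rightarrow> (\<xi> * \<eta>) ^ p / fact p * ((\<sigma> + \<xi>) / \<eta>) ^ q)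
     + exp (\<eta> * \<sigma>) * (case pq of (p, q) \<Rightarrow> (\<xi> / \<eta>) ^ p * ((\<xi> * \<eta>) ^ q / fact q))) summable_on UNIV \<times> UNIV"
    by (intro summable_on_add summable_on_cmult_right)
  also have "(\<lambda>pq. (case pq of (p, q) \<Rightarrow> (\<xi> * \<eta>) ^ p / fact p * ((\<sigma> + \<xi>) / \<eta>) ^ q)
     + exp (\<eta> * \<sigma>) * (case pq of (p, q) \<Rightarrow> (\<xi> / \<eta>) ^ p * ((\<xi> * \<eta>) ^ q / fact q))) = (\<lambda>(p, q). N p q)"
    by (auto simp: N_def)
  finally have 1: "(\<lambda>(p, q). N p q) summable_on UNIV \<times> UNIV" .
  then have "(\<lambda>(p, q). N q p) summable_on UNIV \<times> UNIV"
    by (subst (asm) summable_on_swap) auto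
  from summable_on_add[OF 1 this] have "M summable_on UNIV"
    by (simp add: M_def case_prod_unfold)
  moreover have "M pq \<ge> 0" for pq
    using N0 by (auto simp: M_def case_prod_unfold)
  moreover have "\<xi> ^ p * \<xi> ^ q / (fact p * fact q) * (fact (nat \<bar>l - int p + int q\<bar>) / \<eta> ^ nat \<bar>l - int p + int q\<bar>)
      \<le> fact (nat \<bar>l\<bar>) / \<sigma> ^ nat \<bar>l\<bar> * M (p, q)" (is "?T \<le> ?F * _") for l p q
  proof (cases "l \<ge> 0")
    case True
    have "?T \<le> ?F * N p q"
      using translation_majorant_nat[OF assms, of p q "nat l"] True by (simp add: N_def)
    also have "\<dots> \<le> ?F * M (p, q)"
      using assms N0[of q p] by (intro mult_left_mono) (auto simp: M_def)
    finally show ?thesis .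
  next
    case False
    then have "nat \<bar>l - int p + int q\<bar> = nat \<bar>int (nat \<bar>l\<bar>) - int q + int p\<bar>" by linarith
    then have "?T \<le> ?F * N q p"
      using translation_majorant_nat[OF assms, of q p "nat \<bar>l\<bar>"] unfolding N_def by (simp only: mult.commute[of "\<xi> ^ q"] mult.commute[of "fact q"])
    also have "\<dots> \<le> ?F * M (p, q)"
      using assms N0[of p q] by (intro mult_left_mono) (auto simp: M_def)
    finally show ?thesis .
  qed
  ultimately show ?thesis by (rule that)
qed

section \<open>Taylor expansion along a complex line and Graf's theorem\<close>

lemma pascal_sum:
  fixes a :: "nat \<Rightarrow> complex"
  shows "(\<Sum>i\<le>N. of_nat (N choose i) * a (Suc i)) + (\<Sum>i\<le>N. of_nat (N choose i) * a i)
    = (\<Sum>i\<le>Suc N. of_nat (Suc N choose i) * a i)"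
proof -
  have "(\<Sum>i\<le>N. of_nat (N choose i) * a i) = (\<Sum>i\<le>Suc N. of_nat (N choose i) * a i)" by simp
  also have "\<dots> = a 0 + (\<Sum>i\<le>N. of_nat (N choose Suc i) * a (Suc i))"
    by (subst sum.atMost_Suc_shift) simp
  finally have 1: "(\<Sum>i\<le>N. of_nat (N choose i) * a i) = \<dots>" .
  have "(\<Sum>i\<le>Suc N. of_nat (Suc N choose i) * a i) = a 0 + (\<Sum>i\<le>N. of_nat (Suc N choose Suc i) * a (Suc i))"
    by (subst sum.atMost_Suc_shift) simp
  then show ?thesis
    unfolding 1 by (simp add: sum.distrib algebra_simps)
qed

text \<open>Differentiation acts as \<open>x\<close> times the down-shift of the order plus
  \<open>v\<close> times the up-shift. The shifts commute, so the binomial theorem gives the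
  \<open>N\<close>-th power.\<close>

lemma higher_deriv_ladder:
  fixes \<phi> :: "int \<Rightarrow> complex \<Rightarrow> complex"
  assumes S: "open S" "t \<in> S"
    and \<phi>: "\<And>l t. t \<in> S \<Longrightarrow> (\<phi> l has_field_derivative x * \<phi> (l - 1) t + v * \<phi> (l + 1) t) (at t)"
  shows "(deriv ^^ N) (\<phi> l) t
    = (\<Sum>i\<le>N. of_nat (N choose i) * (x ^ i * v ^ (N - i) * \<phi> (l - int i + int (N - i)) t))"
proof (induction N arbitrary: l)
  case (Suc N)
  have hol: "\<phi> l holomorphic_on S" for l
    using \<phi> S by (auto simp: holomorphic_on_open)
  have "(deriv ^^ Suc N) (\<phi> l) t = (deriv ^^ N) (deriv (\<phi> l)) t"
    by (simp add: funpow_Suc_right del: funpow.simps)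
  also have "\<dots> = (deriv ^^ N) (\<lambda>t. x * \<phi> (l - 1) t + v * \<phi> (l + 1) t) t"
    using S \<phi> by (intro higher_deriv_transform_within_open[of _ S] holomorphic_intros hol holomorphic_deriv DERIV_imp_deriv)
  also have "\<dots> = (deriv ^^ N) (\<lambda>t. x * \<phi> (l - 1) t) t + (deriv ^^ N) (\<lambda>t. v * \<phi> (l + 1) t) t"
    using S by (intro higher_deriv_add[of _ S] holomorphic_intros hol)
  also have "\<dots> = x * (deriv ^^ N) (\<phi> (l - 1)) t + v * (deriv ^^ N) (\<phi> (l + 1)) t"
    using S by (simp add: higher_deriv_cmult[OF hol])
  also have "x * (deriv ^^ N) (\<phi> (l - 1)) t = (\<Sum>i\<le>N. of_nat (N choose i) *
      (x ^ Suc i * v ^ (Suc N - Suc i) * \<phi> (l - int (Suc i) + int (Suc N - Suc i)) t))"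
    unfolding Suc.IH sum_distrib_left by (intro sum.cong) (auto simp: algebra_simps)
  also have "v * (deriv ^^ N) (\<phi> (l + 1)) t = (\<Sum>i\<le>N. of_nat (N choose i) *
      (x ^ i * v ^ (Suc N - i) * \<phi> (l - int i + int (Suc N - i)) t))"
    unfolding Suc.IH sum_distrib_left by (intro sum.cong) (auto simp: Suc_diff_le algebra_simps)
  finally show ?case
    using pascal_sum[of N "\<lambda>i. x ^ i * v ^ (Suc N - i) * \<phi> (l - int i + int (Suc N - i)) t"] by simp
qed simp

lemma norm_translate_coeff_le:
  assumes "cmod x \<le> \<xi>" "y \<noteq> 0" "\<sigma> > 0" "\<xi> + \<sigma> < cmod y"
  obtains M :: "nat \<times> nat \<Rightarrow> real" where "M summable_on UNIV" "\<And>pq. M pq \<ge> 0"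
    "\<And>l p q. norm (x ^ p * (- cnj x) ^ q / (fact p * fact q) * wave_V (l - int p + int q) y)
      \<le> fact (nat \<bar>l\<bar>) / \<sigma> ^ nat \<bar>l\<bar> * M (p, q)"
proof -
  obtain K where K: "K > 0" "\<And>l. norm (wave_V l y) \<le> K * (fact (nat \<bar>l\<bar>) / cmod y ^ nat \<bar>l\<bar>)"
    using norm_wave_V_le[OF assms(2)] by blast
  have \<xi>: "\<xi> \<ge> 0" using assms(1) norm_ge_zero[of x] by linarith
  obtain M :: "nat \<times> nat \<Rightarrow> real" where M: "M summable_on UNIV" "\<And>pq. M pq \<ge> 0"
    "\<And>l p q. \<xi> ^ p * \<xi> ^ q / (fact p * fact q) * (fact (nat \<bar>l - int p + int q\<bar>) / cmod y ^ nat \<bar>l - int p + int q\<bar>)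
      \<le> fact (nat \<bar>l\<bar>) / \<sigma> ^ nat \<bar>l\<bar> * M (p, q)"
    using translation_majorant[OF \<xi> assms(3,4)] by blast
  show ?thesis
  proof (rule that[of "\<lambda>pq. K * M pq"])
    show "(\<lambda>pq. K * M pq) summable_on UNIV" by (intro summable_on_cmult_right M)
    show "K * M pq \<ge> 0" for pq using K M by simp
    show "norm (x ^ p * (- cnj x) ^ q / (fact p * fact q) * wave_V (l - int p + int q) y)
      \<le> fact (nat \<bar>l\<bar>) / \<sigma> ^ nat \<bar>l\<bar> * (K * M (p, q))" for l p q
    proof -
      have "norm (x ^ p * (- cnj x) ^ q / (fact p * fact q) * wave_V (l - int p + int q) y)
        = cmod x ^ p * cmod x ^ q / (fact p * fact q) * norm (wave_V (l - int p + int q) y)"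
        by (simp add: norm_mult norm_divide norm_power)
      also have "\<dots> \<le> \<xi> ^ p * \<xi> ^ q / (fact p * fact q) *
          (K * (fact (nat \<bar>l - int p + int q\<bar>) / cmod y ^ nat \<bar>l - int p + int q\<bar>))"
        using assms(1) \<xi> by (intro mult_mono divide_right_mono power_mono K) auto
      also have "\<dots> \<le> K * (fact (nat \<bar>l\<bar>) / \<sigma> ^ nat \<bar>l\<bar> * M (p, q))"
        using mult_left_mono[OF M(3)[of p q l], of K] K by (simp add: mult_ac)
      finally show ?thesis by (simp add: mult_ac)
    qed
  qed
qed

text \<open>This is the Taylor series at \<open>t = 0\<close> of the wave at
  \<open>y + t * x\<close>, evaluated at \<open>t = 1\<close>, which lies in the disc because
  \<open>cmod x < cmod y\<close>. The majorant upgrades summation by total degree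
  \<open>p + q\<close> to unconditional summation over pairs.\<close>

lemma wave_V_translate:
  assumes xy: "cmod x < cmod y"
  shows "((\<lambda>(p, q). x ^ p * (- cnj x) ^ q / (fact p * fact q) * wave_V (l - int p + int q) y)
    has_sum wave_V l (y + x)) UNIV"
proof -
  have y: "y \<noteq> 0" using xy by auto
  \<comment> \<open>For \<open>x = 0\<close> any radius above 1 would do.\<close>
  define R where "R = (if x = 0 then 2 else cmod y / cmod x)"
  have R: "R > 1" using xy by (auto simp: R_def)
  have Rx: "cmod (t * x) < cmod y" if "t \<in> ball 0 R" for t
    using that y by (cases "x = 0") (auto simp: R_def norm_mult field_simps)
  \<comment> \<open>For real \<open>t\<close> the last argument is
    \<open>2 * ln (cmod (y + t * x))\<close>. With \<open>y\<close> split off, the remaining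
    logarithms are of numbers with positive real part, so the principal branch is holomorphic on the
    whole disc.\<close>
  define \<phi> where "\<phi> = (\<lambda>l t. hankel_wave l (y + t * x) (cnj y + t * cnj x)
     (of_real (2 * ln (cmod y)) + (Ln (1 + t * (x / y)) + Ln (1 + t * cnj (x / y)))))"
  have pos: "Re (1 + t * (x / y)) > 0" "Re (1 + t * cnj (x / y)) > 0" "y + t * x \<noteq> 0" "cnj y + t * cnj x \<noteq> 0"
    if "t \<in> ball 0 R" for t
  proof -
    have "cmod (t * (x / y)) < 1" "cmod (t * cnj (x / y)) < 1"
      using Rx[OF that] y by (auto simp: norm_mult norm_divide field_simps)
    then show "Re (1 + t * (x / y)) > 0" "Re (1 + t * cnj (x / y)) > 0"
      using abs_Re_le_cmod[of "t * (x / y)"] abs_Re_le_cmod[of "t * cnj (x / y)"]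
      by (auto simp del: complex_cnj_divide)
    show "y + t * x \<noteq> 0" "cnj y + t * cnj x \<noteq> 0"
      using Rx[OF that] norm_diff_ineq[of y "t * x"] norm_diff_ineq[of "cnj y" "t * cnj x"]
      by (auto simp: norm_mult)
  qed
  have \<phi>': "(\<phi> l has_field_derivative x * \<phi> (l - 1) t + - cnj x * \<phi> (l + 1) t) (at t)" if t: "t \<in> ball 0 R" for l t
  proof -
    have nn: "1 + t * (x / y) \<notin> \<real>\<^sub>\<le>\<^sub>0" "1 + t * cnj (x / y) \<notin> \<real>\<^sub>\<le>\<^sub>0"
      using pos[OF t] by (auto simp: complex_nonpos_Reals_iff)
    have ne: "1 + t * (x / y) \<noteq> 0" "1 + t * cnj (x / y) \<noteq> 0"
      using pos[OF t] by (metis zero_complex.simps(1) less_irrefl)+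
    have Ln1: "((\<lambda>t. Ln (1 + t * c)) has_field_derivative c / (1 + t * c)) (at t)"
      if "1 + t * c \<notin> \<real>\<^sub>\<le>\<^sub>0" for c
      using that by (auto intro!: derivative_eq_intros simp: divide_inverse)
    have "((\<lambda>t. of_real (2 * ln (cmod y)) + (Ln (1 + t * (x / y)) + Ln (1 + t * cnj (x / y))))
      has_field_derivative ((x / y) / (1 + t * (x / y)) + cnj (x / y) / (1 + t * cnj (x / y)))) (at t)"
      using DERIV_add[OF DERIV_const[of "of_real (2 * ln (cmod y))"] DERIV_add[OF Ln1[OF nn(1)] Ln1[OF nn(2)]]] by simp
    also have "(x / y) / (1 + t * (x / y)) = x / (y + t * x)"
      using y ne pos(3)[OF t] by (simp add: divide_simps)
    also have "cnj (x / y) / (1 + t * cnj (x / y)) = cnj x / (cnj y + t * cnj x)"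
      using y ne pos(4)[OF t] by (simp add: divide_simps)
    finally have L: "((\<lambda>t. of_real (2 * ln (cmod y)) + (Ln (1 + t * (x / y)) + Ln (1 + t * cnj (x / y))))
      has_field_derivative (x / (y + t * x) + cnj x / (cnj y + t * cnj x))) (at t)" .
    have z: "((\<lambda>t. y + t * x) has_field_derivative x) (at t)"
      and w: "((\<lambda>t. cnj y + t * cnj x) has_field_derivative cnj x) (at t)"
      by (auto intro!: derivative_eq_intros)
    have "(\<phi> l has_field_derivative x * \<phi> (l - 1) t - cnj x * \<phi> (l + 1) t) (at t)"
      unfolding \<phi>_def by (rule DERIV_hankel_wave[OF z w L pos(3,4)[OF t]])
    then show ?thesis by simp
  qed
  have \<phi>0: "\<phi> l 0 = wave_V l y" for l by (simp add: \<phi>_def wave_V_def)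
  have \<phi>1: "\<phi> l 1 = wave_V l (y + x)" for l
  proof -
    have 1: "(1 :: complex) \<in> ball 0 R" using R by simp
    have nz: "1 + x / y \<noteq> 0" using pos(1)[OF 1] by (metis less_irrefl mult_1 zero_complex.simps(1))
    have nn: "1 + x / y \<notin> \<real>\<^sub>\<le>\<^sub>0" using pos(1)[OF 1] by (auto simp: complex_nonpos_Reals_iff)
    have "Ln (1 + x / y) + Ln (1 + cnj (x / y)) = of_real (2 * ln (cmod (1 + x / y)))"
    proof -
      have "Ln (1 + cnj (x / y)) = cnj (Ln (1 + x / y))" using nn by (subst cnj_Ln) auto
      then show ?thesis using nz by (simp add: complex_add_cnj Re_Ln)
    qed
    moreover have "ln (cmod y) + ln (cmod (1 + x / y)) = ln (cmod (y + x))"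
    proof -
      have "y + x = y * (1 + x / y)" using y by (simp add: field_simps)
      then have "cmod (y + x) = cmod y * cmod (1 + x / y)" by (simp only: norm_mult)
      then show ?thesis using y nz by (simp add: ln_mult)
    qed
    then have "2 * ln (cmod y) + 2 * ln (cmod (1 + x / y)) = 2 * ln (cmod (y + x))" by simp
    ultimately have "of_real (2 * ln (cmod y)) + (Ln (1 + x / y) + Ln (1 + cnj (x / y))) = complex_of_real (2 * ln (cmod (y + x)))"
      by (metis of_real_add)
    then show ?thesis by (simp add: \<phi>_def wave_V_def del: of_real_mult)
  qed
  define f where "f = (\<lambda>(p, q). x ^ p * (- cnj x) ^ q / (fact p * fact q) * wave_V (l - int p + int q) y)"
  have "\<phi> l holomorphic_on ball 0 R"
    unfolding holomorphic_on_open[OF open_ball] using \<phi>' by blast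
  from holomorphic_power_series[OF this, of 1]
  have "(\<lambda>n. (deriv ^^ n) (\<phi> l) 0 / fact n) sums \<phi> l 1" using R by simp
  also have "(\<lambda>n. (deriv ^^ n) (\<phi> l) 0 / fact n) = (\<lambda>N. \<Sum>i\<le>N. f (i, N - i))"
  proof
    fix N
    have "(deriv ^^ N) (\<phi> l) 0 / fact N =
       (\<Sum>i\<le>N. of_nat (N choose i) * (x ^ i * (- cnj x) ^ (N - i) * \<phi> (l - int i + int (N - i)) 0)) / fact N"
      using R by (subst higher_deriv_ladder[of "ball 0 R", OF _ _ \<phi>']) auto
    also have "\<dots> = (\<Sum>i\<le>N. f (i, N - i))"
      unfolding sum_divide_distrib f_def \<phi>0 by (intro sum.cong) (auto simp: binomial_fact)
    finally show "(deriv ^^ N) (\<phi> l) 0 / fact N = (\<Sum>i\<le>N. f (i, N - i))" .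
  qed
  finally have sums: "(\<lambda>N. \<Sum>i\<le>N. f (i, N - i)) sums wave_V l (y + x)" unfolding \<phi>1 .
  have "f summable_on UNIV"
  proof -
    define \<sigma> where "\<sigma> = (cmod y - cmod x) / 2"
    have \<sigma>: "\<sigma> > 0" "cmod x + \<sigma> < cmod y" using xy by (auto simp: \<sigma>_def field_simps)
    obtain M :: "nat \<times> nat \<Rightarrow> real" where M: "M summable_on UNIV" "\<And>pq. M pq \<ge> 0"
      "\<And>l p q. norm (x ^ p * (- cnj x) ^ q / (fact p * fact q) * wave_V (l - int p + int q) y)
      \<le> fact (nat \<bar>l\<bar>) / \<sigma> ^ nat \<bar>l\<bar> * M (p, q)"
      using norm_translate_coeff_le[OF order_refl y \<sigma>] by blast
    have "(\<lambda>pq. norm (f pq)) summable_on UNIV"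
    proof (rule Infinite_Sum.abs_summable_on_comparison_test')
      show "(\<lambda>pq. fact (nat \<bar>l\<bar>) / \<sigma> ^ nat \<bar>l\<bar> * M pq) summable_on UNIV"
        by (intro summable_on_cmult_right M)
      show "norm (f pq) \<le> fact (nat \<bar>l\<bar>) / \<sigma> ^ nat \<bar>l\<bar> * M pq" for pq
        using M(3)[of "fst pq" "snd pq" l] by (simp add: f_def case_prod_unfold)
    qed
    then show ?thesis by (simp add: summable_on_iff_abs_summable_on_complex)
  qed
  then obtain S where S: "(f has_sum S) UNIV" by (auto simp: summable_on_def)
  also have "(f has_sum S) UNIV \<longleftrightarrow> ((\<lambda>(N, i). f (i, N - i)) has_sum S) (Sigma UNIV (\<lambda>N. {..N}))"
    by (rule has_sum_reindex_bij_witness[of _ "\<lambda>(N, i). (i, N - i)" "\<lambda>(p, q). (p + q, p)"]) auto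
  finally have "((\<lambda>N. \<Sum>i\<le>N. f (i, N - i)) has_sum S) UNIV"
    by (rule has_sum_SigmaD) (auto intro: has_sum_finite)
  then have "(\<lambda>N. \<Sum>i\<le>N. f (i, N - i)) sums S" by (rule has_sum_imp_sums)
  with sums have "S = wave_V l (y + x)" by (rule sums_unique2[symmetric])
  with S show ?thesis unfolding f_def by simp
qed

text \<open>The sum is the coefficient of \<open>s ^ n\<close> in
  \<open>exp (x * s) * exp (- cnj x / s)\<close>, the generating function of the Bessel functions.
  It is what regroups the Taylor expansion by angular index.\<close>

lemma wave_U_has_sum:
  "((\<lambda>(p, q). x ^ p * (- cnj x) ^ q / (fact p * fact q)) has_sum wave_U n x) {(p, q). int p - int q = n}"
proof -
  have cl: "((\<lambda>j. (-1) ^ j / (fact j * fact (m + j)) * s ^ j) has_sum clifford m s) UNIV" for m s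
    unfolding clifford_def
  proof (rule norm_summable_imp_has_sum[OF _ summable_sums[OF summable_clifford]])
    show "summable (\<lambda>j. norm ((-1) ^ j / (fact j * fact (m + j)) * s ^ j))"
      by (rule summable_comparison_test'[OF summable_divide[OF sums_summable[OF sums_exp_real]]])
         (use norm_clifford_coeff_le in auto)
  qed
  show ?thesis
  proof (cases "n \<ge> 0")
    case True
    have "((\<lambda>j. x ^ nat n * ((-1) ^ j / (fact j * fact (nat n + j)) * (x * cnj x) ^ j)) has_sum wave_U n x) UNIV"
      using has_sum_cmult_right[OF cl, of "x ^ nat n"] True by (simp add: wave_U_def bessel_wave_def)
    also have "?this \<longleftrightarrow> ?thesis"
      by (rule has_sum_reindex_bij_witness[of _ snd "\<lambda>j. (nat n + j, j)"])
         (use True in \<open>auto simp: power_add power_mult_distrib power_minus[of "cnj x"] mult_ac\<close>)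
    finally show ?thesis .
  next
    case False
    have "((\<lambda>j. (- cnj x) ^ nat (- n) * ((-1) ^ j / (fact j * fact (nat (- n) + j)) * (x * cnj x) ^ j)) has_sum wave_U n x) UNIV"
      using has_sum_cmult_right[OF cl, of "(- cnj x) ^ nat (- n)"] False by (simp add: wave_U_def bessel_wave_def)
    also have "?this \<longleftrightarrow> ?thesis"
      by (rule has_sum_reindex_bij_witness[of _ fst "\<lambda>j. (j, nat (- n) + j)"])
         (use False in \<open>auto simp: power_add power_mult_distrib power_minus[of "cnj x"] mult_ac\<close>)
    finally show ?thesis .
  qed
qed

text \<open>Everything rests on one absolutely convergent series over \<open>(l, p, q)\<close>.
  Summed over \<open>(p, q)\<close> first it gives the translated waves; grouped by
  \<open>n = p - q\<close> it gives products of waves.\<close>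

lemma source_double_series:
  assumes "\<sigma> > 0" "cmod x + \<sigma> < cmod y"
    and \<beta>: "(\<lambda>l. norm (\<beta> l) * (fact (nat \<bar>l\<bar>) / \<sigma> ^ nat \<bar>l\<bar>)) summable_on UNIV"
  shows "((\<lambda>(l, n). \<beta> l * (wave_U n x * wave_V (l - n) y)) has_sum (\<Sum>\<^sub>\<infinity>l. \<beta> l * wave_V l (y + x))) UNIV"
proof -
  have "cmod y > 0" using assms norm_ge_zero[of x] by linarith
  then have xy: "cmod x < cmod y" and y: "y \<noteq> 0" using assms by auto
  define c where "c = (\<lambda>(p, q). x ^ p * (- cnj x) ^ q / (fact p * fact q) :: complex)"
  define F where "F = (\<lambda>(l, p, q). \<beta> l * (c (p, q) * wave_V (l - int p + int q) y))"
  obtain M :: "nat \<times> nat \<Rightarrow> real" where M: "M summable_on UNIV" "\<And>pq. M pq \<ge> 0"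
    "\<And>l p q. norm (x ^ p * (- cnj x) ^ q / (fact p * fact q) * wave_V (l - int p + int q) y)
      \<le> fact (nat \<bar>l\<bar>) / \<sigma> ^ nat \<bar>l\<bar> * M (p, q)"
    using norm_translate_coeff_le[OF order_refl y assms(1,2)] by blast
  have "(\<lambda>lpq. norm (F lpq)) summable_on UNIV \<times> UNIV"
  proof (rule Infinite_Sum.abs_summable_on_comparison_test')
    show "(\<lambda>(l, pq). norm (\<beta> l) * (fact (nat \<bar>l\<bar>) / \<sigma> ^ nat \<bar>l\<bar>) * M pq) summable_on UNIV \<times> UNIV"
      using assms(1) by (intro summable_on_times_product \<beta> M) auto
    show "norm (F lpq) \<le> (case lpq of (l, pq) \<Rightarrow> norm (\<beta> l) * (fact (nat \<bar>l\<bar>) / \<sigma> ^ nat \<bar>l\<bar>) * M pq)" for lpq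
    proof -
      obtain l p q where lpq: "lpq = (l, p, q)" by (cases lpq) auto
      have "norm (F lpq) \<le> norm (\<beta> l) * (fact (nat \<bar>l\<bar>) / \<sigma> ^ nat \<bar>l\<bar> * M (p, q))"
        unfolding F_def c_def lpq prod.case norm_mult[of "\<beta> l"] by (intro mult_left_mono M(3)) simp
      then show ?thesis by (simp add: lpq mult.assoc)
    qed
  qed
  then have "F summable_on UNIV \<times> UNIV" by (simp add: summable_on_iff_abs_summable_on_complex)
  then obtain S where S: "(F has_sum S) (UNIV \<times> UNIV)" by (auto simp: summable_on_def)
  have "((\<lambda>l. \<beta> l * wave_V l (y + x)) has_sum S) UNIV"
  proof (rule has_sum_SigmaD[OF S])
    fix l
    show "((\<lambda>pq. F (l, pq)) has_sum \<beta> l * wave_V l (y + x)) UNIV"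
      using has_sum_cmult_right[OF wave_V_translate[OF xy, of l], of "\<beta> l"]
      by (simp add: F_def c_def case_prod_unfold)
  qed
  then have S_eq: "S = (\<Sum>\<^sub>\<infinity>l. \<beta> l * wave_V l (y + x))" by (simp add: infsumI)
  have "(F has_sum S) (UNIV \<times> UNIV) \<longleftrightarrow>
    ((\<lambda>(ln, pq). F (fst ln, pq)) has_sum S) (Sigma UNIV (\<lambda>ln. {(p, q). int p - int q = snd ln}))"
    by (rule has_sum_reindex_bij_witness[of _ "\<lambda>(ln, pq). (fst ln, pq)" "\<lambda>(l, pq). ((l, int (fst pq) - int (snd pq)), pq)"])
       auto
  with S have "((\<lambda>(ln, pq). F (fst ln, pq)) has_sum S) (Sigma UNIV (\<lambda>ln. {(p, q). int p - int q = snd ln}))"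
    by blast
  then have "((\<lambda>ln. \<beta> (fst ln) * (wave_U (snd ln) x * wave_V (fst ln - snd ln) y)) has_sum S) UNIV"
  proof (rule has_sum_SigmaD)
    fix ln :: "int \<times> int"
    have "((\<lambda>pq. \<beta> (fst ln) * (c pq * wave_V (fst ln - snd ln) y)) has_sum
       \<beta> (fst ln) * (wave_U (snd ln) x * wave_V (fst ln - snd ln) y)) {(p, q). int p - int q = snd ln}"
      unfolding c_def by (intro has_sum_cmult_right has_sum_cmult_left wave_U_has_sum)
    then show "((\<lambda>pq. case (ln, pq) of (ln, pq) \<Rightarrow> F (fst ln, pq)) has_sum
       \<beta> (fst ln) * (wave_U (snd ln) x * wave_V (fst ln - snd ln) y)) {(p, q). int p - int q = snd ln}"
      by (rule has_sum_cong[THEN iffD1, rotated]) (auto simp: F_def diff_diff_eq2 algebra_simps)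
  qed
  then show ?thesis unfolding S_eq by (simp add: case_prod_unfold)
qed

lemma source_expansion_near:
  assumes "\<sigma> > 0" "cmod x + \<sigma> < cmod y"
    and \<beta>: "(\<lambda>l. norm (\<beta> l) * (fact (nat \<bar>l\<bar>) / \<sigma> ^ nat \<bar>l\<bar>)) summable_on UNIV"
  shows "((\<lambda>n. (\<Sum>\<^sub>\<infinity>l. \<beta> l * wave_V (l - n) y) * wave_U n x) has_sum (\<Sum>\<^sub>\<infinity>l. \<beta> l * wave_V l (y + x))) UNIV"
proof -
  have "((\<lambda>(n, l). \<beta> l * (wave_U n x * wave_V (l - n) y)) has_sum (\<Sum>\<^sub>\<infinity>l. \<beta> l * wave_V l (y + x))) (UNIV \<times> UNIV)
    \<longleftrightarrow> ((\<lambda>(l, n). \<beta> l * (wave_U n x * wave_V (l - n) y)) has_sum (\<Sum>\<^sub>\<infinity>l. \<beta> l * wave_V l (y + x))) UNIV"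
    by (rule has_sum_reindex_bij_witness[of _ "\<lambda>(l, n). (n, l)" "\<lambda>(n, l). (l, n)"]) auto
  with source_double_series[OF assms]
  have D: "((\<lambda>(n, l). \<beta> l * (wave_U n x * wave_V (l - n) y)) has_sum (\<Sum>\<^sub>\<infinity>l. \<beta> l * wave_V l (y + x))) (UNIV \<times> UNIV)"
    by blast
  have "(\<lambda>l. \<beta> l * (wave_U n x * wave_V (l - n) y)) summable_on UNIV" for n
    using summable_on_SigmaD1[OF has_sum_imp_summable[OF D]] by simp
  then have "((\<lambda>l. \<beta> l * (wave_U n x * wave_V (l - n) y)) has_sum (\<Sum>\<^sub>\<infinity>l. \<beta> l * (wave_U n x * wave_V (l - n) y))) UNIV" for n
    by (rule has_sum_infsum)
  moreover have "(\<Sum>\<^sub>\<infinity>l. \<beta> l * (wave_U n x * wave_V (l - n) y)) = (\<Sum>\<^sub>\<infinity>l. \<beta> l * wave_V (l - n) y) * wave_U n x" for n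
    by (subst infsum_cmult_left'[symmetric]) (simp add: mult_ac)
  ultimately show ?thesis
    using has_sum_SigmaD[OF D] by simp
qed

text \<open>The same double series, now with the order of the outgoing wave held fixed. In this use
  \<open>y\<close> is the observation point and \<open>- x\<close> the source position, whereas near
  a centre \<open>y\<close> points from the source to that centre.\<close>

lemma source_expansion_far:
  assumes "\<sigma> > 0" "cmod x + \<sigma> < cmod y"
    and \<beta>: "(\<lambda>l. norm (\<beta> l) * (fact (nat \<bar>l\<bar>) / \<sigma> ^ nat \<bar>l\<bar>)) summable_on UNIV"
  shows "((\<lambda>n. (\<Sum>\<^sub>\<infinity>l. \<beta> l * wave_U (l - n) x) * wave_V n y) has_sum (\<Sum>\<^sub>\<infinity>l. \<beta> l * wave_V l (y + x))) UNIV"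
proof -
  have "((\<lambda>(n, l). \<beta> l * (wave_U (l - n) x * wave_V n y)) has_sum (\<Sum>\<^sub>\<infinity>l. \<beta> l * wave_V l (y + x))) (UNIV \<times> UNIV)
    \<longleftrightarrow> ((\<lambda>(l, n). \<beta> l * (wave_U n x * wave_V (l - n) y)) has_sum (\<Sum>\<^sub>\<infinity>l. \<beta> l * wave_V l (y + x))) UNIV"
    by (rule has_sum_reindex_bij_witness[of _ "\<lambda>(l, n). (l - n, l)" "\<lambda>(n, l). (l, l - n)"]) auto
  with source_double_series[OF assms]
  have D: "((\<lambda>(n, l). \<beta> l * (wave_U (l - n) x * wave_V n y)) has_sum (\<Sum>\<^sub>\<infinity>l. \<beta> l * wave_V l (y + x))) (UNIV \<times> UNIV)"
    by blast
  have "(\<lambda>l. \<beta> l * (wave_U (l - n) x * wave_V n y)) summable_on UNIV" for n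
    using summable_on_SigmaD1[OF has_sum_imp_summable[OF D]] by simp
  then have "((\<lambda>l. \<beta> l * (wave_U (l - n) x * wave_V n y)) has_sum (\<Sum>\<^sub>\<infinity>l. \<beta> l * (wave_U (l - n) x * wave_V n y))) UNIV" for n
    by (rule has_sum_infsum)
  moreover have "(\<Sum>\<^sub>\<infinity>l. \<beta> l * (wave_U (l - n) x * wave_V n y)) = (\<Sum>\<^sub>\<infinity>l. \<beta> l * wave_U (l - n) x) * wave_V n y" for n
    by (subst infsum_cmult_left'[symmetric]) (simp add: mult_ac)
  ultimately show ?thesis
    using has_sum_SigmaD[OF D] by simp
qed

section \<open>From pointwise convergence to weighted coefficients\<close>

lemma summable_on_int_comparison:
  fixes f g :: "int \<Rightarrow> real"
  assumes f: "f summable_on UNIV" and g: "\<And>l. g l \<ge> 0"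
    and le: "\<forall>\<^sub>F n in sequentially. \<forall>l. nat \<bar>l\<bar> = n \<longrightarrow> g l \<le> f l"
  shows "g summable_on UNIV"
proof -
  obtain N where N: "\<And>l. nat \<bar>l\<bar> \<ge> N \<Longrightarrow> g l \<le> f l"
    using le by (auto simp: eventually_sequentially)
  have fin: "finite {l :: int. nat \<bar>l\<bar> < N}"
    by (rule finite_subset[of _ "{- int N..int N}"]) auto
  have "g summable_on {l. nat \<bar>l\<bar> \<ge> N}"
    by (rule summable_on_comparison_test[OF summable_on_subset_banach[OF f]]) (use N g in auto)
  then have "g summable_on ({l. nat \<bar>l\<bar> \<ge> N} \<union> {l. nat \<bar>l\<bar> < N})"
    by (rule summable_on_Un_disjoint) (use fin in auto)
  also have "{l. nat \<bar>l\<bar> \<ge> N} \<union> {l. nat \<bar>l\<bar> < N} = UNIV" by auto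
  finally show ?thesis .
qed

text \<open>Unconditional convergence of complex series is absolute, so the lower bound for large
  orders transfers; finitely many small orders do not affect summability.\<close>

lemma summable_on_wave_U_coeff:
  assumes "(\<lambda>l. \<beta> l * wave_U l z) summable_on UNIV"
  shows "(\<lambda>l. norm (\<beta> l) * (cmod z ^ nat \<bar>l\<bar> / fact (nat \<bar>l\<bar>))) summable_on UNIV"
proof (rule summable_on_int_comparison)
  show "(\<lambda>l. 2 * norm (\<beta> l * wave_U l z)) summable_on UNIV"
    using assms by (intro summable_on_cmult_right) (simp add: summable_on_iff_abs_summable_on_complex)
  show "\<forall>\<^sub>F n in sequentially. \<forall>l. nat \<bar>l\<bar> = n \<longrightarrow>
      norm (\<beta> l) * (cmod z ^ nat \<bar>l\<bar> / fact (nat \<bar>l\<bar>)) \<le> 2 * norm (\<beta> l * wave_U l z)"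
    using wave_U_lower[of z]
  proof eventually_elim
    case (elim n)
    have "norm (\<beta> l) * (cmod z ^ nat \<bar>l\<bar> / fact (nat \<bar>l\<bar>)) \<le> norm (\<beta> l) * (2 * norm (wave_U l z))" if "nat \<bar>l\<bar> = n" for l
      using elim that by (intro mult_left_mono) auto
    then show ?case by (simp add: norm_mult mult_ac)
  qed
qed auto

text \<open>The radius grows from \<open>cmod z\<close> to \<sigma> because the lower bound for the
  Hankel waves loses a factor of the size of the order.\<close>

lemma summable_on_wave_V_coeff:
  assumes "(\<lambda>l. \<beta> l * wave_V l z) summable_on UNIV" "z \<noteq> 0" "cmod z < \<sigma>"
  shows "(\<lambda>l. norm (\<beta> l) * (fact (nat \<bar>l\<bar>) / \<sigma> ^ nat \<bar>l\<bar>)) summable_on UNIV"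
proof (rule summable_on_int_comparison)
  show "(\<lambda>l. norm (\<beta> l * wave_V l z)) summable_on UNIV"
    using assms by (simp add: summable_on_iff_abs_summable_on_complex)
  show "\<forall>\<^sub>F n in sequentially. \<forall>l. nat \<bar>l\<bar> = n \<longrightarrow>
      norm (\<beta> l) * (fact (nat \<bar>l\<bar>) / \<sigma> ^ nat \<bar>l\<bar>) \<le> norm (\<beta> l * wave_V l z)"
    using wave_V_lower[OF assms(2,3)]
  proof eventually_elim
    case (elim n)
    have "norm (\<beta> l) * (fact (nat \<bar>l\<bar>) / \<sigma> ^ nat \<bar>l\<bar>) \<le> norm (\<beta> l) * norm (wave_V l z)" if "nat \<bar>l\<bar> = n" for l
      using elim that by (intro mult_left_mono) auto
    then show ?case by (simp add: norm_mult)
  qed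
  have "\<sigma> \<ge> 0" using assms(3) norm_ge_zero[of z] by linarith
  then show "norm (\<beta> l) * (fact (nat \<bar>l\<bar>) / \<sigma> ^ nat \<bar>l\<bar>) \<ge> 0" for l by simp
qed

section \<open>Uniqueness of wave expansions\<close>

text \<open>A discrete form of the orthogonality of the functions \<open>u powi h\<close> on the
  circle, exact as long as \<open>N\<close> exceeds the frequency.\<close>

lemma root_of_unity_average:
  fixes h :: int
  assumes "\<bar>h\<bar> < int N"
  shows "(\<Sum>j<N. (cis (2 * pi / N) ^ j) powi h) / of_nat N = (if h = 0 then 1 else 0)"
proof (cases "h = 0")
  case True
  then show ?thesis using assms by simp
next
  case False
  have N: "N > 0" using assms by linarith
  define w where "w = cis (2 * pi / N) powi h"
  have w: "w = cis (of_int h * (2 * pi / N))" unfolding w_def by (rule cis_power_int)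
  have wN: "w ^ N = 1"
  proof -
    have "w ^ N = cis (real N * (of_int h * (2 * pi / N)))" unfolding w by (rule Complex.DeMoivre)
    also have "real N * (of_int h * (2 * pi / N)) = 2 * pi * of_int h" using N by simp
    also have "cis \<dots> = 1" by (simp add: cis_multiple_2pi)
    finally show ?thesis .
  qed
  have w1: "w \<noteq> 1"
  proof
    assume "w = 1"
    then have "cos (of_int h * (2 * pi / N)) = 1" unfolding w by (simp add: complex_eq_iff)
    then obtain m :: int where "of_int h * (2 * pi / N) = of_int m * 2 * pi"
      by (auto simp: cos_one_2pi_int)
    then have "real_of_int h = real_of_int (m * int N)" using N by (simp add: field_simps)
    then have "h = m * int N" by linarith
    then show False using assms False by (auto simp: abs_mult)
  qed
  have "(\<Sum>j<N. (cis (2 * pi / N) ^ j) powi h) = (\<Sum>j<N. w ^ j)"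
    unfolding w Complex.DeMoivre cis_power_int by (intro sum.cong refl arg_cong[of _ _ cis]) (simp add: mult_ac)
  also have "\<dots> = 0" using w1 wN by (subst geometric_sum) auto
  finally show ?thesis using False by simp
qed

lemma has_sum_finite_family:
  fixes f :: "'i \<Rightarrow> 'a \<Rightarrow> 'b :: topological_comm_monoid_add"
  assumes "\<And>i. i \<in> I \<Longrightarrow> (f i has_sum s i) A"
  shows "((\<lambda>x. \<Sum>i\<in>I. f i x) has_sum (\<Sum>i\<in>I. s i)) A"
  using assms by (induction I rule: infinite_finite_induct) (auto intro!: has_sum_add)

text \<open>Averaging \<open>u powi (- m)\<close> times the series over the \<open>N\<close>-th
  roots of unity isolates \<open>d m\<close> up to other frequencies congruent to \<open>m\<close>
  modulo \<open>N\<close>. With \<open>N\<close> large these all lie in a tail of mass at most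
  \<epsilon>.\<close>

lemma laurent_coeff_le:
  fixes d :: "int \<Rightarrow> complex"
  assumes d: "d summable_on UNIV"
    and B: "\<And>u. cmod u = 1 \<Longrightarrow> norm (\<Sum>\<^sub>\<infinity>n. d n * u powi n) \<le> B"
  shows "norm (d m) \<le> B"
proof (rule field_le_epsilon)
  fix \<epsilon> :: real assume \<epsilon>: "\<epsilon> > 0"
  have nd: "(\<lambda>n. norm (d n)) summable_on UNIV"
    using d by (simp add: summable_on_iff_abs_summable_on_complex)
  obtain F0 where F0: "finite F0" "dist (sum (\<lambda>n. norm (d n)) F0) (\<Sum>\<^sub>\<infinity>n. norm (d n)) \<le> \<epsilon>"
    using infsum_finite_approximation[OF nd \<epsilon>] by blast
  define F where "F = insert m F0"
  have F: "finite F" "m \<in> F" using F0 by (auto simp: F_def)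
  have tail: "(\<Sum>\<^sub>\<infinity>n\<in>- F. norm (d n)) \<le> \<epsilon>"
  proof -
    have "(\<Sum>\<^sub>\<infinity>n. norm (d n)) = (\<Sum>\<^sub>\<infinity>n\<in>F. norm (d n)) + (\<Sum>\<^sub>\<infinity>n\<in>- F. norm (d n))"
      using infsum_Un_disjoint[of "\<lambda>n. norm (d n)" F "- F"] nd summable_on_subset_banach[OF nd] F by (simp add: Compl_partition)
    moreover have "sum (\<lambda>n. norm (d n)) F0 \<le> sum (\<lambda>n. norm (d n)) F"
      using F by (intro sum_mono2) (auto simp: F_def)
    ultimately show ?thesis using F0 F by (simp add: dist_real_def)
  qed
  \<comment> \<open>Each distance is bounded by the sum of all, so this \<open>N\<close> exceeds
    every frequency difference occurring in \<open>F\<close>.\<close>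
  define N where "N = Suc (nat (\<Sum>n\<in>F. \<bar>n - m\<bar>))"
  have N: "\<bar>n - m\<bar> < int N" if "n \<in> F" for n
  proof -
    have "\<bar>n - m\<bar> \<le> (\<Sum>n\<in>F. \<bar>n - m\<bar>)" using that F by (intro member_le_sum) auto
    then show ?thesis by (simp add: N_def)
  qed
  have N0: "N > 0" by (simp add: N_def)
  define u where "u = (\<lambda>j. cis (2 * pi / N) ^ j)"
  have u: "cmod (u j) = 1" "u j \<noteq> 0" for j by (auto simp: u_def norm_power)
  have up: "cmod (u j powi n) = 1" for j n by (simp add: norm_power_int u)
  define K where "K = (\<lambda>n. (\<Sum>j<N. u j powi (n - m)) / of_nat N)"
  have K1: "norm (K n) \<le> 1" for n
  proof -
    have "norm (\<Sum>j<N. u j powi (n - m)) \<le> (\<Sum>j<N. norm (u j powi (n - m)))" by (rule norm_sum)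
    then show ?thesis using N0 by (simp add: K_def norm_divide up)
  qed
  have K0: "K n = (if n = m then 1 else 0)" if "n \<in> F" for n
    using root_of_unity_average[OF N[OF that]] unfolding K_def u_def by simp
  have su: "(\<lambda>n. d n * u j powi n) summable_on UNIV" for j
    using nd by (subst summable_on_iff_abs_summable_on_complex) (simp add: norm_mult up)
  have hs: "((\<lambda>n. \<Sum>j<N. u j powi (- m) * (d n * u j powi n)) has_sum (\<Sum>j<N. u j powi (- m) * (\<Sum>\<^sub>\<infinity>n. d n * u j powi n))) UNIV"
    by (intro has_sum_finite_family has_sum_cmult_right has_sum_infsum su)
  have "(\<lambda>n. \<Sum>j<N. u j powi (- m) * (d n * u j powi n)) = (\<lambda>n. of_nat N * (d n * K n))"
    unfolding K_def using N0 by (auto simp: sum_distrib_left u power_int_diff power_int_minus divide_inverse mult_ac intro!: sum.cong)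
  with hs have "((\<lambda>n. 1 / of_nat N * (of_nat N * (d n * K n))) has_sum
      1 / of_nat N * (\<Sum>j<N. u j powi (- m) * (\<Sum>\<^sub>\<infinity>n. d n * u j powi n))) UNIV"
    by (intro has_sum_cmult_right) simp
  then have hs': "((\<lambda>n. d n * K n) has_sum 1 / of_nat N * (\<Sum>j<N. u j powi (- m) * (\<Sum>\<^sub>\<infinity>n. d n * u j powi n))) UNIV"
    using N0 by simp
  have "norm (\<Sum>j<N. u j powi (- m) * (\<Sum>\<^sub>\<infinity>n. d n * u j powi n)) \<le> (\<Sum>j<N. B)"
    by (rule order_trans[OF norm_sum sum_mono]) (simp add: norm_mult up B u)
  then have av: "norm (\<Sum>\<^sub>\<infinity>n. d n * K n) \<le> B"
    unfolding infsumI[OF hs'] using N0 by (simp add: norm_mult norm_divide field_simps)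
  have sK: "(\<lambda>n. d n * K n) summable_on UNIV" using hs' by (rule has_sum_imp_summable)
  have "(\<Sum>\<^sub>\<infinity>n. d n * K n) = (\<Sum>\<^sub>\<infinity>n\<in>F. d n * K n) + (\<Sum>\<^sub>\<infinity>n\<in>- F. d n * K n)"
    using infsum_Un_disjoint[of "\<lambda>n. d n * K n" F "- F"] summable_on_subset_banach[OF sK] F by (simp add: Compl_partition)
  also have "(\<Sum>\<^sub>\<infinity>n\<in>F. d n * K n) = d m"
    using F by (simp add: K0 if_distrib[of "\<lambda>c. _ * c"] sum.delta cong: sum.cong if_cong)
  finally have dm: "d m = (\<Sum>\<^sub>\<infinity>n. d n * K n) - (\<Sum>\<^sub>\<infinity>n\<in>- F. d n * K n)" by simp
  have "norm (\<Sum>\<^sub>\<infinity>n\<in>- F. d n * K n) \<le> (\<Sum>\<^sub>\<infinity>n\<in>- F. norm (d n))"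
  proof (rule norm_infsum_le)
    show "((\<lambda>n. d n * K n) has_sum (\<Sum>\<^sub>\<infinity>n\<in>- F. d n * K n)) (- F)"
      by (intro has_sum_infsum summable_on_subset_banach[OF sK]) auto
    show "((\<lambda>n. norm (d n)) has_sum (\<Sum>\<^sub>\<infinity>n\<in>- F. norm (d n))) (- F)"
      by (intro has_sum_infsum summable_on_subset_banach[OF nd]) auto
    show "norm (d n * K n) \<le> norm (d n)" for n
      unfolding norm_mult using K1[of n] by (rule mult_left_le) simp
  qed
  then show "norm (d m) \<le> B + \<epsilon>"
    unfolding dm using norm_triangle_ineq4[of "\<Sum>\<^sub>\<infinity>n. d n * K n" "\<Sum>\<^sub>\<infinity>n\<in>- F. d n * K n"] av tail by linarith
qed

text \<open>On each small circle the Fourier coefficient is \<open>c n\<close> times a Bessel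
  function. The zeros of the latter are avoided close to the origin, where the nonzero value
  \<open>1 / fact n\<close> of the Clifford factor decides.\<close>

lemma wave_U_series_unique:
  assumes "\<delta> > 0" and c: "\<And>z. cmod z < \<delta> \<Longrightarrow> ((\<lambda>n. c n * wave_U n z) has_sum 0) UNIV"
  shows "c n = 0"
proof -
  have zero: "c n * wave_U n (of_real r) = 0" if r: "0 < r" "r < \<delta>" for r
  proof -
    define d where "d = (\<lambda>n. c n * of_real (besselJ n (2 * r)))"
    have d: "((\<lambda>n. d n * u powi n) has_sum 0) UNIV" if "cmod u = 1" for u
      using c[of "of_real r * u"] r that by (simp add: wave_U_polar d_def norm_mult mult.assoc)
    have "norm (d n) \<le> 0"
    proof (rule laurent_coeff_le)
      show "d summable_on UNIV" using has_sum_imp_summable[OF d[of 1]] by simp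
    qed (use d in \<open>simp add: infsumI\<close>)
    moreover have "wave_U n (of_real r) = of_real (besselJ n (2 * r))" using wave_U_polar[of 1 n r] by simp
    ultimately show ?thesis by (simp add: d_def)
  qed
  have "isCont (clifford (nat \<bar>n\<bar>)) 0" using DERIV_clifford by (rule DERIV_isCont)
  then have "(\<lambda>r. clifford (nat \<bar>n\<bar>) (of_real r ^ 2)) \<midarrow>0\<rightarrow> clifford (nat \<bar>n\<bar>) 0"
    by (rule isCont_tendsto_compose) (auto intro!: tendsto_eq_intros)
  then have "\<forall>\<^sub>F r in at 0. clifford (nat \<bar>n\<bar>) (of_real r ^ 2) \<noteq> 0"
    by (rule tendsto_imp_eventually_ne) simp
  then have "\<forall>\<^sub>F r :: real in at_right 0. clifford (nat \<bar>n\<bar>) (of_real r ^ 2) \<noteq> 0"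
    by (auto simp: eventually_at_split)
  moreover have "\<forall>\<^sub>F r in at_right 0. r \<in> {0<..<\<delta>}"
    using assms(1) by (rule eventually_at_right_real)
  ultimately have "\<forall>\<^sub>F r :: real in at_right 0. clifford (nat \<bar>n\<bar>) (of_real r ^ 2) \<noteq> 0 \<and> 0 < r \<and> r < \<delta>"
    by eventually_elim auto
  then obtain r :: real where r: "clifford (nat \<bar>n\<bar>) (of_real r ^ 2) \<noteq> 0" "0 < r" "r < \<delta>"
    using eventually_happens[of _ "at_right (0::real)"] by auto
  have "norm (wave_U n (of_real r)) \<noteq> 0" unfolding norm_wave_U using r by simp
  then show ?thesis using zero[OF r(2,3)] by auto
qed

text \<open>The bound on a circle passes to each Fourier coefficient, so a nonzero
  \<open>c n\<close> would force a Hankel function to decay too fast.\<close>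

lemma wave_V_series_unique:
  assumes c: "\<And>z. cmod z > R \<Longrightarrow> ((\<lambda>n. c n * wave_V n z) has_sum u z) UNIV"
    and u: "\<And>z. cmod z > R \<Longrightarrow> norm (u z) \<le> K / (cmod z * sqrt (cmod z))"
  shows "c n = 0"
proof (rule ccontr)
  assume cn: "c n \<noteq> 0"
  have le: "norm (c n * hankel1 n (2 * r)) \<le> K / (r * sqrt r)" if r: "r > 0" "r > R" for r
  proof -
    define d where "d = (\<lambda>n. c n * hankel1 n (2 * r))"
    have d: "((\<lambda>n. d n * v powi n) has_sum u (of_real r * v)) UNIV" if "cmod v = 1" for v
      using c[of "of_real r * v"] r that by (simp add: wave_V_polar d_def norm_mult mult.assoc)
    have "norm (d n) \<le> K / (r * sqrt r)"
    proof (rule laurent_coeff_le)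
      show "d summable_on UNIV" using has_sum_imp_summable[OF d[of 1]] by simp
      show "norm (\<Sum>\<^sub>\<infinity>n. d n * v powi n) \<le> K / (r * sqrt r)" if "cmod v = 1" for v
        unfolding infsumI[OF d[OF that]] using u[of "of_real r * v"] r that by (simp add: norm_mult)
    qed
    then show ?thesis by (simp add: d_def)
  qed
  have sym: "norm (hankel1 (int (nat \<bar>n\<bar>)) x) = norm (hankel1 n x)" for x
    using hankel1_minus[of n x] by (cases "n \<ge> 0") (auto simp: norm_mult norm_power)
  have "norm (hankel1 (int (nat \<bar>n\<bar>)) (2 * r)) \<le> (K / norm (c n)) / (r * sqrt r)" if "r \<ge> max 1 (R + 1)" for r
  proof -
    have "norm (c n) * norm (hankel1 n (2 * r)) \<le> K / (r * sqrt r)"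
      using le[of r] that by (simp add: norm_mult)
    then have "norm (hankel1 n (2 * r)) \<le> K / (r * sqrt r) / norm (c n)"
      using cn by (subst pos_le_divide_eq) (auto simp: mult.commute)
    then show ?thesis unfolding sym by (simp add: mult_ac)
  qed
  then show False by (rule hankel1_nat_no_fast_decay)
qed

section \<open>Unique continuation of sums of wave series\<close>

lemma holomorphic_on_clifford: "f holomorphic_on S \<Longrightarrow> (\<lambda>t. clifford n (f t)) holomorphic_on S"
proof -
  assume f: "f holomorphic_on S"
  have "clifford n holomorphic_on UNIV"
    using DERIV_clifford by (auto simp: holomorphic_on_open)
  from holomorphic_on_compose_gen[OF f this] show ?thesis by (simp add: o_def)
qed

text \<open>\<open>cnj (y + t * x)\<close> is in general not holomorphic in \<open>t\<close>, but
  \<open>cnj y + t * cnj x\<close> is, and the two agree for real \<open>t\<close>. For this reason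
  \<open>norm_bessel_wave_le\<close> is stated for independent \<open>z\<close> and
  \<open>w\<close>.\<close>

lemma bessel_wave_series_holomorphic:
  assumes A: "(\<lambda>n. norm (A n) * (\<rho> ^ nat \<bar>n\<bar> / fact (nat \<bar>n\<bar>))) summable_on UNIV"
    and \<rho>: "cmod y + T * cmod x \<le> \<rho>"
  shows "(\<lambda>t. \<Sum>\<^sub>\<infinity>n. A n * bessel_wave n (y + t * x) (cnj y + t * cnj x)) holomorphic_on ball 0 T"
proof -
  have hol: "(\<lambda>t. A n * bessel_wave n (y + t * x) (cnj y + t * cnj x)) holomorphic_on UNIV" for n
    unfolding bessel_wave_def
    by (cases "n \<ge> 0") (auto intro!: holomorphic_intros holomorphic_on_clifford)
  have ul: "uniform_limit (cball 0 T) (\<lambda>X t. \<Sum>n\<in>X. A n * bessel_wave n (y + t * x) (cnj y + t * cnj x))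
     (\<lambda>t. \<Sum>\<^sub>\<infinity>n. A n * bessel_wave n (y + t * x) (cnj y + t * cnj x)) (finite_subsets_at_top UNIV)"
  proof (rule Weierstrass_m_test_general)
    show "(\<lambda>n. exp (\<rho>\<^sup>2) * (norm (A n) * (\<rho> ^ nat \<bar>n\<bar> / fact (nat \<bar>n\<bar>)))) summable_on UNIV"
      by (intro summable_on_cmult_right A)
    fix n :: int and t :: complex assume "t \<in> cball 0 T"
    then have "cmod (t * x) \<le> T * cmod x" by (simp add: norm_mult mult_right_mono)
    then have "cmod (y + t * x) \<le> \<rho>" "cmod (cnj y + t * cnj x) \<le> \<rho>"
      using \<rho> norm_triangle_ineq[of y "t * x"] norm_triangle_ineq[of "cnj y" "t * cnj x"] by (auto simp: norm_mult)
    from mult_left_mono[OF norm_bessel_wave_le[OF this, of n], of "norm (A n)"]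
    show "norm (A n * bessel_wave n (y + t * x) (cnj y + t * cnj x)) \<le> exp (\<rho>\<^sup>2) * (norm (A n) * (\<rho> ^ nat \<bar>n\<bar> / fact (nat \<bar>n\<bar>)))"
      by (simp add: norm_mult mult_ac)
  qed
  show ?thesis
  proof (rule holomorphic_uniform_limit[OF _ ul])
    show "\<forall>\<^sub>F X in finite_subsets_at_top UNIV. continuous_on (cball 0 T) (\<lambda>t. \<Sum>n\<in>X. A n * bessel_wave n (y + t * x) (cnj y + t * cnj x))
      \<and> (\<lambda>t. \<Sum>n\<in>X. A n * bessel_wave n (y + t * x) (cnj y + t * cnj x)) holomorphic_on ball 0 T"
    proof (intro always_eventually allI conjI)
      fix X :: "int set"
      have "(\<lambda>t. \<Sum>n\<in>X. A n * bessel_wave n (y + t * x) (cnj y + t * cnj x)) holomorphic_on UNIV"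
        by (intro holomorphic_on_sum hol)
      then show "continuous_on (cball 0 T) (\<lambda>t. \<Sum>n\<in>X. A n * bessel_wave n (y + t * x) (cnj y + t * cnj x))"
        "(\<lambda>t. \<Sum>n\<in>X. A n * bessel_wave n (y + t * x) (cnj y + t * cnj x)) holomorphic_on ball 0 T"
        by (auto intro: holomorphic_on_imp_continuous_on holomorphic_on_subset)
    qed
  qed auto
qed

text \<open>The identity theorem applies in the complexified parameter of the line from the centre
  through \<open>x\<close>; the target is \<open>t = 1\<close>. The radius \<open>cmod y + r\<close>
  belongs to the first series, which is expanded about the origin and not about
  \<open>y\<close>.\<close>

lemma two_series_vanish:
  assumes A: "(\<lambda>n. norm (A n) * ((cmod y + r) ^ nat \<bar>n\<bar> / fact (nat \<bar>n\<bar>))) summable_on UNIV"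
    and c: "(\<lambda>n. norm (c n) * (r ^ nat \<bar>n\<bar> / fact (nat \<bar>n\<bar>))) summable_on UNIV"
    and "\<eta> > 0" and zero: "\<And>x. cmod x < \<eta> \<Longrightarrow>
       (\<Sum>\<^sub>\<infinity>n. A n * wave_U n (y + x)) + (\<Sum>\<^sub>\<infinity>n. c n * wave_U n x) = 0"
    and x: "cmod x < r"
  shows "(\<Sum>\<^sub>\<infinity>n. A n * wave_U n (y + x)) + (\<Sum>\<^sub>\<infinity>n. c n * wave_U n x) = 0"
proof (cases "x = 0")
  case True
  then show ?thesis using zero[of x] \<open>\<eta> > 0\<close> by simp
next
  case False
  define T where "T = r / cmod x"
  have T: "T > 1" "T * cmod x = r" using x False by (auto simp: T_def)
  define F where "F = (\<lambda>t. (\<Sum>\<^sub>\<infinity>n. A n * bessel_wave n (y + t * x) (cnj y + t * cnj x))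
     + (\<Sum>\<^sub>\<infinity>n. c n * bessel_wave n (0 + t * x) (cnj 0 + t * cnj x)))"
  have hol: "F holomorphic_on ball 0 T"
    unfolding F_def by (intro holomorphic_on_add bessel_wave_series_holomorphic[OF A] bessel_wave_series_holomorphic[OF c])
      (use T in auto)
  have F: "F (of_real t) = (\<Sum>\<^sub>\<infinity>n. A n * wave_U n (y + of_real t * x)) + (\<Sum>\<^sub>\<infinity>n. c n * wave_U n (of_real t * x))" for t
    by (simp add: F_def wave_U_def)
  \<comment> \<open>Only for real \<open>t\<close> is \<open>F t\<close> a value of the two wave
    series, so the accumulating zeros are taken on the real axis.\<close>
  define U :: "complex set" where "U = of_real ` {0<..<min 1 (\<eta> / cmod x)}"
  have lim: "0 islimpt U"
    unfolding islimpt_approachable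
  proof (intro allI impI)
    fix e :: real assume e: "e > 0"
    define t where "t = min e (min 1 (\<eta> / cmod x)) / 2"
    have t: "0 < t" "t < min 1 (\<eta> / cmod x)" "t < e"
      using e \<open>\<eta> > 0\<close> False by (auto simp: t_def min_def)
    then show "\<exists>x'\<in>U. x' \<noteq> 0 \<and> dist x' 0 < e"
      by (intro bexI[of _ "of_real t"]) (auto simp: U_def)
  qed
  have "F 1 = 0"
  proof (rule analytic_continuation[OF hol])
    show "U \<subseteq> ball 0 T" using T by (auto simp: U_def)
    show "F z = 0" if "z \<in> U" for z
    proof -
      obtain t where t: "z = of_real t" and "t \<in> {0<..<min 1 (\<eta> / cmod x)}"
        using \<open>z \<in> U\<close> unfolding U_def by (rule imageE)
      then have "0 < t" "t < \<eta> / cmod x" by auto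
      then have "cmod (of_real t * x) < \<eta>" using False by (simp add: norm_mult field_simps)
      then show ?thesis unfolding t F by (rule zero)
    qed
  qed (use T lim in auto)
  with F[of 1] show ?thesis by simp
qed

section \<open>Expansions of the source field\<close>

text \<open>The weights must come from a point closer to the source than \<open>q\<close>. As
  \<open>s\<close> lies outside the ball, the segment from \<open>q\<close> towards \<open>s\<close>
  can be followed inside \<open>C\<close> beyond the distance \<open>cmod x\<close>, and there the
  series converges by assumption.\<close>

lemma source_local_expansion:
  fixes \<kappa> :: real
  assumes \<kappa>: "\<kappa> > 0" and sub: "ball q \<delta> \<subseteq> C" and s: "s \<notin> C" and x: "cmod x < \<delta>"
    and conv: "\<And>p. p \<in> C \<Longrightarrow> (\<lambda>l. \<beta> l * wave_V l (of_real \<kappa> * (p - s))) summable_on UNIV"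
  shows "((\<lambda>n. (\<Sum>\<^sub>\<infinity>l. \<beta> l * wave_V (l - n) (of_real \<kappa> * (q - s))) * wave_U n (of_real \<kappa> * x))
    has_sum (\<Sum>\<^sub>\<infinity>l. \<beta> l * wave_V l (of_real \<kappa> * (q + x - s)))) UNIV"
proof -
  define d where "d = cmod (q - s)"
  have d: "d \<ge> \<delta>" using sub s by (force simp: d_def dist_norm)
  define \<delta>' where "\<delta>' = (cmod x + \<delta>) / 2"
  have "cmod x < \<delta>'" "\<delta>' < \<delta>" using x by (simp_all add: \<delta>'_def)
  moreover from this have "\<delta>' > 0" using norm_ge_zero[of x] by linarith
  ultimately have \<delta>': "cmod x < \<delta>'" "\<delta>' < \<delta>" "\<delta>' > 0" by auto
  define p where "p = q - of_real (\<delta>' / d) * (q - s)"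
  have dpos: "d > 0" using d \<delta>' by linarith
  have "dist q p = \<delta>'" using \<delta>' dpos by (simp add: p_def dist_norm norm_mult norm_divide d_def)
  then have "p \<in> C" using sub \<delta>' by auto
  have ps: "p - s = of_real (1 - \<delta>' / d) * (q - s)" by (simp add: p_def algebra_simps)
  have nps: "cmod (p - s) = d - \<delta>'"
  proof -
    have "\<bar>1 - \<delta>' / d\<bar> = 1 - \<delta>' / d" using \<delta>' d dpos by (simp add: divide_simps)
    then have "cmod (p - s) = (1 - \<delta>' / d) * d" unfolding ps norm_mult norm_of_real d_def by simp
    then show ?thesis using dpos by (simp add: left_diff_distrib)
  qed
  \<comment> \<open>Midway between the modulus \<open>\<kappa> * (d - \<delta>')\<close> at
    \<open>p\<close> and the bound \<open>\<kappa> * (d - cmod x)\<close> below which the expansion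
    holds.\<close>
  define \<sigma> where "\<sigma> = \<kappa> * (d - (cmod x + \<delta>') / 2)"
  have "(\<lambda>l. norm (\<beta> l) * (fact (nat \<bar>l\<bar>) / \<sigma> ^ nat \<bar>l\<bar>)) summable_on UNIV"
  proof (rule summable_on_wave_V_coeff[OF conv[OF \<open>p \<in> C\<close>]])
    show "of_real \<kappa> * (p - s) \<noteq> 0" using \<kappa> nps \<delta>' d by auto
    show "cmod (of_real \<kappa> * (p - s)) < \<sigma>"
      unfolding norm_mult nps \<sigma>_def using \<kappa> \<delta>' by simp
  qed
  moreover have "\<sigma> > 0" unfolding \<sigma>_def using \<kappa> \<delta>' d by simp
  moreover have "cmod (of_real \<kappa> * x) + \<sigma> < cmod (of_real \<kappa> * (q - s))"
  proof -
    have "\<kappa> * (cmod x + (d - (cmod x + \<delta>') / 2)) < \<kappa> * d"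
      using \<kappa> \<delta>' by (intro mult_strict_left_mono) (auto simp: field_simps)
    then show ?thesis using \<kappa> by (simp add: norm_mult \<sigma>_def d_def distrib_left)
  qed
  ultimately have "((\<lambda>n. (\<Sum>\<^sub>\<infinity>l. \<beta> l * wave_V (l - n) (of_real \<kappa> * (q - s))) * wave_U n (of_real \<kappa> * x))
    has_sum (\<Sum>\<^sub>\<infinity>l. \<beta> l * wave_V l (of_real \<kappa> * (q - s) + of_real \<kappa> * x))) UNIV"
    by (intro source_expansion_near)
  moreover have "of_real \<kappa> * (q - s) + of_real \<kappa> * x = of_real \<kappa> * (q + x - s)" by (simp add: algebra_simps)
  ultimately show ?thesis by simp
qed

lemma source_far_expansion:
  fixes \<kappa> :: real
  assumes \<kappa>: "\<kappa> > 0" and a: "a > 0" and x: "cmod s + a < cmod x"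
    and conv: "\<And>p. dist p s > a \<Longrightarrow> (\<lambda>l. \<beta> l * wave_V l (of_real \<kappa> * (p - s))) summable_on UNIV"
  shows "((\<lambda>n. (\<Sum>\<^sub>\<infinity>l. \<beta> l * wave_U (l - n) (- (of_real \<kappa> * s))) * wave_V n (of_real \<kappa> * x))
    has_sum (\<Sum>\<^sub>\<infinity>l. \<beta> l * wave_V l (of_real \<kappa> * (x - s)))) UNIV"
proof -
  \<comment> \<open>One third of the gap separates \<open>p\<close> from the circle of radius
    \<open>a\<close>, another one separates \<sigma> from the modulus at \<open>p\<close>, and the
    last keeps the inequality with \<open>x\<close> strict.\<close>
  define \<epsilon> where "\<epsilon> = (cmod x - cmod s - a) / 3"
  have \<epsilon>: "\<epsilon> > 0" "cmod s + (a + 2 * \<epsilon>) < cmod x" using x by (auto simp: \<epsilon>_def field_simps)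
  define p where "p = s + of_real (a + \<epsilon>)"
  have nps: "cmod (p - s) = a + \<epsilon>" unfolding p_def using a \<epsilon> by (simp del: of_real_add)
  then have ps: "dist p s > a" using \<epsilon> by (simp add: dist_norm)
  define \<sigma> where "\<sigma> = \<kappa> * (a + 2 * \<epsilon>)"
  have "(\<lambda>l. norm (\<beta> l) * (fact (nat \<bar>l\<bar>) / \<sigma> ^ nat \<bar>l\<bar>)) summable_on UNIV"
  proof (rule summable_on_wave_V_coeff[OF conv[OF ps]])
    show "of_real \<kappa> * (p - s) \<noteq> 0" using \<kappa> nps a \<epsilon> by auto
    show "cmod (of_real \<kappa> * (p - s)) < \<sigma>"
      unfolding norm_mult nps \<sigma>_def using \<kappa> \<epsilon> by simp
  qed
  moreover have "\<sigma> > 0" unfolding \<sigma>_def using \<kappa> a \<epsilon> by simp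
  moreover have "cmod (- (of_real \<kappa> * s)) + \<sigma> < cmod (of_real \<kappa> * x)"
    using mult_strict_left_mono[OF \<epsilon>(2) \<kappa>] \<kappa> by (simp add: norm_mult \<sigma>_def distrib_left)
  ultimately have "((\<lambda>n. (\<Sum>\<^sub>\<infinity>l. \<beta> l * wave_U (l - n) (- (of_real \<kappa> * s))) * wave_V n (of_real \<kappa> * x))
    has_sum (\<Sum>\<^sub>\<infinity>l. \<beta> l * wave_V l (of_real \<kappa> * x + - (of_real \<kappa> * s)))) UNIV"
    by (intro source_expansion_far)
  then show ?thesis by (simp add: algebra_simps)
qed

text \<open>The set of points with a neighbourhood on which \<open>u\<close> vanishes is open, and closed in \<open>C\<close>.\<close>
lemma vanishing_propagates:
  fixes u :: "complex \<Rightarrow> complex"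
  assumes C: "open C" "connected C"
    and step: "\<And>q \<delta> \<eta>. \<lbrakk>ball q \<delta> \<subseteq> C; \<eta> > 0; \<And>x. cmod x < \<eta> \<Longrightarrow> u (q + x) = 0\<rbrakk>
      \<Longrightarrow> \<forall>x. cmod x < \<delta> \<longrightarrow> u (q + x) = 0"
    and start: "q0 \<in> C" "\<eta>0 > 0" "\<And>x. cmod x < \<eta>0 \<Longrightarrow> u (q0 + x) = 0"
    and x: "x \<in> C"
  shows "u x = 0"
proof -
  define Z where "Z = {q \<in> C. \<exists>\<eta>>0. ball q \<eta> \<subseteq> C \<and> (\<forall>y\<in>ball q \<eta>. u y = 0)}"
  have "open Z"
    unfolding open_contains_ball
  proof
    fix q assume "q \<in> Z"
    then obtain \<eta> where \<eta>: "\<eta> > 0" "ball q \<eta> \<subseteq> C" "\<And>y. y \<in> ball q \<eta> \<Longrightarrow> u y = 0" by (auto simp: Z_def)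
    have "ball q \<eta> \<subseteq> Z"
    proof
      fix y assume y: "y \<in> ball q \<eta>"
      obtain \<eta>' where "\<eta>' > 0" "ball y \<eta>' \<subseteq> ball q \<eta>"
        by (rule openE[OF open_ball y])
      then show "y \<in> Z" using \<eta> y unfolding Z_def by blast
    qed
    with \<eta> show "\<exists>e>0. ball q e \<subseteq> Z" by blast
  qed
  moreover have "open (C - Z)"
    unfolding open_contains_ball
  proof
    fix q assume q: "q \<in> C - Z"
    then obtain \<delta> where \<delta>: "\<delta> > 0" "ball q \<delta> \<subseteq> C" using C(1) open_contains_ball by blast
    \<comment> \<open>With half the radius, \<open>ball z (\<delta> / 2)\<close> both contains
      \<open>q\<close> and stays in \<open>ball q \<delta>\<close>; a point \<open>z\<close> of
      \<open>Z\<close> would then put \<open>q\<close> into \<open>Z\<close>.\<close>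
    have "ball q (\<delta> / 2) \<subseteq> C - Z"
    proof (intro subsetI DiffI notI)
      fix z assume z: "z \<in> ball q (\<delta> / 2)"
      show "z \<in> C" using z \<delta> by (intro subsetD[OF \<delta>(2)]) auto
      assume "z \<in> Z"
      then obtain \<eta> where \<eta>: "\<eta> > 0" "\<And>y. y \<in> ball z \<eta> \<Longrightarrow> u y = 0" by (auto simp: Z_def)
      have sub: "ball z (\<delta> / 2) \<subseteq> ball q \<delta>"
      proof
        fix y assume "y \<in> ball z (\<delta> / 2)"
        then show "y \<in> ball q \<delta>" using z dist_triangle[of q y z] by auto
      qed
      have "\<forall>x. cmod x < \<delta> / 2 \<longrightarrow> u (z + x) = 0"
      proof (rule step)
        show "ball z (\<delta> / 2) \<subseteq> C" using sub \<delta> by blast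
        show "u (z + x) = 0" if "cmod x < \<eta>" for x
          using that by (intro \<eta>) (simp add: dist_norm)
      qed (rule \<eta>)
      then have zero: "u y = 0" if "y \<in> ball z (\<delta> / 2)" for y
        using that by (metis add_diff_cancel_left' add.commute diff_add_cancel dist_norm mem_ball norm_minus_commute)
      have "q \<in> ball z (\<delta> / 2)" using z by (simp add: dist_commute)
      then obtain \<eta>' where "\<eta>' > 0" "ball q \<eta>' \<subseteq> ball z (\<delta> / 2)"
        by (rule openE[OF open_ball])
      then have "q \<in> Z" using q zero sub \<delta> unfolding Z_def by blast
      with q show False by simp
    qed
    with \<delta> show "\<exists>e>0. ball q e \<subseteq> C - Z" by (intro exI[of _ "\<delta> / 2"]) auto
  qed
  moreover have "q0 \<in> Z"
  proof -
    obtain \<delta> where \<delta>: "\<delta> > 0" "ball q0 \<delta> \<subseteq> C" using C(1) start(1) open_contains_ball by blast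
    have "u y = 0" if "y \<in> ball q0 (min \<delta> \<eta>0)" for y
      using start(3)[of "y - q0"] that by (simp add: dist_norm norm_minus_commute)
    moreover have "ball q0 (min \<delta> \<eta>0) \<subseteq> C" using \<delta> by auto
    ultimately show ?thesis using \<delta> start unfolding Z_def by (auto intro!: exI[of _ "min \<delta> \<eta>0"])
  qed
  ultimately have "C \<subseteq> Z"
    using connectedD[OF C(2), of Z "C - Z"] start(1) by (auto simp: Z_def)
  then have "x \<in> Z" using x by blast
  then show ?thesis by (auto simp: Z_def)
qed

section \<open>Equivalence of the field conditions with the coefficient equations\<close>

theorem theorem1:
  fixes k :: real and M :: nat and xs :: "nat \<Rightarrow> complex" and a :: "nat \<Rightarrow> real"
    and C :: "complex set" and A :: "int \<Rightarrow> complex" and b :: "nat \<Rightarrow> int \<Rightarrow> complex"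
    and ui ud :: "complex \<Rightarrow> complex"
  assumes k_pos: "k > 0"
    and M_pos: "M \<ge> 1"
    and a_pos: "\<forall>m<M. a m > 0"
    and outside: "\<forall>m<M. cmod (xs m) > a m"
    and C_open: "open C" and C_bounded: "bounded C" and C_connected: "connected C"
    and C_origin: "\<exists>e>0. ball 0 e \<subseteq> C"
    and C_no_src: "\<forall>m<M. xs m \<notin> C"
    and ui_conv: "\<forall>x\<in>C. (\<lambda>n. A n * Uplus k n x) summable_on UNIV"
    and ud_conv: "\<forall>m<M. \<forall>x. (dist x (xs m) > a m \<or> x \<in> C) \<longrightarrow>
                    (\<lambda>n. b m n * Vplus k n (x - xs m)) summable_on UNIV"
    and condU_conv: "\<forall>m<M. \<forall>n. (\<lambda>l. b m l * Uminus k (n - l) (xs m)) summable_on UNIV"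
    and condV_conv: "\<forall>m<M. \<forall>n. (\<lambda>l. b m l * Vminus k (n - l) (xs m)) summable_on UNIV"
    and ui_def: "ui = (\<lambda>x. \<Sum>\<^sub>\<infinity>n. A n * Uplus k n x)"
    and ud_def: "ud = (\<lambda>x. \<Sum>m<M. \<Sum>\<^sub>\<infinity>n. b m n * Vplus k n (x - xs m))"
  shows "((\<forall>x\<in>C. ui x + ud x = 0) \<and> far_field_amplitude k ud (\<lambda>\<theta>. 0))
         \<longleftrightarrow>
         (\<forall>n::int. (\<Sum>m<M. \<Sum>\<^sub>\<infinity>l. b m l * Uminus k (n - l) (xs m)) = 0
                 \<and> (\<Sum>m<M. \<Sum>\<^sub>\<infinity>l. b m l * Vminus k (n - l) (xs m)) = - A n)"
proof -
  \<comment> \<open>The waves are normalised to the Bessel argument \<open>2 * cmod z\<close>, hence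
    the half.\<close>
  define \<kappa> where "\<kappa> = k / 2"
  have \<kappa>: "\<kappa> > 0" and k: "k = 2 * \<kappa>" using k_pos by (auto simp: \<kappa>_def)
  have ui: "ui x = (\<Sum>\<^sub>\<infinity>n. A n * wave_U n (of_real \<kappa> * x))" for x
    unfolding ui_def Uplus_eq \<kappa>_def ..
  have ud: "ud x = (\<Sum>m<M. \<Sum>\<^sub>\<infinity>n. b m n * wave_V n (of_real \<kappa> * (x - xs m)))" if "\<forall>m<M. x \<noteq> xs m" for x
    unfolding ud_def \<kappa>_def using that k_pos by (intro sum.cong refl infsum_cong) (simp add: Vplus_eq)
  have uiC: "(\<lambda>n. A n * wave_U n (of_real \<kappa> * x)) summable_on UNIV" if "x \<in> C" for x
    using ui_conv that unfolding Uplus_eq \<kappa>_def by blast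
  have convV: "(\<lambda>n. b m n * wave_V n (of_real \<kappa> * (x - xs m))) summable_on UNIV"
    if "m < M" "x \<noteq> xs m" "dist x (xs m) > a m \<or> x \<in> C" for m x
    using ud_conv[rule_format, OF that(1,3)] that(2) k_pos by (simp add: Vplus_eq \<kappa>_def)
  have convC: "(\<lambda>n. b m n * wave_V n (of_real \<kappa> * (x - xs m))) summable_on UNIV" if "m < M" "x \<in> C" for m x
    using convV[of m x] that C_no_src by blast
  have convF: "(\<lambda>n. b m n * wave_V n (of_real \<kappa> * (x - xs m))) summable_on UNIV" if "m < M" "dist x (xs m) > a m" for m x
    using convV[of m x] that a_pos by force
  \<comment> \<open>The centre \<open>q\<close> is kept general: at 0 these are the sums of the
    second condition, elsewhere they serve the continuation along \<open>C\<close>.\<close>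
  define cV where "cV = (\<lambda>q n. \<Sum>m<M. \<Sum>\<^sub>\<infinity>l. b m l * wave_V (l - n) (of_real \<kappa> * (q - xs m)))"
  define cU where "cU = (\<lambda>n. \<Sum>m<M. \<Sum>\<^sub>\<infinity>l. b m l * wave_U (l - n) (- (of_real \<kappa> * xs m)))"
  have condV: "(\<Sum>m<M. \<Sum>\<^sub>\<infinity>l. b m l * Vminus k (n - l) (xs m)) = cV 0 n" for n
  proof -
    have "Vminus k (n - l) (xs m) = wave_V (l - n) (of_real \<kappa> * (0 - xs m))" if "m < M" for m l
    proof -
      have "xs m \<noteq> 0" using that outside a_pos by force
      then show ?thesis using Vminus_eq[OF k_pos, of "xs m" "n - l"] by (simp add: \<kappa>_def)
    qed
    then show ?thesis unfolding cV_def by simp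
  qed
  have condU: "(\<Sum>m<M. \<Sum>\<^sub>\<infinity>l. b m l * Uminus k (n - l) (xs m)) = cU n" for n
    unfolding cU_def Uminus_eq \<kappa>_def by simp
  have near: "((\<lambda>n. cV q n * wave_U n (of_real \<kappa> * x)) has_sum ud (q + x)) UNIV"
    if sub: "ball q \<delta> \<subseteq> C" and x: "cmod x < \<delta>" for q \<delta> x
  proof -
    have "q + x \<in> C" using sub x by (auto simp: dist_norm)
    then have ne: "\<forall>m<M. q + x \<noteq> xs m" using C_no_src by auto
    show ?thesis
      unfolding cV_def ud[OF ne] sum_distrib_right
      by (intro has_sum_finite_family source_local_expansion[OF \<kappa> sub _ x] convC) (use C_no_src in auto)
  qed
  \<comment> \<open>A sum of nonnegative terms dominates each of them, so all source expansions
    converge beyond this one radius.\<close>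
  define R where "R = (\<Sum>m<M. cmod (xs m) + a m)"
  have R: "cmod (xs m) + a m \<le> R" if "m < M" for m
    unfolding R_def using that a_pos by (intro member_le_sum) (auto simp: add_nonneg_nonneg less_imp_le)
  have far: "((\<lambda>n. cU n * wave_V n (of_real \<kappa> * x)) has_sum ud x) UNIV" if x: "cmod x > R" for x
  proof -
    have x': "cmod (xs m) + a m < cmod x" if "m < M" for m using R[OF that] x by linarith
    then have ne: "\<forall>m<M. x \<noteq> xs m" using a_pos by fastforce
    show ?thesis
      unfolding cU_def ud[OF ne] sum_distrib_right
      by (intro has_sum_finite_family source_far_expansion[OF \<kappa> _ x'] convF) (use a_pos in auto)
  qed
  obtain e where e: "e > 0" "ball 0 e \<subseteq> C" using C_origin by blast
  \<comment> \<open>On a ball about 0 both fields are series in the same \<open>wave_U n\<close>, so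
    the total field has the coefficients \<open>A n + cV 0 n\<close>.\<close>
  have vanish_near: "(\<forall>x. cmod x < e \<longrightarrow> ui x + ud x = 0) \<longleftrightarrow> (\<forall>n. cV 0 n = - A n)"
  proof -
    have hs: "((\<lambda>n. (A n + cV 0 n) * wave_U n (of_real \<kappa> * x)) has_sum (ui x + ud x)) UNIV" if "cmod x < e" for x
    proof -
      have "x \<in> C" using e that by auto
      from has_sum_add[OF has_sum_infsum[OF uiC[OF this]] near[OF e(2) that]]
      show ?thesis by (simp add: ui distrib_right)
    qed
    show ?thesis
    proof
      assume zero: "\<forall>x. cmod x < e \<longrightarrow> ui x + ud x = 0"
      have "A n + cV 0 n = 0" for n
      proof (rule wave_U_series_unique[of "\<kappa> * e" "\<lambda>n. A n + cV 0 n"])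
        fix z assume z: "cmod z < \<kappa> * e"
        define x where "x = z / of_real \<kappa>"
        have "cmod x < e" using z \<kappa> by (simp add: x_def norm_divide field_simps)
        moreover have "of_real \<kappa> * x = z" using \<kappa> by (simp add: x_def)
        ultimately show "((\<lambda>n. (A n + cV 0 n) * wave_U n z) has_sum 0) UNIV"
          using hs[of x] zero by simp
      qed (use \<kappa> e in simp)
      then show "\<forall>n. cV 0 n = - A n" by (simp add: eq_neg_iff_add_eq_0 add.commute)
    next
      assume "\<forall>n. cV 0 n = - A n"
      then have "((\<lambda>n. 0) has_sum (ui x + ud x)) (UNIV :: int set)" if "cmod x < e" for x
        using hs[OF that] by simp
      then show "\<forall>x. cmod x < e \<longrightarrow> ui x + ud x = 0"
        using has_sum_unique has_sum_0_simp by blast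
    qed
  qed
  have step: "\<forall>x. cmod x < \<delta> \<longrightarrow> ui (q + x) + ud (q + x) = 0"
    if sub: "ball q \<delta> \<subseteq> C" and "\<eta> > 0" and zero: "\<And>x. cmod x < \<eta> \<Longrightarrow> ui (q + x) + ud (q + x) = 0" for q \<delta> \<eta>
  proof (intro allI impI)
    fix x assume x: "cmod x < \<delta>"
    define r where "r = (cmod x + \<delta>) / 2"
    have "cmod x < r" "r < \<delta>" using x by (simp_all add: r_def)
    moreover from this have "r > 0" using norm_ge_zero[of x] by linarith
    ultimately have r: "cmod x < r" "r < \<delta>" "r > 0" by auto
    \<comment> \<open>\<open>ui\<close> is expanded about 0, not about \<open>q\<close>. A step of
      length \<open>r\<close> from \<open>q\<close> radially outwards stays in \<open>C\<close> and
      reaches the modulus \<open>cmod q + r\<close>, so convergence there supplies the weight for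
      the whole ball. Since \<open>sgn 0 = 0\<close>, the centre 0 needs its own direction.\<close>
    define v where "v = (if q = 0 then 1 else sgn q)"
    have v: "cmod v = 1" by (simp add: v_def norm_sgn)
    have qv: "cmod (q + of_real r * v) = cmod q + r"
    proof (cases "q = 0")
      case False
      then have "q + of_real r * v = of_real (cmod q + r) * sgn q"
        by (simp add: v_def sgn_eq field_simps)
      then have "cmod (q + of_real r * v) = \<bar>cmod q + r\<bar> * cmod (sgn q)"
        by (simp only: norm_mult norm_of_real)
      with False r show ?thesis by (simp add: norm_sgn)
    qed (use r in \<open>simp add: v_def\<close>)
    have "q + of_real r * v \<in> C" using sub r v by (intro subsetD[OF sub]) (simp add: dist_norm norm_mult)
    have eq: "cmod (of_real \<kappa> * (q + of_real r * v)) = cmod (of_real \<kappa> * q) + \<kappa> * r"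
      unfolding norm_mult[of "of_real \<kappa>"] qv using \<kappa> by (simp add: distrib_left)
    have A: "(\<lambda>n. norm (A n) * ((cmod (of_real \<kappa> * q) + \<kappa> * r) ^ nat \<bar>n\<bar> / fact (nat \<bar>n\<bar>))) summable_on UNIV"
      using summable_on_wave_U_coeff[OF uiC[OF \<open>q + of_real r * v \<in> C\<close>]] unfolding eq .
    have "(\<lambda>n. cV q n * wave_U n (of_real \<kappa> * of_real r)) summable_on UNIV"
      using near[OF sub, of "of_real r"] r by (intro has_sum_imp_summable) auto
    from summable_on_wave_U_coeff[OF this]
    have c: "(\<lambda>n. norm (cV q n) * ((\<kappa> * r) ^ nat \<bar>n\<bar> / fact (nat \<bar>n\<bar>))) summable_on UNIV"
      using \<kappa> r by (simp add: norm_mult)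
    have u: "(\<Sum>\<^sub>\<infinity>n. A n * wave_U n (of_real \<kappa> * q + of_real \<kappa> * x)) + (\<Sum>\<^sub>\<infinity>n. cV q n * wave_U n (of_real \<kappa> * x))
        = ui (q + x) + ud (q + x)" if "cmod x < \<delta>" for x
      using infsumI[OF near[OF sub that]] by (simp add: ui distrib_left)
    have "(\<Sum>\<^sub>\<infinity>n. A n * wave_U n (of_real \<kappa> * q + of_real \<kappa> * x)) + (\<Sum>\<^sub>\<infinity>n. cV q n * wave_U n (of_real \<kappa> * x)) = 0"
    \<comment> \<open>The \<open>min\<close> keeps the points inside the ball on which the local
      expansion of \<open>ud\<close> is known.\<close>
    proof (rule two_series_vanish[OF A c, of "\<kappa> * min \<eta> \<delta>"])
      show "\<kappa> * min \<eta> \<delta> > 0" using \<kappa> \<open>\<eta> > 0\<close> r by simp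
      show "cmod (of_real \<kappa> * x) < \<kappa> * r" using \<kappa> r by (simp add: norm_mult)
      fix z assume z: "cmod z < \<kappa> * min \<eta> \<delta>"
      define y where "y = z / of_real \<kappa>"
      have "cmod y < min \<eta> \<delta>" using z \<kappa> by (simp add: y_def norm_divide pos_divide_less_eq mult.commute del: min_less_iff_conj)
      moreover have zy: "z = of_real \<kappa> * y" using \<kappa> by (simp add: y_def)
      ultimately show "(\<Sum>\<^sub>\<infinity>n. A n * wave_U n (of_real \<kappa> * q + z)) + (\<Sum>\<^sub>\<infinity>n. cV q n * wave_U n z) = 0"
        unfolding zy using u[of y] zero[of y] by simp
    qed
    then show "ui (q + x) + ud (q + x) = 0" unfolding u[OF x] .
  qed
  have vanish: "(\<forall>x\<in>C. ui x + ud x = 0) \<longleftrightarrow> (\<forall>n. cV 0 n = - A n)"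
  proof
    assume "\<forall>x\<in>C. ui x + ud x = 0"
    then show "\<forall>n. cV 0 n = - A n" unfolding vanish_near[symmetric] using e by auto
  next
    assume "\<forall>n. cV 0 n = - A n"
    then have zero: "ui (0 + x) + ud (0 + x) = 0" if "cmod x < e" for x
      unfolding vanish_near[symmetric] using that by simp
    show "\<forall>x\<in>C. ui x + ud x = 0"
    proof
      fix x assume x: "x \<in> C"
      have "0 \<in> C" using e by auto
      then show "ui x + ud x = 0"
        using vanishing_propagates[of C "\<lambda>x. ui x + ud x" 0 e x] C_open C_connected step e(1) zero x by blast
    qed
  qed
  have radiate: "far_field_amplitude k ud (\<lambda>\<theta>. 0) \<longleftrightarrow> (\<forall>n. cU n = 0)"
  proof
    assume "far_field_amplitude k ud (\<lambda>\<theta>. 0)"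
    then have "ud \<in> O[at_infinity](\<lambda>x. of_real ((k * cmod x) powr (-3/2)))"
      by (simp add: far_field_amplitude_def)
    then obtain c where c: "c > 0"
      "\<forall>\<^sub>F x in at_infinity. norm (ud x) \<le> c * norm (complex_of_real ((k * cmod x) powr (-3/2)))"
      by (rule landau_o.bigE)
    then obtain B where B: "\<And>x. cmod x \<ge> B \<Longrightarrow> norm (ud x) \<le> c * (k * cmod x) powr (-3/2)"
      by (auto simp: eventually_at_infinity)
    define R' where "R' = \<kappa> * max 1 (max B R)"
    show "\<forall>n. cU n = 0"
    proof
      fix n
      show "cU n = 0"
      proof (rule wave_V_series_unique[of R' cU "\<lambda>z. ud (z / of_real \<kappa>)" c])
        fix z assume z: "cmod z > R'"
        define x where "x = z / of_real \<kappa>"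
        have zx: "z = of_real \<kappa> * x" using \<kappa> by (simp add: x_def)
        have x: "cmod x > max 1 (max B R)" using z \<kappa> by (simp add: zx R'_def norm_mult)
        show "((\<lambda>n. cU n * wave_V n z) has_sum ud (z / of_real \<kappa>)) UNIV"
          using far[of x] x by (simp add: zx[symmetric] x_def[symmetric])
        have zpos: "cmod z > 0" using x \<kappa> by (auto simp: zx)
        have "norm (ud x) \<le> c * (k * cmod x) powr (-3/2)" using x by (intro B) auto
        also have "k * cmod x = 2 * cmod z" using \<kappa> by (simp add: zx k norm_mult)
        \<comment> \<open>The constant \<open>2 powr (-3/2)\<close> is at most 1 and is
          dropped.\<close>
        also have "(2 * cmod z) powr (-3/2) \<le> cmod z powr (-3/2)"
          using zpos by (intro powr_mono2') auto
        also have "cmod z powr (-3/2) = 1 / (cmod z * sqrt (cmod z))"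
        proof -
          have "cmod z powr (3/2) = cmod z powr (1 + 1/2)" by simp
          also have "\<dots> = cmod z * sqrt (cmod z)"
            using zpos by (subst powr_add) (simp add: powr_half_sqrt)
          finally show ?thesis by (simp add: powr_minus_divide)
        qed
        finally show "norm (ud (z / of_real \<kappa>)) \<le> c / (cmod z * sqrt (cmod z))"
          using c(1) by (simp add: x_def mult_left_mono)
      qed
    qed
  next
    \<comment> \<open>In this direction \<open>ud\<close> is exactly 0 beyond the radius
      \<open>R\<close>, which makes the far-field estimate immediate.\<close>
    assume "\<forall>n. cU n = 0"
    then have "((\<lambda>n. 0) has_sum ud x) (UNIV :: int set)" if "cmod x > R" for x using far[OF that] by simp
    then have zero: "ud x = 0" if "cmod x > R" for x using that has_sum_unique has_sum_0_simp by blast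
    have "\<forall>\<^sub>F x in at_infinity. norm (ud x) \<le> 1 * norm (complex_of_real ((k * cmod x) powr (-3/2)))"
      unfolding eventually_at_infinity by (intro exI[of _ "R + 1"]) (auto simp: zero)
    then show "far_field_amplitude k ud (\<lambda>\<theta>. 0)"
      unfolding far_field_amplitude_def by (intro bigoI[where c = 1]) simp
  qed
  show ?thesis
    unfolding vanish radiate condU condV by auto
qed

end
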